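(* Let $I\subseteq[0,\frac{\pi}{4}]$ be an interval of positive length $|I|$, and for $0<\varepsilon<\frac12$ let $\tilde\mu^I_\varepsilon$ and $\mu^I_\varepsilon$ be the probability measures on $[0,\infty)$ defined by $$\tilde\mu^I_\varepsilon(f)=\frac1{|I|}\int_I f\big(\varepsilon\tilde\tau_\varepsilon(\omega)\big)\,d\omega,\qquad \mu^I_\varepsilon(f)=\frac1{|I|}\int_I f\big(\varepsilon l_\varepsilon(\omega)\big)\,d\omega,\qquad f\in C_c([0,\infty)).$$ There exist probability measures $\tilde\mu$ (not depending on $I$) and $\mu^I$ on $[0,\sqrt2]$ such that $$\tilde\mu^I_\varepsilon\to\tilde\mu\quad\text{and}\quad \mu^I_\varepsilon\to\mu^I\quad\text{weakly as }\varepsilon\to0^+ .$$ Moreover, for every integer $n\ge1$, the moments of $\tilde\mu$ and $\mu^I$ are $$\int_0^\infty t^n\,d\tilde\mu(t)=c_n\qquad\text{and respectively}\qquad \int_0^\infty t^n\,d\mu^I(t)=\frac{c_n}{|I|}\int_I\frac{dx}{\cos^n x},$$ where $$c_n=\frac{12}{\pi^2}\int_0^{1/2}\left( x\big(x^{n-1}+(1-x)^{n-1}\big)+\frac{1-(1-x)^n}{nx(1-x)}-\frac{1-(1-x)^{n+1}}{(n+1)x(1-x)}\right)dx .$$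
   Context: Let $\mathbb{Z}^{2*}=\mathbb{Z}^2\setminus\{(0,0)\}$. For $0<\varepsilon<\frac12$ put $D_\varepsilon=\{(x,y)\in\mathbb{R}^2:x^2+y^2=\varepsilon^2\}$ and $C_\varepsilon=\big(\{0\}\times[-\varepsilon,\varepsilon]\big)\cup\big([-\varepsilon,\varepsilon]\times\{0\}\big)$. For a direction (angle) $\omega$, $$\tilde\tau_\varepsilon(\omega)=\inf\{\tau>0:(\tau\cos\omega,\tau\sin\omega)\in D_\varepsilon+\mathbb{Z}^{2*}\},\qquad l_\varepsilon(\omega)=\inf\{\tau>0:(\tau\cos\omega,\tau\sin\omega)\in C_\varepsilon+\mathbb{Z}^{2*}\}$$ are the free path lengths from the origin with circular, respectively cross-like, scatterers at the nonzero integer lattice points. $C_c([0,\infty))$ is the space of compactly supported continuous functions on $[0,\infty)$; measures on $[0,\sqrt2]$ are viewed as measures on $[0,\infty)$ supported in $[0,\sqrt2]$. *)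

theory Defs
  imports "HOL-Probability.Probability" "HOL-Library.Set_Algebras"
begin

definition nonzero_lattice :: "(real \<times> real) set" where
  "nonzero_lattice = (\<int> \<times> \<int>) - {(0, 0)}"

definition circle_scatterer :: "real \<Rightarrow> (real \<times> real) set" where
  "circle_scatterer \<epsilon> = {(x, y). x\<^sup>2 + y\<^sup>2 = \<epsilon>\<^sup>2}"

definition cross_scatterer :: "real \<Rightarrow> (real \<times> real) set" where
  "cross_scatterer \<epsilon> = ({0} \<times> {-\<epsilon>..\<epsilon>}) \<union> ({-\<epsilon>..\<epsilon>} \<times> {0})"

definition hitting_times :: "(real \<times> real) set \<Rightarrow> real \<Rightarrow> real set" where
  "hitting_times S \<omega> = {\<tau>. \<tau> > 0 \<and> (\<tau> * cos \<omega>, \<tau> * sin \<omega>) \<in> S}"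

text \<open>
  In the next two definitions \<open>+\<close> is the Minkowski sum of sets. \<open>Inf\<close> of the empty set is
  unspecified on the reals; it does not occur for directions in \<open>[0, \<pi>/4]\<close>, by the lemmas
  \<open>circle_hitting_times_nonempty\<close> and \<open>cross_hitting_times_nonempty\<close> below.
\<close>

definition circle_path :: "real \<Rightarrow> real \<Rightarrow> real" where
  "circle_path \<epsilon> \<omega> = Inf (hitting_times (circle_scatterer \<epsilon> + nonzero_lattice) \<omega>)"

definition cross_path :: "real \<Rightarrow> real \<Rightarrow> real" where
  "cross_path \<epsilon> \<omega> = Inf (hitting_times (cross_scatterer \<epsilon> + nonzero_lattice) \<omega>)"

text \<open>
  The laws of the normalized free path lengths, as push-forwards of the uniform distribution
  on \<open>I\<close>. Lemmas \<open>integral_circle_law\<close> and \<open>integral_cross_law\<close> below give the description of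
  these measures as functionals on test functions. Measures on \<open>[0,\<infinity>)\<close> are represented as
  Borel measures on the real line that are concentrated there.
\<close>

definition circle_law :: "real set \<Rightarrow> real \<Rightarrow> real measure" where
  "circle_law I \<epsilon> = distr (uniform_measure lborel I) borel (\<lambda>\<omega>. \<epsilon> * circle_path \<epsilon> \<omega>)"

definition cross_law :: "real set \<Rightarrow> real \<Rightarrow> real measure" where
  "cross_law I \<epsilon> = distr (uniform_measure lborel I) borel (\<lambda>\<omega>. \<epsilon> * cross_path \<epsilon> \<omega>)"

definition probability_on :: "real set \<Rightarrow> real measure \<Rightarrow> bool" where
  "probability_on A M \<longleftrightarrow> real_distribution M \<and> (AE t in M. t \<in> A)"

text \<open>
  Weak convergence along an arbitrary filter. The library notion \<open>weak_conv_m\<close> is restricted to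
  sequences, where the two agree (lemma \<open>weakly_tendsto_sequentially_iff\<close>).
\<close>

definition weakly_tendsto :: "('b \<Rightarrow> real measure) \<Rightarrow> real measure \<Rightarrow> 'b filter \<Rightarrow> bool" where
  "weakly_tendsto \<mu> M F \<longleftrightarrow>
     (\<forall>f::real \<Rightarrow> real. continuous_on UNIV f \<and> bounded (range f) \<longrightarrow>
        ((\<lambda>\<epsilon>. LINT t|\<mu> \<epsilon>. f t) \<longlongrightarrow> (LINT t|M. f t)) F)"

definition moment_const :: "nat \<Rightarrow> real" where
  "moment_const n = 12 / pi\<^sup>2 *
     (LINT x:{0..1/2}|lborel.
        x * (x ^ (n - 1) + (1 - x) ^ (n - 1))
        + (1 - (1 - x) ^ n) / (real n * x * (1 - x))
        - (1 - (1 - x) ^ (n + 1)) / (real (n + 1) * x * (1 - x)))"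

lemma weakly_tendsto_sequentially_iff:
  assumes "\<And>n. real_distribution (\<mu> n)" "real_distribution M"
  shows "weakly_tendsto \<mu> M sequentially \<longleftrightarrow> weak_conv_m \<mu> M"
proof
  assume *: "weakly_tendsto \<mu> M sequentially"
  show "weak_conv_m \<mu> M"
  proof (rule integral_bdd_continuous_conv_imp_weak_conv[OF assms])
    fix f :: "real \<Rightarrow> real"
    assume "\<And>x. isCont f x" "\<And>x. \<bar>f x\<bar> \<le> 1"
    then have "continuous_on UNIV f" "bounded (range f)"
      by (auto simp: continuous_at_imp_continuous_on bounded_iff)
    with * show "(\<lambda>n. integral\<^sup>L (\<mu> n) f) \<longlonglongrightarrow> integral\<^sup>L M f"
      unfolding weakly_tendsto_def by blast
  qed
next
  assume *: "weak_conv_m \<mu> M"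
  show "weakly_tendsto \<mu> M sequentially"
    unfolding weakly_tendsto_def
  proof (intro allI impI, elim conjE)
    fix f :: "real \<Rightarrow> real"
    assume c: "continuous_on UNIV f" and "bounded (range f)"
    then obtain B where B: "\<And>x. norm (f x) \<le> B"
      by (auto simp: bounded_iff)
    have "\<And>x. isCont f x"
      using c by (simp add: continuous_on_eq_continuous_at)
    then show "(\<lambda>n. integral\<^sup>L (\<mu> n) f) \<longlonglongrightarrow> integral\<^sup>L M f"
      by (rule weak_conv_imp_integral_bdd_continuous_conv[OF assms * _ B])
  qed
qed

lemma lattice_hit:
  assumes "0 < \<epsilon>" "0 \<le> \<omega>" "\<omega> \<le> pi/4"
  obtains k h :: int where "0 < k" "\<bar>of_int k * tan \<omega> - of_int h\<bar> < \<epsilon>"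
proof -
  obtain N :: nat where N: "N > 0" "1 / real N < \<epsilon>"
    using assms(1) by (metis nat_approx_posE zero_less_Suc)
  show thesis
    by (rule Dirichlet_approx[OF N(1), of "tan \<omega>"]) (use N that less_trans in blast)
qed

lemma cos_pos_angle: "0 < cos \<omega>" if "0 \<le> \<omega>" "\<omega> \<le> pi/4"
  by (rule cos_gt_zero_pi) (use that pi_gt_zero in linarith)+

lemma cross_hitting_times_nonempty:
  assumes "0 < \<epsilon>" "0 \<le> \<omega>" "\<omega> \<le> pi/4"
  shows "hitting_times (cross_scatterer \<epsilon> + nonzero_lattice) \<omega> \<noteq> {}"
proof -
  obtain k h :: int where kh: "0 < k" "\<bar>of_int k * tan \<omega> - of_int h\<bar> < \<epsilon>"
    using lattice_hit[OF assms] .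
  have c: "0 < cos \<omega>"
    using cos_pos_angle assms by blast
  let ?t = "of_int k / cos \<omega>"
  have "(?t * cos \<omega>, ?t * sin \<omega>) = (0, of_int k * tan \<omega> - of_int h) + (of_int k, of_int h)"
    using c by (simp add: tan_def)
  also have "\<dots> \<in> cross_scatterer \<epsilon> + nonzero_lattice"
    by (intro set_plus_intro)
       (use kh in \<open>auto simp: cross_scatterer_def nonzero_lattice_def abs_less_iff\<close>)
  finally have "?t \<in> hitting_times (cross_scatterer \<epsilon> + nonzero_lattice) \<omega>"
    using kh c by (simp add: hitting_times_def)
  then show ?thesis by blast
qed

lemma circle_hitting_times_nonempty:
  assumes "0 < \<epsilon>" "\<epsilon> < 1/2" "0 \<le> \<omega>" "\<omega> \<le> pi/4"
  shows "hitting_times (circle_scatterer \<epsilon> + nonzero_lattice) \<omega> \<noteq> {}"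
proof -
  obtain k h :: int where kh: "0 < k" "\<bar>of_int k * tan \<omega> - of_int h\<bar> < \<epsilon>"
    using lattice_hit[of \<epsilon> \<omega>] assms by blast
  have c: "0 < cos \<omega>"
    using cos_pos_angle assms by blast
  let ?t = "of_int k / cos \<omega>"
  let ?g = "\<lambda>t. (t * cos \<omega> - of_int k)\<^sup>2 + (t * sin \<omega> - of_int h)\<^sup>2"
  have e: "\<epsilon>\<^sup>2 < 1"
    using assms by (simp add: power_less_one_iff)
  have "(1::real) \<le> (of_int k)\<^sup>2"
    using kh by (simp add: one_le_power)
  then have g0: "\<epsilon>\<^sup>2 \<le> ?g 0" "?g 0 \<noteq> \<epsilon>\<^sup>2"
    using e by (auto simp: power2_eq_square) (smt (verit) zero_le_square)+
  have "?g ?t = (of_int k * tan \<omega> - of_int h)\<^sup>2"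
    using c by (simp add: tan_def)
  also have "\<dots> \<le> \<epsilon>\<^sup>2"
    using kh assms by (simp add: abs_le_square_iff[symmetric])
  finally have g1: "?g ?t \<le> \<epsilon>\<^sup>2" .
  have "\<exists>t\<ge>0. t \<le> ?t \<and> ?g t = \<epsilon>\<^sup>2"
    by (rule IVT2'[where f="?g", OF g1 g0(1)]) (use kh c in \<open>auto intro!: continuous_intros\<close>)
  then obtain t where t: "0 \<le> t" "?g t = \<epsilon>\<^sup>2" by blast
  then have "0 < t"
    using g0(2) by (cases "t = 0") auto
  have "(t * cos \<omega>, t * sin \<omega>)
      = (t * cos \<omega> - of_int k, t * sin \<omega> - of_int h) + (of_int k, of_int h)" by simp
  also have "\<dots> \<in> circle_scatterer \<epsilon> + nonzero_lattice"
    by (intro set_plus_intro)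
       (use kh t in \<open>auto simp: circle_scatterer_def nonzero_lattice_def\<close>)
  finally have "t \<in> hitting_times (circle_scatterer \<epsilon> + nonzero_lattice) \<omega>"
    using \<open>0 < t\<close> by (simp add: hitting_times_def)
  then show ?thesis by blast
qed

lemma Inf_hitting_times_nonneg:
  "hitting_times S \<omega> \<noteq> {} \<Longrightarrow> 0 \<le> Inf (hitting_times S \<omega>)"
  by (rule cInf_greatest) (auto simp: hitting_times_def)

lemma borel_hitting_directions:
  assumes K: "compact K" and L: "countable L"
  shows "{\<omega>. \<exists>\<tau>\<in>hitting_times (K + L) \<omega>. \<tau> < t} \<in> sets borel"
proof -
  define P where "P z n m = {p :: real \<times> real. fst p \<in> {1 / real (Suc n)..t - 1 / real (Suc n)} \<and>
      snd p \<in> {- real m..real m} \<and> (fst p * cos (snd p), fst p * sin (snd p)) \<in> (+) z ` K}"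
    for z n m
  have "compact (P z n m)" for z n m
  proof -
    let ?C = "{1 / real (Suc n)..t - 1 / real (Suc n)} \<times> {- real m..real m}"
    let ?h = "\<lambda>p::real \<times> real. (fst p * cos (snd p), fst p * sin (snd p))"
    have "closed ((+) z ` K)"
      using K by (intro compact_imp_closed compact_translation)
    then have "closed (?h -` ((+) z ` K))"
      by (intro continuous_closed_vimage continuous_intros)
    then have "compact (?C \<inter> ?h -` ((+) z ` K))"
      by (intro compact_Int_closed compact_Times compact_Icc)
    moreover have "P z n m = ?C \<inter> ?h -` ((+) z ` K)"
      by (auto simp: P_def)
    ultimately show ?thesis by simp
  qed
  then have "compact (snd ` P z n m)" for z n m
    by (intro compact_continuous_image continuous_intros)
  then have "(\<Union>z\<in>L. \<Union>n m. snd ` P z n m) \<in> sets borel"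
    by (intro sets.countable_UN'[OF L] sets.countable_UN)
       (use borel_compact in blast)
  moreover have "{\<omega>. \<exists>\<tau>\<in>hitting_times (K + L) \<omega>. \<tau> < t} = (\<Union>z\<in>L. \<Union>n m. snd ` P z n m)"
  proof (intro set_eqI iffI)
    fix \<omega> assume "\<omega> \<in> {\<omega>. \<exists>\<tau>\<in>hitting_times (K + L) \<omega>. \<tau> < t}"
    then obtain \<tau> where \<tau>: "0 < \<tau>" "\<tau> < t" "(\<tau> * cos \<omega>, \<tau> * sin \<omega>) \<in> K + L"
      by (auto simp: hitting_times_def)
    then obtain d z where dz: "d \<in> K" "z \<in> L" "(\<tau> * cos \<omega>, \<tau> * sin \<omega>) = d + z"
      by (auto elim!: set_plus_elim)
    obtain n where n: "1 / real (Suc n) < min \<tau> (t - \<tau>)"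
      using nat_approx_posE[of "min \<tau> (t - \<tau>)"] \<tau> by auto
    obtain m :: nat where "\<bar>\<omega>\<bar> \<le> real m"
      using real_arch_simple by blast
    with n dz have "(\<tau>, \<omega>) \<in> P z n m"
      by (auto simp: P_def abs_le_iff add.commute)
    with dz(2) show "\<omega> \<in> (\<Union>z\<in>L. \<Union>n m. snd ` P z n m)" by force
  next
    fix \<omega> assume "\<omega> \<in> (\<Union>z\<in>L. \<Union>n m. snd ` P z n m)"
    then obtain z n m \<tau> where z: "z \<in> L" and "(\<tau>, \<omega>) \<in> P z n m" by auto
    then have 1: "1 / real (Suc n) \<le> \<tau>" "\<tau> \<le> t - 1 / real (Suc n)"
      and "(\<tau> * cos \<omega>, \<tau> * sin \<omega>) \<in> (+) z ` K" by (auto simp: P_def)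
    then have "(\<tau> * cos \<omega>, \<tau> * sin \<omega>) \<in> K + L"
      using z by (metis (no_types, lifting) add.commute imageE set_plus_intro)
    moreover have "0 < \<tau>" "\<tau> < t"
      using 1 by (smt (verit) divide_pos_pos of_nat_0_less_iff zero_less_Suc)+
    ultimately show "\<omega> \<in> {\<omega>. \<exists>\<tau>\<in>hitting_times (K + L) \<omega>. \<tau> < t}"
      by (auto simp: hitting_times_def)
  qed
  ultimately show ?thesis by simp
qed

lemma borel_measurable_Inf_hitting_times:
  assumes "compact K" "countable L"
  shows "(\<lambda>\<omega>. Inf (hitting_times (K + L) \<omega>)) \<in> borel_measurable borel"
proof (rule borel_measurableI_less)
  fix t :: real
  let ?H = "hitting_times (K + L)"
  let ?A = "\<lambda>t. {\<omega>. \<exists>\<tau>\<in>?H \<omega>. \<tau> < t}"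
  have 1: "?A t \<in> sets borel" for t
    by (rule borel_hitting_directions[OF assms])
  have "{\<omega>. ?H \<omega> \<noteq> {}} = (\<Union>n. ?A (real n))"
    using reals_Archimedean2 by fastforce
  then have 2: "{\<omega>. ?H \<omega> \<noteq> {}} \<in> sets borel"
    using 1 by auto
  have bdd: "bdd_below (?H \<omega>)" for \<omega>
    by (rule bdd_belowI[of _ 0]) (auto simp: hitting_times_def)
  have "{\<omega>. Inf (?H \<omega>) < t}
      = ?A t \<union> (if Inf ({}::real set) < t then - {\<omega>. ?H \<omega> \<noteq> {}} else {})"
    by (auto simp: cInf_less_iff bdd split: if_splits) (metis bdd cInf_less_iff equals0D)+
  then show "{\<omega> \<in> space borel. Inf (?H \<omega>) < t} \<in> sets borel"
    using 1 2 by auto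
qed

lemma countable_nonzero_lattice: "countable nonzero_lattice"
proof -
  have "countable (\<int> :: real set)"
    by (simp add: Ints_def)
  then show ?thesis
    by (auto simp: nonzero_lattice_def)
qed

lemma borel_measurable_cross_path [measurable]: "cross_path \<epsilon> \<in> borel_measurable borel"
proof -
  have "compact (cross_scatterer \<epsilon>)"
    unfolding cross_scatterer_def by (intro compact_Un compact_Times compact_Icc) auto
  from borel_measurable_Inf_hitting_times[OF this countable_nonzero_lattice]
  show ?thesis by (simp add: cross_path_def[abs_def])
qed

lemma borel_measurable_circle_path [measurable]: "circle_path \<epsilon> \<in> borel_measurable borel"
proof -
  have "x\<^sup>2 + y\<^sup>2 = \<epsilon>\<^sup>2 \<longleftrightarrow> sqrt (x\<^sup>2 + y\<^sup>2) = \<bar>\<epsilon>\<bar>" for x y :: real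
    by (metis real_sqrt_abs real_sqrt_eq_iff)
  then have "circle_scatterer \<epsilon> = sphere 0 \<bar>\<epsilon>\<bar>"
    by (simp add: circle_scatterer_def set_eq_iff norm_prod_def)
  then have "compact (circle_scatterer \<epsilon>)" by simp
  from borel_measurable_Inf_hitting_times[OF this countable_nonzero_lattice]
  show ?thesis by (simp add: circle_path_def[abs_def])
qed

lemma uniform_law:
  fixes I :: "real set" and g f :: "real \<Rightarrow> real"
  assumes I: "is_interval I" "I \<subseteq> {0..pi/4}" "0 < measure lborel I"
    and g [measurable]: "g \<in> borel_measurable borel" and nonneg: "\<And>\<omega>. \<omega> \<in> I \<Longrightarrow> 0 \<le> g \<omega>"
  defines "M \<equiv> distr (uniform_measure lborel I) borel g"
  shows "probability_on {0..} M"
    and "continuous_on {0..} f \<Longrightarrow>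
      (LINT t:{0..}|M. f t) = (LINT \<omega>:I|lborel. f (g \<omega>)) / measure lborel I"
proof -
  have [measurable]: "I \<in> sets borel"
    using I(1) by (rule real_interval_borel_measurable)
  have "emeasure lborel I \<le> emeasure lborel {0..pi/4}"
    using I(2) by (intro emeasure_mono) auto
  then have fin: "emeasure lborel I \<noteq> \<infinity>"
    by (auto simp: top_unique)
  have pos: "emeasure lborel I \<noteq> 0"
    using I(3) by (auto simp: measure_def)
  interpret U: prob_space "uniform_measure lborel I"
    using fin pos by (intro prob_space_uniform_measure)
  interpret M: prob_space M
    unfolding M_def by (intro U.prob_space_distr) simp
  have "real_distribution M"
    by standard (simp add: M_def)
  moreover have "AE t in M. t \<in> {0..}"
    unfolding M_def using nonneg
    by (subst AE_distr_iff) (auto intro!: AE_uniform_measureI)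
  ultimately show "probability_on {0..} M"
    by (simp add: probability_on_def)
  assume "continuous_on {0..} f"
  then have f [measurable]: "(\<lambda>t. indicator {0..} t *\<^sub>R f t) \<in> borel_measurable borel"
    by (intro borel_measurable_continuous_on_indicator) auto
  have e: "emeasure lborel I = ennreal (measure lborel I)"
    using fin by (simp add: emeasure_eq_ennreal_measure)
  have "uniform_measure lborel I = density lborel (\<lambda>x. ennreal (indicator I x / measure lborel I))"
    unfolding uniform_measure_def e
    by (intro arg_cong[where f="density lborel"] ext)
       (use I(3) in \<open>auto simp: divide_ennreal[symmetric] ennreal_indicator split: split_indicator\<close>)
  note U = this
  have "(LINT t:{0..}|M. f t)
      = (LINT \<omega>|uniform_measure lborel I. indicator {0..} (g \<omega>) *\<^sub>R f (g \<omega>))"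
    unfolding M_def set_lebesgue_integral_def
    by (rule integral_distr[OF _ f]) simp
  also have "\<dots> = (LINT \<omega>|lborel.
      (indicator I \<omega> / measure lborel I) *\<^sub>R (indicator {0..} (g \<omega>) *\<^sub>R f (g \<omega>)))"
    unfolding U using measurable_compose[OF g f] by (intro integral_density) auto
  also have "\<dots> = (LINT \<omega>|lborel. (indicator I \<omega> *\<^sub>R f (g \<omega>)) / measure lborel I)"
    using nonneg by (intro Bochner_Integration.integral_cong) (auto split: split_indicator)
  finally show "(LINT t:{0..}|M. f t) = (LINT \<omega>:I|lborel. f (g \<omega>)) / measure lborel I"
    by (simp add: set_lebesgue_integral_def)
qed

context
  fixes I :: "real set" and \<epsilon> :: real
  assumes I: "is_interval I" "I \<subseteq> {0..pi/4}" "0 < measure lborel I"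
    and \<epsilon>: "0 < \<epsilon>" "\<epsilon> < 1/2"
begin

lemma circle_path_nonneg: "\<omega> \<in> I \<Longrightarrow> 0 \<le> \<epsilon> * circle_path \<epsilon> \<omega>"
  using I \<epsilon> circle_hitting_times_nonempty[of \<epsilon> \<omega>]
  by (auto simp: circle_path_def intro!: mult_nonneg_nonneg Inf_hitting_times_nonneg)

lemma cross_path_nonneg: "\<omega> \<in> I \<Longrightarrow> 0 \<le> \<epsilon> * cross_path \<epsilon> \<omega>"
  using I \<epsilon> cross_hitting_times_nonempty[of \<epsilon> \<omega>]
  by (auto simp: cross_path_def intro!: mult_nonneg_nonneg Inf_hitting_times_nonneg)

lemma probability_on_circle_law: "probability_on {0..} (circle_law I \<epsilon>)"
  unfolding circle_law_def by (rule uniform_law(1)[OF I _ circle_path_nonneg]) measurable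

lemma probability_on_cross_law: "probability_on {0..} (cross_law I \<epsilon>)"
  unfolding cross_law_def by (rule uniform_law(1)[OF I _ cross_path_nonneg]) measurable

lemma integral_circle_law:
  "continuous_on {0..} f \<Longrightarrow> (LINT t:{0..}|circle_law I \<epsilon>. f t)
     = 1 / measure lborel I * (LINT \<omega>:I|lborel. f (\<epsilon> * circle_path \<epsilon> \<omega>))"
  unfolding circle_law_def
  by (subst uniform_law(2)[OF I _ circle_path_nonneg]) auto

lemma integral_cross_law:
  "continuous_on {0..} f \<Longrightarrow> (LINT t:{0..}|cross_law I \<epsilon>. f t)
     = 1 / measure lborel I * (LINT \<omega>:I|lborel. f (\<epsilon> * cross_path \<epsilon> \<omega>))"
  unfolding cross_law_def
  by (subst uniform_law(2)[OF I _ cross_path_nonneg]) auto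

end

end

theory Submission
  imports Defs "HOL-Number_Theory.Totient" "HOL-Real_Asymp.Real_Asymp"
begin

text \<open>
  For a direction \<open>\<omega>\<close> in \<open>[0, \<pi>/4]\<close> put \<open>t = tan \<omega>\<close>. The ray meets the scatterer at \<open>(q, a)\<close> essentially
  when \<open>\<bar>q t - a\<bar> \<le> \<delta>\<close>, where \<open>\<delta> = \<epsilon>\<close> for crosses and \<open>\<delta> = \<epsilon> / cos \<omega>\<close> for circles, and it does so at
  time \<open>q / cos \<omega>\<close> up to \<open>O(\<epsilon>)\<close>. The horizontal arm of a cross is never hit without the vertical one,
  because \<open>tan \<omega> \<le> 1\<close>. So both laws are governed by the least denominator \<open>q\<close> for which \<open>q t\<close> is within
  \<open>\<delta>\<close> of an integer. The theorem follows once it is known that, for \<open>t\<close> uniform in any fixed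
  subinterval of \<open>[0, 1]\<close>, the variable \<open>\<delta> q\<close> converges in law to one and the same density on \<open>[0, 1]\<close>.
  For circles the factor \<open>1 / cos \<omega>\<close> is absorbed by \<open>\<delta>\<close>, so the limit does not see the interval; for crosses
  it remains, and the limit is the law of \<open>Y / cos \<omega>\<close> with \<open>Y\<close> and \<open>\<omega>\<close> independent. This accounts for the
  factor \<open>\<integral> dx / cos\<^sup>n x\<close> in the moments.

  The points \<open>t\<close> for which \<open>q\<close> is the least denominator lie near the fractions \<open>a / q\<close> in lowest terms.
  With \<open>t = (a + s) / q\<close> and \<open>u = \<delta> q < 1\<close>, a smaller denominator \<open>q'\<close> can interfere only if
  \<open>q' a\<close> is congruent to \<open>1\<close> or \<open>-1\<close> modulo \<open>q\<close>. Therefore the length of the good set at \<open>a / q\<close> is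
  \<open>(w x + w (q - x)) / q\<close>, where \<open>x\<close> is the inverse of \<open>a\<close> modulo \<open>q\<close> and \<open>w x = min \<delta> ((1 - u) / x)\<close>
  (\<open>measure_first_approx_at\<close>).

  To sum this over the fractions \<open>a / q\<close> in an interval one needs the joint equidistribution of
  \<open>a / q\<close> and \<open>x / q\<close>. It comes from a bound for Kloosterman sums (\<open>kloosterman_bound\<close>), by Kloosterman's own argument: the sum
  \<open>K(m, n)\<close> does not change under \<open>(m, n) \<mapsto> (m l, n l\<^sup>-\<^sup>1)\<close>, so that its fourth power is bounded by an average of fourth powers, and the full fourth
  moment counts solutions of a system of congruences that reduces to a product of three linear factors.
  Completing the incomplete sums gives an error that tends to zero in the mean over \<open>q\<close>
  (\<open>inverse_pairs_equidistributed\<close>, \<open>equidistribution_error_cesaro\<close>). The remaining sum over \<open>q\<close> has weights \<open>\<phi>(q) / q\<close>, whose mean is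
  \<open>6 / \<pi>\<^sup>2\<close> (\<open>totient_ratio_mean\<close>), and is a Riemann sum of \<open>gap_profile\<close>, the normalised integral of
  \<open>w\<close>. This gives the distribution function \<open>limit_cdf\<close> (\<open>measure_approx_within_tendsto\<close>); it has total mass one by Dirichlet's approximation theorem.

  The dependence of \<open>\<delta>\<close> on \<open>\<omega>\<close>, the change of variables \<open>t = tan \<omega>\<close> and the errors \<open>O(\<epsilon>)\<close> are all handled
  at once by squeezing on short intervals of directions, since a set that catches more time or a larger
  \<open>\<delta>\<close> only grows (\<open>directions_tendsto\<close>). The moments follow by one integration by parts (\<open>moment_const_eq\<close>).
\<close>

section \<open>Roots of unity and counting modulo q\<close>

definition root_unity :: "nat \<Rightarrow> int \<Rightarrow> complex" where
  "root_unity q k = cis (2 * pi * of_int k / of_nat q)"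

lemma root_unity_0 [simp]: "root_unity q 0 = 1"
  by (simp add: root_unity_def)

lemma root_unity_add: "root_unity q (a + b) = root_unity q a * root_unity q b"
  by (simp add: root_unity_def cis_mult add_divide_distrib distrib_left)

lemma norm_root_unity [simp]: "norm (root_unity q k) = 1"
  by (simp add: root_unity_def)

lemma cnj_root_unity: "cnj (root_unity q k) = root_unity q (- k)"
  by (simp add: root_unity_def cis_cnj)

lemma root_unity_power: "root_unity q k ^ n = root_unity q (int n * k)"
  by (induction n) (simp_all add: root_unity_add algebra_simps)

lemma root_unity_multiple: "q > 0 \<Longrightarrow> root_unity q (int q * k) = 1"
  using cis_multiple_2pi[of "of_int k"] by (simp add: root_unity_def mult_ac)

lemma root_unity_cong:
  assumes "q > 0" "[a = b] (mod int q)"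
  shows "root_unity q a = root_unity q b"
proof -
  obtain k where "a = b + int q * k"
    using assms(2) by (metis cong_iff_lin cong_sym)
  then show ?thesis by (simp add: root_unity_add root_unity_multiple assms(1))
qed

lemma root_unity_eq_1_iff:
  assumes "q > 0"
  shows "root_unity q k = 1 \<longleftrightarrow> int q dvd k"
proof
  assume "root_unity q k = 1"
  then have "cos (2 * pi * of_int k / of_nat q) = 1"
    by (simp add: root_unity_def complex_eq_iff)
  then obtain n :: int where "2 * pi * of_int k / of_nat q = of_int n * 2 * pi"
    using cos_one_2pi_int by blast
  then have "of_int k = (of_int n * of_nat q :: real)"
    using assms by (simp add: field_simps)
  then have "k = n * int q"
    by (metis of_int_eq_iff of_int_mult of_int_of_nat_eq)
  then show "int q dvd k" by simp
next
  assume "int q dvd k"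
  then show "root_unity q k = 1"
    by (auto elim!: dvdE simp: root_unity_multiple assms)
qed

lemma sum_int_residues: "(\<Sum>n\<in>{0..<int q}. f n) = (\<Sum>n<q. f (int n))"
  by (rule sum.reindex_bij_witness[of _ int nat]) auto

lemma root_unity_orthogonality:
  assumes "q > 0"
  shows "(\<Sum>n\<in>{0..<int q}. root_unity q (n * k)) = (if int q dvd k then of_nat q else 0)"
proof -
  have "(\<Sum>n\<in>{0..<int q}. root_unity q (n * k)) = (\<Sum>n<q. root_unity q k ^ n)"
    by (simp add: sum_int_residues root_unity_power)
  moreover have "root_unity q k ^ q = 1"
    by (simp add: root_unity_power root_unity_multiple assms)
  ultimately show ?thesis
    using root_unity_eq_1_iff[OF assms, of k] by (auto simp: sum_gp_strict)
qed

text \<open>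
  The double sum over frequencies detects the coincidences of the pairs \<open>(s p, t p)\<close> modulo \<open>q\<close>. With
  \<open>P\<close> the set of pairs of points of the modular hyperbola it turns a fourth moment of Kloosterman sums into a count.
\<close>

lemma parseval_two_variables:
  fixes s t :: "'a \<Rightarrow> int"
  assumes "q > 0" "finite P"
  shows "(\<Sum>m\<in>{0..<int q}. \<Sum>n\<in>{0..<int q}. (cmod (\<Sum>p\<in>P. root_unity q (m * s p + n * t p)))\<^sup>2)
    = (real q)\<^sup>2 * card {(p, r) \<in> P \<times> P. [s p = s r] (mod int q) \<and> [t p = t r] (mod int q)}"
proof -
  let ?e = "root_unity q" and ?Z = "{0..<int q}"
  have "complex_of_real (\<Sum>m\<in>?Z. \<Sum>n\<in>?Z. (cmod (\<Sum>p\<in>P. ?e (m * s p + n * t p)))\<^sup>2)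
     = (\<Sum>m\<in>?Z. \<Sum>n\<in>?Z. \<Sum>(p, r)\<in>P \<times> P. ?e (m * (s p - s r)) * ?e (n * (t p - t r)))"
  proof -
    have "complex_of_real ((cmod (\<Sum>p\<in>P. ?e (m * s p + n * t p)))\<^sup>2)
      = (\<Sum>(p, r)\<in>P \<times> P. ?e (m * (s p - s r)) * ?e (n * (t p - t r)))" for m n
    proof -
      have "complex_of_real ((cmod (\<Sum>p\<in>P. ?e (m * s p + n * t p)))\<^sup>2)
        = (\<Sum>p\<in>P. ?e (m * s p + n * t p)) * (\<Sum>r\<in>P. ?e (- (m * s r + n * t r)))"
        by (simp add: complex_norm_square cnj_root_unity del: of_real_power)
      also have "\<dots> = (\<Sum>(p, r)\<in>P \<times> P. ?e (m * s p + n * t p) * ?e (- (m * s r + n * t r)))"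
        by (simp add: sum_product sum.cartesian_product)
      also have "\<dots> = (\<Sum>(p, r)\<in>P \<times> P. ?e (m * (s p - s r)) * ?e (n * (t p - t r)))"
        by (intro sum.cong refl) (auto simp: root_unity_add[symmetric] algebra_simps)
      finally show ?thesis .
    qed
    then show ?thesis by simp
  qed
  also have "\<dots> = (\<Sum>m\<in>?Z. \<Sum>(p, r)\<in>P \<times> P. \<Sum>n\<in>?Z. ?e (m * (s p - s r)) * ?e (n * (t p - t r)))"
    unfolding case_prod_beta by (intro sum.cong refl sum.swap)
  also have "\<dots> = (\<Sum>(p, r)\<in>P \<times> P. (\<Sum>m\<in>?Z. ?e (m * (s p - s r))) * (\<Sum>n\<in>?Z. ?e (n * (t p - t r))))"
    unfolding case_prod_beta sum_product by (rule sum.swap)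
  also have "\<dots> = (\<Sum>(p, r)\<in>P \<times> P. if [s p = s r] (mod int q) \<and> [t p = t r] (mod int q)
      then (of_nat q)\<^sup>2 else 0)"
    by (intro sum.cong refl)
       (auto simp: root_unity_orthogonality[OF assms(1)] cong_iff_dvd_diff power2_eq_square)
  also have "\<dots> = complex_of_real ((real q)\<^sup>2 *
      card {(p, r) \<in> P \<times> P. [s p = s r] (mod int q) \<and> [t p = t r] (mod int q)})"
    using assms(2) unfolding case_prod_beta
    by (subst sum.If_cases) (auto simp del: sum.cartesian_product intro!: arg_cong[where f=card])
  finally show ?thesis by (simp only: of_real_eq_iff)
qed

lemma card_linear_congruence_le:
  fixes c e :: int
  assumes "q > 0"
  shows "int (card {x \<in> {0..<int q}. [c * x = e] (mod int q)}) \<le> gcd c (int q)"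
proof -
  let ?S = "{x \<in> {0..<int q}. [c * x = e] (mod int q)}"
  define g where "g = gcd c (int q)"
  define k where "k = int q div g"
  have g: "g > 0" "g dvd int q" "g dvd c" and qk: "int q = g * k"
    using assms by (auto simp: g_def k_def)
  then have k: "k > 0" using assms
    by (metis of_nat_0_less_iff zero_less_mult_pos)
  have same: "x mod k = y mod k" if "x \<in> ?S" "y \<in> ?S" for x y
  proof -
    have "[c * x = c * y] (mod int q)" using that by (auto simp: cong_def)
    then have "g * k dvd c * (x - y)"
      using qk by (simp add: cong_iff_dvd_diff right_diff_distrib)
    also have "c * (x - y) = g * ((c div g) * (x - y))"
      using g by simp
    finally have "k dvd (c div g) * (x - y)"
      using g by simp
    moreover have "coprime (c div g) k"
      unfolding k_def g_def using assms by (intro div_gcd_coprime) auto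
    ultimately have "k dvd x - y"
      by (simp add: coprime_commute coprime_dvd_mult_right_iff)
    then show ?thesis by (simp add: mod_eq_dvd_iff)
  qed
  have "inj_on (\<lambda>x. x div k) ?S"
  proof (rule inj_onI)
    fix x y assume "x \<in> ?S" "y \<in> ?S" and d: "x div k = y div k"
    then have "x mod k = y mod k" by (intro same)
    then show "x = y" using d div_mult_mod_eq[of x k] div_mult_mod_eq[of y k] by metis
  qed
  moreover have "(\<lambda>x. x div k) ` ?S \<subseteq> {0..<g}"
  proof safe
    fix x assume "x \<in> {0..<int q}"
    then have x: "0 \<le> x" "x < g * k" using qk by auto
    have "x div k * k \<le> x" using k
      by (metis div_mult_mod_eq le_add_same_cancel1 pos_mod_sign)
    then have "x div k * k < g * k" using x by linarith
    then have "x div k < g" using k by (simp add: mult_less_cancel_right)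
    then show "x div k \<in> {0..<g}" using x k by (simp add: pos_imp_zdiv_nonneg_iff)
  qed
  ultimately have "card ?S \<le> card {0..<g}"
    by (intro card_inj_on_le) auto
  then show ?thesis using g by (simp add: le_nat_iff flip: g_def)
qed

text \<open>
  Each \<open>gcd u q\<close> is at most the sum of the divisors \<open>d\<close> of \<open>q\<close> that divide \<open>u\<close>, and each
  divisor \<open>d\<close> contributes \<open>d (q / d) = q\<close> to the total.
\<close>

lemma sum_gcd_le:
  assumes "q > 0"
  shows "(\<Sum>u\<in>{0..<int q}. gcd u (int q)) \<le> int (q * card {d. d dvd q})"
proof -
  let ?D = "{d. d dvd q}"
  have fin: "finite ?D" using assms by simp
  have "(\<Sum>u\<in>{0..<int q}. gcd u (int q)) = (\<Sum>u<q. int (gcd u q))"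
    by (simp add: sum_int_residues)
  also have "\<dots> \<le> (\<Sum>u<q. \<Sum>d\<in>?D. if d dvd u then int d else 0)"
  proof (rule sum_mono)
    fix u
    have "int (gcd u q) = (\<Sum>d\<in>{gcd u q}. if d dvd u then int d else 0)" by simp
    also have "\<dots> \<le> (\<Sum>d\<in>?D. if d dvd u then int d else 0)"
      by (rule sum_mono2) (use fin in auto)
    finally show "int (gcd u q) \<le> (\<Sum>d\<in>?D. if d dvd u then int d else 0)" .
  qed
  also have "\<dots> = (\<Sum>d\<in>?D. \<Sum>u<q. if d dvd u then int d else 0)"
    by (rule sum.swap)
  also have "\<dots> = (\<Sum>d\<in>?D. int q)"
  proof (rule sum.cong[OF refl])
    fix d assume "d \<in> ?D"
    then obtain k where k: "q = d * k" by auto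
    with assms have d: "d > 0" by (cases d) auto
    have "{u \<in> {..<q}. d dvd u} = (\<lambda>i. d * i) ` {..<k}"
      using d by (auto simp: k elim!: dvdE)
    then have "card {u \<in> {..<q}. d dvd u} = k"
      using d by (simp add: card_image inj_on_def)
    then show "(\<Sum>u<q. if d dvd u then int d else 0) = int q"
      by (simp add: sum.If_cases Int_def k)
  qed
  finally show ?thesis by (simp add: mult.commute)
qed

section \<open>Kloosterman sums\<close>

text \<open>
  The modular hyperbola. For \<open>q = 1\<close> it is the single point \<open>(0, 0)\<close>, in agreement with \<open>totient 1 = 1\<close>.
\<close>

definition inverse_pairs :: "nat \<Rightarrow> (int \<times> int) set" where
  "inverse_pairs q = {(a, x). a \<in> {0..<int q} \<and> x \<in> {0..<int q} \<and> [a * x = 1] (mod int q)}"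

definition kloosterman :: "nat \<Rightarrow> int \<Rightarrow> int \<Rightarrow> complex" where
  "kloosterman q m n = (\<Sum>(a, x)\<in>inverse_pairs q. root_unity q (m * a + n * x))"

lemma finite_inverse_pairs [simp]: "finite (inverse_pairs q)"
  by (rule finite_subset[of _ "{0..<int q} \<times> {0..<int q}"]) (auto simp: inverse_pairs_def)

lemma swap_inverse_pairs: "(a, x) \<in> inverse_pairs q \<longleftrightarrow> (x, a) \<in> inverse_pairs q"
  by (auto simp: inverse_pairs_def mult.commute)

lemma residue_eq:
  fixes x y :: int
  assumes "x \<in> {0..<int q}" "y \<in> {0..<int q}" "[x = y] (mod int q)"
  shows "x = y"
  using assms by (simp add: cong_def)

lemma inverse_pairs_unique:
  assumes "(a, x) \<in> inverse_pairs q" "(a, y) \<in> inverse_pairs q"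
  shows "x = y"
proof -
  have "[x = x * (a * y)] (mod int q)"
    using assms(2) by (metis (mono_tags, lifting) case_prodD cong_scalar_left cong_sym
      inverse_pairs_def mem_Collect_eq mult.right_neutral)
  also have "x * (a * y) = (a * x) * y" by simp
  also have "[(a * x) * y = 1 * y] (mod int q)"
    using assms(1) by (intro cong_scalar_right) (auto simp: inverse_pairs_def)
  finally show ?thesis
    using assms by (intro residue_eq[of x q y]) (auto simp: inverse_pairs_def)
qed

lemma inj_on_fst_inverse_pairs: "inj_on fst (inverse_pairs q)"
  by (auto simp: inj_on_def dest: inverse_pairs_unique)

lemma fst_image_inverse_pairs:
  assumes "q > 0"
  shows "fst ` inverse_pairs q = {a \<in> {0..<int q}. coprime a (int q)}"
proof (intro set_eqI iffI)
  fix a assume "a \<in> fst ` inverse_pairs q"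
  then obtain x where "a \<in> {0..<int q}" "[a * x = 1] (mod int q)"
    by (auto simp: inverse_pairs_def)
  then show "a \<in> {a \<in> {0..<int q}. coprime a (int q)}"
    using coprime_iff_invertible_int by auto
next
  fix a assume a: "a \<in> {a \<in> {0..<int q}. coprime a (int q)}"
  then obtain x where x: "[a * x = 1] (mod int q)"
    using coprime_iff_invertible_int by auto
  have "[a * (x mod int q) = a * x] (mod int q)"
    by (intro cong_scalar_left) (simp add: cong_def)
  with x have "[a * (x mod int q) = 1] (mod int q)" by (rule cong_trans[rotated])
  with a assms have "(a, x mod int q) \<in> inverse_pairs q" by (auto simp: inverse_pairs_def)
  then show "a \<in> fst ` inverse_pairs q" by force
qed

lemma card_inverse_pairs:
  assumes "q > 0"
  shows "card (inverse_pairs q) = totient q"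
proof -
  have "card (inverse_pairs q) = card {a \<in> {0..<int q}. coprime a (int q)}"
    by (metis assms card_image fst_image_inverse_pairs inj_on_fst_inverse_pairs)
  also have "\<dots> = card (totatives q)"
  proof (cases "q = 1")
    case True
    then have "{a \<in> {0..<int q}. coprime a (int q)} = {0}" by auto
    then show ?thesis using True by simp
  next
    case False
    have "int ` totatives q = {a \<in> {0..<int q}. coprime a (int q)}"
    proof (intro set_eqI iffI)
      fix a assume "a \<in> int ` totatives q"
      then show "a \<in> {a \<in> {0..<int q}. coprime a (int q)}"
        using False assms by (auto simp: in_totatives_iff totatives_less)
    next
      fix a assume a: "a \<in> {a \<in> {0..<int q}. coprime a (int q)}"
      then have "a \<noteq> 0" using False by (auto intro: ccontr)
      with a have "nat a \<in> totatives q" "a = int (nat a)"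
        by (auto simp: in_totatives_iff simp flip: coprime_int_iff)
      then show "a \<in> int ` totatives q" by (metis imageI)
    qed
    then show ?thesis by (metis card_image inj_on_of_nat)
  qed
  finally show ?thesis by (simp add: totient_def)
qed

lemma kloosterman_commute: "kloosterman q m n = kloosterman q n m"
  unfolding kloosterman_def
  by (rule sum.reindex_bij_witness[of _ prod.swap prod.swap])
     (auto simp: swap_inverse_pairs add.commute)

lemma inverse_pairs_mult:
  assumes "q > 0" "(a, x) \<in> inverse_pairs q" "(l, l') \<in> inverse_pairs q"
  shows "(l * a mod int q, l' * x mod int q) \<in> inverse_pairs q"
proof -
  have "[(a * x) * (l * l') = 1 * 1] (mod int q)"
    using assms(2,3) by (intro cong_mult) (auto simp: inverse_pairs_def)
  then have "[(l * a mod int q) * (l' * x mod int q) = 1] (mod int q)"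
    by (simp add: cong_def mod_mult_eq mult_ac)
  then show ?thesis using assms(1) by (auto simp: inverse_pairs_def)
qed

lemma inverse_pairs_cancel:
  assumes "(l, l') \<in> inverse_pairs q" "a \<in> {0..<int q}"
  shows "l' * (l * a mod int q) mod int q = a"
proof -
  have "[(l * l') * a = 1 * a] (mod int q)"
    using assms(1) by (intro cong_scalar_right) (auto simp: inverse_pairs_def)
  then show ?thesis
    using assms(2) by (simp add: cong_def mod_mult_right_eq mult_ac)
qed

text \<open>
  The map \<open>(a, x) \<mapsto> (l a, l' x)\<close> permutes the modular hyperbola. One large Kloosterman sum therefore
  forces many others to be equally large, which the fourth moment forbids.
\<close>

lemma kloosterman_dilate:
  assumes "q > 0" and l: "(l, l') \<in> inverse_pairs q"
  shows "kloosterman q (m * l) (n * l') = kloosterman q m n"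
proof -
  have l': "(l', l) \<in> inverse_pairs q" using l by (simp add: swap_inverse_pairs)
  have range: "a \<in> {0..<int q}" "x \<in> {0..<int q}" if "(a, x) \<in> inverse_pairs q" for a x
    using that by (auto simp: inverse_pairs_def)
  let ?f = "\<lambda>l l' p. (l * fst p mod int q, l' * snd p mod int q)"
  show ?thesis
    unfolding kloosterman_def
  proof (rule sum.reindex_bij_witness[of _ "?f l' l" "?f l l'"])
    fix p assume "p \<in> inverse_pairs q"
    then obtain a x where p: "p = (a, x)" and ax: "(a, x) \<in> inverse_pairs q" by (cases p) auto
    show "?f l' l (?f l l' p) = p" "?f l l' (?f l' l p) = p"
      using inverse_pairs_cancel[OF l] inverse_pairs_cancel[OF l'] range[OF ax] by (auto simp: p)
    show "?f l l' p \<in> inverse_pairs q" "?f l' l p \<in> inverse_pairs q"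
      using inverse_pairs_mult[OF assms(1) ax] l l' by (auto simp: p)
    have "[m * (l * a mod int q) + n * (l' * x mod int q) = m * l * a + n * l' * x] (mod int q)"
      by (intro cong_add) (simp_all add: cong_def mod_mult_right_eq mult.assoc)
    then have "root_unity q (m * (l * a mod int q) + n * (l' * x mod int q)) = root_unity q (m * l * a + n * l' * x)"
      by (rule root_unity_cong[OF assms(1)])
    then show "(case ?f l l' p of (a, x) \<Rightarrow> root_unity q (m * a + n * x)) =
         (case p of (a, x) \<Rightarrow> root_unity q (m * l * a + n * l' * x))"
      by (simp add: p)
  qed
qed

definition additive_quadruples :: "nat \<Rightarrow> (((int \<times> int) \<times> int \<times> int) \<times> (int \<times> int) \<times> int \<times> int) set" where
  "additive_quadruples q = {(p, r).
     (p, r) \<in> (inverse_pairs q \<times> inverse_pairs q) \<times> (inverse_pairs q \<times> inverse_pairs q) \<and>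
     [fst (fst p) + fst (snd p) = fst (fst r) + fst (snd r)] (mod int q) \<and>
     [snd (fst p) + snd (snd p) = snd (fst r) + snd (snd r)] (mod int q)}"

lemma kloosterman_fourth_moment:
  assumes "q > 0"
  shows "(\<Sum>m\<in>{0..<int q}. \<Sum>n\<in>{0..<int q}. cmod (kloosterman q m n) ^ 4)
    = (real q)\<^sup>2 * card (additive_quadruples q)"
proof -
  let ?P = "inverse_pairs q \<times> inverse_pairs q"
  have "cmod (kloosterman q m n) ^ 4 = (cmod (\<Sum>p\<in>?P. root_unity q
      (m * (fst (fst p) + fst (snd p)) + n * (snd (fst p) + snd (snd p)))))\<^sup>2" for m n
  proof -
    have square: "kloosterman q m n * kloosterman q m n = (\<Sum>p\<in>?P. root_unity q
      (m * (fst (fst p) + fst (snd p)) + n * (snd (fst p) + snd (snd p))))"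
      unfolding kloosterman_def sum_product sum.cartesian_product
      by (intro sum.cong refl) (auto simp: root_unity_add[symmetric] algebra_simps)
    have "cmod (kloosterman q m n) ^ 4 = (cmod (kloosterman q m n * kloosterman q m n))\<^sup>2"
      by (simp add: norm_mult power2_eq_square power4_eq_xxxx)
    then show ?thesis by (simp only: square)
  qed
  then show ?thesis
    by (simp add: parseval_two_variables[OF assms] additive_quadruples_def)
qed

text \<open>
  Clearing denominators in \<open>x\<^sub>1 + x\<^sub>2 = x\<^sub>3 + x\<^sub>4\<close> gives
  \<open>(a\<^sub>1 + a\<^sub>2) (a\<^sub>3 a\<^sub>4 - a\<^sub>1 a\<^sub>2) = 0\<close>, and \<open>a\<^sub>4 = a\<^sub>1 + a\<^sub>2 - a\<^sub>3\<close> makes the second factor split.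
\<close>

lemma product_of_cong_sums:
  fixes a1 a2 a3 a4 x1 x2 x3 x4 q :: int
  assumes inv: "[a1 * x1 = 1] (mod q)" "[a2 * x2 = 1] (mod q)" "[a3 * x3 = 1] (mod q)" "[a4 * x4 = 1] (mod q)"
    and a: "[a1 + a2 = a3 + a4] (mod q)" and x: "[x1 + x2 = x3 + x4] (mod q)"
  shows "q dvd (a1 + a2) * (a3 - a1) * (a3 - a2)"
proof -
  have lin: "\<exists>k. y = x + q * k" if "[y = x] (mod q)" for x y
    using that by (metis cong_iff_lin cong_sym)
  obtain k1 k2 k3 k4 where k: "a1 * x1 = 1 + q * k1" "a2 * x2 = 1 + q * k2"
      "a3 * x3 = 1 + q * k3" "a4 * x4 = 1 + q * k4"
    using inv[THEN lin] by blast
  obtain j where "a3 + a4 = a1 + a2 + q * j" using lin[OF cong_sym[OF a]] by blast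
  then have j: "a4 = a1 + a2 - a3 + q * j" by simp
  obtain i where i: "x3 + x4 = x1 + x2 + q * i"
    using lin[OF cong_sym[OF x]] by blast
  let ?A = "a1 * a2 * a3 * a4"
  have "?A * (x1 + x2) = a3 * a4 * (a2 * (a1 * x1) + a1 * (a2 * x2))"
    by (simp add: algebra_simps)
  also have "\<dots> = a3 * a4 * (a1 + a2) + q * (a3 * a4 * (a2 * k1 + a1 * k2))"
    unfolding k by (simp add: algebra_simps)
  finally have 1: "?A * (x1 + x2) = a3 * a4 * (a1 + a2) + q * (a3 * a4 * (a2 * k1 + a1 * k2))" .
  have "?A * (x3 + x4) = a1 * a2 * (a4 * (a3 * x3) + a3 * (a4 * x4))"
    by (simp add: algebra_simps)
  also have "\<dots> = a1 * a2 * (a3 + a4) + q * (a1 * a2 * (a4 * k3 + a3 * k4))"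
    unfolding k by (simp add: algebra_simps)
  finally have 2: "?A * (x3 + x4) = a1 * a2 * (a3 + a4) + q * (a1 * a2 * (a4 * k3 + a3 * k4))" .
  have "?A * (x3 + x4) = ?A * (x1 + x2) + q * (?A * i)" using i by (simp add: algebra_simps)
  then have "a3 * a4 * (a1 + a2) - a1 * a2 * (a3 + a4) = q * ((a1 * a2 * (a4 * k3 + a3 * k4))
       - (a3 * a4 * (a2 * k1 + a1 * k2)) - ?A * i)"
    using 1 2 by (simp add: algebra_simps)
  moreover have "(a1 + a2) * (a3 - a1) * (a3 - a2)
     = - (a3 * a4 * (a1 + a2) - a1 * a2 * (a3 + a4)) + q * (j * (a3 * (a1 + a2) - a1 * a2))"
    unfolding j by (simp add: algebra_simps)
  ultimately show ?thesis by (metis dvd_add dvd_minus_iff dvd_triv_left)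
qed

lemma gcd_mult_dvd: "gcd (a * b) c dvd gcd a c * gcd b c" for a b c :: int
proof -
  obtain s t where a: "s * a + t * c = gcd a c" using bezout_int by blast
  obtain u v where b: "u * b + v * c = gcd b c" using bezout_int by blast
  have "gcd a c * gcd b c = (a * b) * (s * u) + c * (s * a * v + t * u * b + t * v * c)"
    unfolding a[symmetric] b[symmetric] by (simp add: algebra_simps)
  then show ?thesis by (metis dvd_add dvd_mult2 gcd_dvd1 gcd_dvd2)
qed

text \<open>
  A quadruple is determined by \<open>u = a\<^sub>3 - a\<^sub>1\<close>, \<open>v = a\<^sub>3 - a\<^sub>2\<close> and \<open>w = a\<^sub>3\<close>, and these satisfy
  \<open>(2 w - u - v) u v = 0\<close>. For fixed \<open>u\<close> and \<open>v\<close> this is a linear congruence in \<open>w\<close> with at most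
  \<open>2 gcd u q gcd v q\<close> solutions.
\<close>

lemma card_additive_quadruples_le:
  assumes "q > 0"
  shows "card (additive_quadruples q) \<le> 2 * (q * card {d. d dvd q})\<^sup>2"
proof -
  let ?Z = "{0..<int q}"
  let ?W = "\<lambda>(u, v). {w \<in> ?Z. [2 * u * v * w = u * v * (u + v)] (mod int q)}"
  let ?f = "\<lambda>(((a1, x1), (a2, x2)), ((a3, x3), (a4, x4))).
    (((a3 - a1) mod int q, (a3 - a2) mod int q), a3)"
  have inj: "inj_on ?f (additive_quadruples q)"
  proof (rule inj_onI)
    fix P Q
    assume PQ: "P \<in> additive_quadruples q" "Q \<in> additive_quadruples q" "?f P = ?f Q"
    obtain a1 x1 a2 x2 a3 x3 a4 x4 where P: "P = (((a1, x1), (a2, x2)), ((a3, x3), (a4, x4)))"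
      by (metis surj_pair)
    obtain b1 y1 b2 y2 b3 y3 b4 y4 where Q: "Q = (((b1, y1), (b2, y2)), ((b3, y3), (b4, y4)))"
      by (metis surj_pair)
    have A: "(((a1, x1), (a2, x2)), ((a3, x3), (a4, x4))) \<in> additive_quadruples q"
      and B: "(((b1, y1), (b2, y2)), ((b3, y3), (b4, y4))) \<in> additive_quadruples q"
      and 1: "(a3 - a1) mod int q = (b3 - b1) mod int q"
      and 2: "(a3 - a2) mod int q = (b3 - b2) mod int q"
      and 3: "a3 = b3"
      using PQ unfolding P Q prod.case prod.inject by blast+
    have Z: "{a1, a2, a3, a4, b1, b2, b3, b4} \<subseteq> ?Z"
      using A B by (auto simp: additive_quadruples_def inverse_pairs_def)
    have "[a3 - a1 = b3 - b1] (mod int q)" using 1 by (simp only: cong_def)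
    then have "[a3 - (a3 - a1) = a3 - (b3 - b1)] (mod int q)" by (rule cong_diff[OF cong_refl])
    then have "[a1 = b1] (mod int q)" using 3 by simp
    then have e1: "a1 = b1" using Z by (intro residue_eq[of _ q]) auto
    have "[a3 - a2 = b3 - b2] (mod int q)" using 2 by (simp only: cong_def)
    then have "[a3 - (a3 - a2) = a3 - (b3 - b2)] (mod int q)" by (rule cong_diff[OF cong_refl])
    then have "[a2 = b2] (mod int q)" using 3 by simp
    then have e2: "a2 = b2" using Z by (intro residue_eq[of _ q]) auto
    have "[a1 + a2 = a3 + a4] (mod int q)" "[a1 + a2 = a3 + b4] (mod int q)"
      using A B e1 e2 3 by (auto simp: additive_quadruples_def)
    then have "[a3 + a4 = a3 + b4] (mod int q)" by (metis cong_sym cong_trans)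
    then have "[a4 = b4] (mod int q)" by (simp add: cong_add_lcancel)
    then have e4: "a4 = b4" using Z by (intro residue_eq[of _ q]) auto
    have "x1 = y1" "x2 = y2" "x3 = y3" "x4 = y4"
      using A B e1 e2 3 e4 by (auto simp: additive_quadruples_def intro: inverse_pairs_unique)
    then show "P = Q" by (simp add: P Q e1 e2 3 e4)
  qed
  have sub: "?f ` additive_quadruples q \<subseteq> Sigma (?Z \<times> ?Z) ?W"
  proof (rule image_subsetI)
    fix P
    assume P_in: "P \<in> additive_quadruples q"
    obtain a1 x1 a2 x2 a3 x3 a4 x4 where P: "P = (((a1, x1), (a2, x2)), ((a3, x3), (a4, x4)))"
      by (metis surj_pair)
    have A: "(((a1, x1), (a2, x2)), ((a3, x3), (a4, x4))) \<in> additive_quadruples q"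
      using P_in by (simp add: P)
    define u v where "u = (a3 - a1) mod int q" and "v = (a3 - a2) mod int q"
    have "int q dvd (a1 + a2) * (a3 - a1) * (a3 - a2)"
      using A by (intro product_of_cong_sums[of a1 x1 "int q" a2 x2 a3 x3 a4 x4])
                 (auto simp: additive_quadruples_def inverse_pairs_def)
    then have "[((a3 - (a3 - a1)) + (a3 - (a3 - a2))) * (a3 - a1) * (a3 - a2) = 0] (mod int q)"
      by (simp add: cong_0_iff)
    moreover have uv: "[a3 - a1 = u] (mod int q)" "[a3 - a2 = v] (mod int q)"
      by (auto simp: u_def v_def cong_def)
    then have "[((a3 - (a3 - a1)) + (a3 - (a3 - a2))) * (a3 - a1) * (a3 - a2)
       = ((a3 - u) + (a3 - v)) * u * v] (mod int q)"
      by (intro cong_mult cong_add cong_diff cong_refl)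
    ultimately have "[((a3 - u) + (a3 - v)) * u * v = 0] (mod int q)"
      by (metis cong_sym cong_trans)
    then have "[2 * u * v * a3 = u * v * (u + v)] (mod int q)"
      by (simp add: cong_iff_dvd_diff algebra_simps)
    moreover have "a3 \<in> ?Z" "u \<in> ?Z" "v \<in> ?Z"
      using A assms by (auto simp: additive_quadruples_def inverse_pairs_def u_def v_def)
    ultimately have "((u, v), a3) \<in> Sigma (?Z \<times> ?Z) ?W" by simp
    then show "?f P \<in> Sigma (?Z \<times> ?Z) ?W" by (simp add: P u_def v_def)
  qed
  have fin: "finite (?W p)" for p
    by (cases p) (rule finite_subset[of _ ?Z], auto)
  have "card (additive_quadruples q) \<le> card (Sigma (?Z \<times> ?Z) ?W)"
    by (rule card_inj_on_le[OF inj sub]) (use fin in \<open>intro finite_SigmaI; blast\<close>)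
  also have "\<dots> = (\<Sum>p\<in>?Z \<times> ?Z. card (?W p))"
    by (rule card_SigmaI) (use fin in blast)+
  finally have "int (card (additive_quadruples q)) \<le> (\<Sum>p\<in>?Z \<times> ?Z. int (card (?W p)))"
    by (simp only: of_nat_le_iff flip: of_nat_sum)
  also have "\<dots> \<le> (\<Sum>(u, v)\<in>?Z \<times> ?Z. 2 * (gcd u (int q) * gcd v (int q)))"
  proof (rule sum_mono)
    fix p :: "int \<times> int"
    obtain u v where p: "p = (u, v)" by (cases p)
    have "int (card (?W (u, v))) \<le> gcd (2 * u * v) (int q)"
      using card_linear_congruence_le[OF assms, of "2 * u * v" "u * v * (u + v)"] by simp
    also have "\<dots> \<le> gcd 2 (int q) * (gcd u (int q) * gcd v (int q))"
    proof (rule zdvd_imp_le)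
      have "gcd (2 * (u * v)) (int q) dvd gcd 2 (int q) * gcd (u * v) (int q)"
        by (rule gcd_mult_dvd)
      also have "\<dots> dvd gcd 2 (int q) * (gcd u (int q) * gcd v (int q))"
        by (intro mult_dvd_mono dvd_refl gcd_mult_dvd)
      finally show "gcd (2 * u * v) (int q) dvd gcd 2 (int q) * (gcd u (int q) * gcd v (int q))"
        by (simp only: mult.assoc)
    qed (use assms in simp)
    also have "\<dots> \<le> 2 * (gcd u (int q) * gcd v (int q))"
      using assms by (intro mult_right_mono) (auto intro: zdvd_imp_le)
    finally show "int (card (?W p)) \<le> (case p of (u, v) \<Rightarrow> 2 * (gcd u (int q) * gcd v (int q)))"
      by (simp only: p prod.case)
  qed
  also have "\<dots> = 2 * (\<Sum>u\<in>?Z. gcd u (int q))\<^sup>2"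
    by (simp add: sum.cartesian_product[symmetric] sum_distrib_left power2_eq_square sum_product mult_ac)
  also have "\<dots> \<le> 2 * (int (q * card {d. d dvd q}))\<^sup>2"
    using sum_gcd_le[OF assms] by (intro mult_left_mono power_mono sum_nonneg) auto
  finally show ?thesis
    by (metis (mono_tags, lifting) of_nat_le_iff of_nat_mult of_nat_numeral of_nat_power)
qed

text \<open>
  Up to the greatest common divisor and powers of the divisor function this is Kloosterman's bound \<open>q\<^bsup>3/4\<^esup>\<close>, valid for every modulus. Averaging over the dilations
  \<open>(m l, n l')\<close> reaches each pair of frequencies at most \<open>gcd m q\<close> times.
\<close>

theorem kloosterman_bound:
  assumes "q > 0"
  shows "totient q * cmod (kloosterman q m n) ^ 4
    \<le> gcd m (int q) * (2 * real q ^ 4 * real (card {d. d dvd q}) ^ 2)"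
proof -
  let ?Z = "{0..<int q}" and ?U = "inverse_pairs q"
  define g where "g = (\<lambda>(r, s). cmod (kloosterman q r s) ^ 4)"
  define \<phi> where "\<phi> = (\<lambda>(l, l'). (m * l mod int q, n * l' mod int q))"
  have g: "g p \<ge> 0" for p by (simp add: g_def case_prod_beta)
  have \<phi>: "g (\<phi> p) = cmod (kloosterman q m n) ^ 4" if "p \<in> ?U" for p
  proof -
    obtain l l' where p: "p = (l, l')" by force
    have "kloosterman q (m * l mod int q) (n * l' mod int q) = kloosterman q (m * l) (n * l')"
      unfolding kloosterman_def
      by (intro sum.cong refl) (auto intro!: root_unity_cong assms cong_add cong_scalar_right simp: cong_def mod_mult_left_eq)
    then show ?thesis
      using kloosterman_dilate[OF assms, of l l' m n] that by (simp add: g_def \<phi>_def p)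
  qed
  have fiber: "real (card {p \<in> ?U. \<phi> p = z}) \<le> gcd m (int q)" for z
  proof -
    have "card {p \<in> ?U. \<phi> p = z} \<le> card {l \<in> ?Z. [m * l = fst z] (mod int q)}"
    proof (rule card_inj_on_le[of fst])
      show "inj_on fst {p \<in> ?U. \<phi> p = z}"
        by (rule inj_on_subset[OF inj_on_fst_inverse_pairs]) auto
      show "fst ` {p \<in> ?U. \<phi> p = z} \<subseteq> {l \<in> ?Z. [m * l = fst z] (mod int q)}"
        by (auto simp: \<phi>_def inverse_pairs_def cong_def)
      show "finite {l \<in> ?Z. [m * l = fst z] (mod int q)}" by (rule finite_subset[of _ ?Z]) auto
    qed
    also have "int \<dots> \<le> gcd m (int q)" by (rule card_linear_congruence_le[OF assms])
    finally show ?thesis by linarith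
  qed
  have "totient q * cmod (kloosterman q m n) ^ 4 = (\<Sum>p\<in>?U. g (\<phi> p))"
    by (simp add: \<phi> card_inverse_pairs[OF assms])
  also have "\<dots> = (\<Sum>z\<in>?Z \<times> ?Z. \<Sum>p\<in>{p \<in> ?U. \<phi> p = z}. g (\<phi> p))"
    by (rule sum.group[symmetric]) (use assms in \<open>auto simp: \<phi>_def\<close>)
  also have "\<dots> = (\<Sum>z\<in>?Z \<times> ?Z. card {p \<in> ?U. \<phi> p = z} * g z)"
    by (intro sum.cong refl) auto
  also have "\<dots> \<le> (\<Sum>z\<in>?Z \<times> ?Z. gcd m (int q) * g z)"
    by (intro sum_mono mult_right_mono fiber g)
  also have "\<dots> = gcd m (int q) * (\<Sum>r\<in>?Z. \<Sum>s\<in>?Z. cmod (kloosterman q r s) ^ 4)"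
    by (simp add: sum_distrib_left sum.cartesian_product g_def case_prod_beta)
  also have "\<dots> = gcd m (int q) * ((real q)\<^sup>2 * card (additive_quadruples q))"
    by (simp add: kloosterman_fourth_moment assms)
  also have "\<dots> \<le> gcd m (int q) * ((real q)\<^sup>2 * real (2 * (q * card {d. d dvd q})\<^sup>2))"
    using card_additive_quadruples_le[OF assms]
    by (intro mult_left_mono) (simp_all only: of_nat_le_iff, auto)
  also have "\<dots> = gcd m (int q) * (2 * real q ^ 4 * real (card {d. d dvd q}) ^ 2)"
    by (simp add: power2_eq_square power4_eq_xxxx)
  finally show ?thesis .
qed

section \<open>Equidistribution of residues and their inverses\<close>

definition interval_transform :: "nat \<Rightarrow> int set \<Rightarrow> int \<Rightarrow> complex" where
  "interval_transform q A m = (\<Sum>a\<in>A. root_unity q (- (m * a)))"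

lemma interval_transform_inversion:
  assumes "q > 0" "A \<subseteq> {0..<int q}" "a \<in> {0..<int q}"
  shows "(\<Sum>m\<in>{0..<int q}. interval_transform q A m * root_unity q (m * a)) = (if a \<in> A then of_nat q else 0)"
proof -
  have fin: "finite A" using assms(2) by (rule finite_subset) simp
  have "(\<Sum>m\<in>{0..<int q}. interval_transform q A m * root_unity q (m * a))
     = (\<Sum>m\<in>{0..<int q}. \<Sum>b\<in>A. root_unity q (m * (a - b)))"
    unfolding interval_transform_def sum_distrib_right
    by (intro sum.cong refl) (simp add: root_unity_add[symmetric] algebra_simps)
  also have "\<dots> = (\<Sum>b\<in>A. \<Sum>m\<in>{0..<int q}. root_unity q (m * (a - b)))"
    by (rule sum.swap)
  also have "\<dots> = (\<Sum>b\<in>A. if a = b then of_nat q else 0)"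
  proof (intro sum.cong refl)
    fix b assume "b \<in> A"
    then have "int q dvd a - b \<longleftrightarrow> a = b"
      using assms residue_eq[of a q b] by (auto simp: cong_iff_dvd_diff)
    then show "(\<Sum>m\<in>{0..<int q}. root_unity q (m * (a - b))) = (if a = b then of_nat q else 0)"
      by (simp add: root_unity_orthogonality[OF assms(1)])
  qed
  also have "\<dots> = (if a \<in> A then of_nat q else 0)" using fin by simp
  finally show ?thesis .
qed

text \<open>
  Fourier inversion in both coordinates: the indicator functions of \<open>A\<close> and \<open>B\<close> are expanded, and
  the sum over the modular hyperbola of a product of characters is a Kloosterman sum.
\<close>

lemma count_inverse_pairs_eq:
  assumes "q > 0" "A \<subseteq> {0..<int q}" "B \<subseteq> {0..<int q}"
  shows "of_nat (q ^ 2 * card {(a, x) \<in> inverse_pairs q. a \<in> A \<and> x \<in> B})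
    = (\<Sum>(m, n)\<in>{0..<int q} \<times> {0..<int q}. interval_transform q A m * interval_transform q B n * kloosterman q m n)"
proof -
  let ?Z = "{0..<int q}" and ?U = "inverse_pairs q"
  let ?S = "{(a, x) \<in> ?U. a \<in> A \<and> x \<in> B}"
  have "complex_of_nat (q ^ 2 * card ?S) = (\<Sum>p\<in>?U. if p \<in> ?S then of_nat (q ^ 2) else 0)"
    by (subst sum.inter_restrict[symmetric]) (auto simp: Int_absorb2 intro!: arg_cong[where f=card])
  also have "\<dots> = (\<Sum>p\<in>?U. (\<Sum>m\<in>?Z. interval_transform q A m * root_unity q (m * fst p)) *
        (\<Sum>n\<in>?Z. interval_transform q B n * root_unity q (n * snd p)))"
  proof (intro sum.cong refl)
    fix p assume p: "p \<in> ?U"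
    then have "fst p \<in> ?Z" "snd p \<in> ?Z" by (auto simp: inverse_pairs_def)
    then show "(if p \<in> ?S then of_nat (q ^ 2) else 0) = (\<Sum>m\<in>?Z. interval_transform q A m * root_unity q (m * fst p)) *
        (\<Sum>n\<in>?Z. interval_transform q B n * root_unity q (n * snd p))"
      using p by (simp add: interval_transform_inversion[OF assms(1)] assms(2,3) power2_eq_square case_prod_beta)
  qed
  also have "\<dots> = (\<Sum>p\<in>?U. \<Sum>(m, n)\<in>?Z \<times> ?Z. interval_transform q A m * interval_transform q B n * root_unity q (m * fst p + n * snd p))"
    unfolding sum_product sum.cartesian_product
    by (intro sum.cong refl) (auto simp: root_unity_add mult_ac)
  also have "\<dots> = (\<Sum>(m, n)\<in>?Z \<times> ?Z. \<Sum>p\<in>?U. interval_transform q A m * interval_transform q B n * root_unity q (m * fst p + n * snd p))"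
    unfolding case_prod_beta by (rule sum.swap)
  also have "\<dots> = (\<Sum>(m, n)\<in>?Z \<times> ?Z. interval_transform q A m * interval_transform q B n * kloosterman q m n)"
    by (simp add: kloosterman_def sum_distrib_left case_prod_beta)
  finally show ?thesis .
qed

text \<open>
  The graph of the concave function \<open>sin\<close> lies above its chords from \<open>0\<close> to \<open>\<pi>/2\<close> and from \<open>\<pi>/2\<close> to \<open>\<pi>\<close>.
\<close>

lemma sin_pi_ge:
  assumes "0 \<le> x" "x \<le> 1"
  shows "2 * min x (1 - x) \<le> sin (pi * x)"
proof -
  have conc: "concave_on {0..pi} sin"
    by (rule f''_le0_imp_concave[where f' = cos and f'' = "\<lambda>x. - sin x"])
       (auto intro!: derivative_eq_intros sin_ge_zero)
  have *: "2 * t \<le> sin (pi * t)" if "0 \<le> t" "t \<le> 1/2" for t :: real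
    using concave_onD[OF conc, of "2 * t" 0 "pi / 2"] that by (auto simp: mult.commute)
  show ?thesis
  proof (cases "x \<le> 1/2")
    case True
    then show ?thesis using *[of x] assms by (simp add: min_def)
  next
    case False
    have "sin (pi * (1 - x)) = sin (pi * x)"
      using sin_pi_minus[of "pi * x"] by (simp add: right_diff_distrib)
    then show ?thesis using *[of "1 - x"] assms False by (simp add: min_def)
  qed
qed

lemma norm_1_minus_root_unity:
  assumes "0 < m" "m < int q"
  shows "4 * min (of_int m) (of_int (int q - m)) / real q \<le> norm (1 - root_unity q m)"
proof -
  define x where "x = of_int m / real q"
  have x: "0 \<le> x" "x \<le> 1" using assms by (auto simp: x_def divide_simps)
  have "norm (1 - root_unity q m) = norm (exp (\<i> * of_real (2 * pi * x)) - 1)"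
    by (simp add: root_unity_def cis_conv_exp x_def norm_minus_commute)
  also have "\<dots> = 2 * \<bar>sin (pi * x)\<bar>"
    by (subst dist_exp_i_1) simp
  finally have "norm (1 - root_unity q m) \<ge> 4 * min x (1 - x)"
    using sin_pi_ge[OF x] by linarith
  moreover have "4 * min x (1 - x) = 4 * min (of_int m) (of_int (int q - m)) / real q"
    using assms by (auto simp: x_def min_def field_simps)
  ultimately show ?thesis by simp
qed

text \<open>
  A majorant of \<open>q / (2 min m (q - m))\<close> that is additive in the two ends, so that it can be summed
  against \<open>gcd m q\<close> by symmetry.
\<close>

definition transform_bound :: "nat \<Rightarrow> int \<Rightarrow> real" where
  "transform_bound q m = (if m = 0 then real q else real q / of_int m + real q / of_int (int q - m))"

text \<open>
  The transform of an interval is a geometric series with ratio \<open>root_unity q (- m)\<close>.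
\<close>

lemma norm_interval_transform_le:
  assumes "q > 0" "m \<in> {0..<int q}" and A: "{c..<d} \<subseteq> {0..<int q}"
  shows "norm (interval_transform q {c..<d} m) \<le> transform_bound q m"
proof (cases "m = 0")
  case True
  have "card {c..<d} \<le> card {0..<int q}" by (rule card_mono[OF _ A]) simp
  then show ?thesis by (simp add: True interval_transform_def transform_bound_def)
next
  case False
  then have m: "0 < m" "m < int q" using assms by auto
  define z where "z = root_unity q (- m)"
  have z: "norm (1 - z) = norm (1 - root_unity q m)" "norm z = 1"
  proof -
    have "1 - z = cnj (1 - root_unity q m)" by (simp add: z_def cnj_root_unity)
    then show "norm (1 - z) = norm (1 - root_unity q m)" by (metis complex_mod_cnj)
  qed (simp add: z_def)
  have pos: "0 < 4 * min (of_int m) (of_int (int q - m)) / real q"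
    using m assms(1) by (auto simp: min_def)
  then have nz: "0 < norm (1 - z)" using norm_1_minus_root_unity[OF m] z by linarith
  have "interval_transform q {c..<d} m = (\<Sum>k<nat (d - c). root_unity q (- (m * (c + int k))))"
    unfolding interval_transform_def
    by (rule sum.reindex_bij_witness[of _ "\<lambda>k. c + int k" "\<lambda>a. nat (a - c)"]) auto
  also have "\<dots> = root_unity q (- (m * c)) * (\<Sum>k<nat (d - c). z ^ k)"
    by (simp add: sum_distrib_left z_def root_unity_power root_unity_add[symmetric] algebra_simps)
  also have "norm \<dots> = norm (\<Sum>k<nat (d - c). z ^ k)" by (simp add: norm_mult)
  also have "\<dots> = norm (1 - z ^ nat (d - c)) / norm (1 - z)"
    using nz by (subst sum_gp_strict) (auto simp: norm_divide)
  also have "\<dots> \<le> 2 / norm (1 - z)"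
    using nz z norm_triangle_ineq4[of 1 "z ^ nat (d - c)"] by (intro divide_right_mono) (auto simp: norm_power)
  also have "\<dots> \<le> 2 / (4 * min (of_int m) (of_int (int q - m)) / real q)"
    using norm_1_minus_root_unity[OF m] z pos by (intro divide_left_mono mult_pos_pos) auto
  also have "\<dots> \<le> real q / of_int m + real q / of_int (int q - m)"
  proof -
    have half: "2 / (4 * k / real q) \<le> real q / k" if "k > 0" for k
      using that assms(1) by (simp add: field_simps)
    let ?k = "min (of_int m) (of_int (int q - m)) :: real"
    have "?k > 0" using m by simp
    then have "2 / (4 * ?k / real q) \<le> real q / ?k" by (rule half)
    moreover have "?k = of_int m \<or> ?k = of_int (int q - m)" by (auto simp only: min_def split: if_splits)
    then have "real q / ?k = real q / of_int m \<or> real q / ?k = real q / of_int (int q - m)" by metis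
    moreover have "0 \<le> real q / of_int m" "0 \<le> real q / of_int (int q - m)"
      using m by auto
    ultimately show ?thesis by linarith
  qed
  finally show ?thesis using False by (simp add: transform_bound_def)
qed

lemma sum_gcd_over_le:
  assumes "q > 0"
  shows "(\<Sum>m\<in>{1..<q}. real (gcd m q) / real m) \<le> real (card {d. d dvd q}) * harm q"
proof -
  let ?D = "{d. d dvd q}"
  have fin: "finite ?D" using assms by simp
  have "(\<Sum>m\<in>{1..<q}. real (gcd m q) / real m) \<le> (\<Sum>m\<in>{1..<q}. \<Sum>d\<in>?D. if d dvd m then real d / real m else 0)"
  proof (rule sum_mono)
    fix m
    have "real (gcd m q) / real m = (\<Sum>d\<in>{gcd m q}. if d dvd m then real d / real m else 0)" by simp
    also have "\<dots> \<le> (\<Sum>d\<in>?D. if d dvd m then real d / real m else 0)"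
      by (rule sum_mono2) (use fin in auto)
    finally show "real (gcd m q) / real m \<le> (\<Sum>d\<in>?D. if d dvd m then real d / real m else 0)" .
  qed
  also have "\<dots> = (\<Sum>d\<in>?D. \<Sum>m\<in>{1..<q}. if d dvd m then real d / real m else 0)"
    by (rule sum.swap)
  also have "\<dots> \<le> (\<Sum>d\<in>?D. harm q)"
  proof (rule sum_mono)
    fix d assume "d \<in> ?D"
    then have d: "d > 0" using assms by (auto intro: dvd_pos_nat)
    have "(\<Sum>m\<in>{1..<q}. if d dvd m then real d / real m else 0) = (\<Sum>m\<in>{m \<in> {1..<q}. d dvd m}. real d / real m)"
      by (rule sum.inter_filter[symmetric]) simp
    also have "\<dots> = (\<Sum>k\<in>(\<lambda>m. m div d) ` {m \<in> {1..<q}. d dvd m}. inverse (real k))"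
    proof (subst sum.reindex)
      show "inj_on (\<lambda>m. m div d) {m \<in> {1..<q}. d dvd m}"
        by (rule inj_onI) (use d dvd_div_eq_cancel in auto)
      show "(\<Sum>m\<in>{m \<in> {1..<q}. d dvd m}. real d / real m)
        = sum ((\<lambda>k. inverse (real k)) \<circ> (\<lambda>m. m div d)) {m \<in> {1..<q}. d dvd m}"
        by (rule sum.cong) (use d in \<open>auto simp: real_of_nat_div\<close>)
    qed
    also have "\<dots> \<le> (\<Sum>k\<in>{1..q}. inverse (real k))"
    proof (rule sum_mono2)
      show "(\<lambda>m. m div d) ` {m \<in> {1..<q}. d dvd m} \<subseteq> {1..q}"
      proof safe
        fix m assume "m \<in> {1..<q}" "d dvd m"
        then obtain k where "m = d * k" "m \<ge> 1" "m < q" by auto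
        moreover from this have "k \<le> d * k" using d by simp
        ultimately show "m div d \<in> {1..q}" using d by (cases k) auto
      qed
    qed auto
    finally show "(\<Sum>m\<in>{1..<q}. if d dvd m then real d / real m else 0) \<le> harm q"
      by (simp add: harm_def)
  qed
  finally show ?thesis by simp
qed

lemma sum_transform_bound_gcd_le:
  assumes "q > 0"
  shows "(\<Sum>m\<in>{1..<int q}. transform_bound q m * gcd m (int q)) \<le> real q * (2 * card {d. d dvd q} * harm q)"
proof -
  have "(\<Sum>m\<in>{1..<int q}. transform_bound q m * gcd m (int q))
     = (\<Sum>m\<in>{1..<q}. transform_bound q (int m) * gcd (int m) (int q))"
    by (rule sum.reindex_bij_witness[of _ int nat]) auto
  also have "\<dots> = (\<Sum>m\<in>{1..<q}. (real q / real m + real q / real (q - m)) * real (gcd m q))"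
    by (intro sum.cong refl) (simp add: transform_bound_def of_nat_diff)
  also have "\<dots> = real q * (\<Sum>m\<in>{1..<q}. real (gcd m q) / real m) + real q * (\<Sum>m\<in>{1..<q}. real (gcd m q) / real (q - m))"
    by (simp add: sum.distrib sum_distrib_left algebra_simps)
  also have "(\<Sum>m\<in>{1..<q}. real (gcd m q) / real (q - m)) = (\<Sum>m\<in>{1..<q}. real (gcd m q) / real m)"
    by (rule sum.reindex_bij_witness[of _ "\<lambda>m. q - m" "\<lambda>m. q - m"])
       (auto simp: gcd_diff2_nat)
  finally show ?thesis
    using mult_left_mono[OF sum_gcd_over_le[OF assms], of "real q"] by (simp add: mult_ac)
qed

lemma harm_le_1_plus_ln: "q > 0 \<Longrightarrow> harm q \<le> 1 + ln (real q)"
  using euler_mascheroni_sequence_decreasing[of 1 q] by (simp add: harm_expand)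

text \<open>
  In \<open>q = (\<Sum>d | d dvd q. totient d)\<close> every term is at most \<open>totient q\<close>.
\<close>

lemma totient_ge:
  assumes "q > 0"
  shows "q \<le> card {d. d dvd q} * totient q"
proof -
  have "q = (\<Sum>d | d dvd q. totient d)" by (rule totient_divisor_sum[symmetric])
  also have "\<dots> \<le> (\<Sum>d | d dvd q. totient q)"
  proof (rule sum_mono)
    fix d assume "d \<in> {d. d dvd q}"
    then show "totient d \<le> totient q"
      using assms by (intro dvd_imp_le totient_dvd) auto
  qed
  finally show ?thesis by simp
qed

lemma norm_kloosterman_le:
  assumes "q > 0" "m \<noteq> 0"
  shows "cmod (kloosterman q m n) \<le> gcd m (int q) * root 4 (2 * real q ^ 3 * real (card {d. d dvd q}) ^ 3)"
proof -
  define \<tau> where "\<tau> = real (card {d. d dvd q})"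
  define R where "R = root 4 (2 * real q ^ 3 * \<tau> ^ 3)"
  let ?k = "cmod (kloosterman q m n)" and ?g = "real_of_int (gcd m (int q))"
  have \<tau>: "\<tau> > 0" using assms by (auto simp: \<tau>_def card_gt_0_iff)
  have R: "R \<ge> 0" "R ^ 4 = 2 * real q ^ 3 * \<tau> ^ 3"
    using \<tau> by (auto simp: R_def)
  have "gcd m (int q) > 0" using assms by simp
  then have g: "?g \<ge> 1" by linarith
  have "real q * ?k ^ 4 \<le> (\<tau> * totient q) * ?k ^ 4"
    using totient_ge[OF assms(1)] unfolding \<tau>_def
    by (intro mult_right_mono) (simp_all flip: of_nat_mult)
  also have "\<dots> \<le> \<tau> * (?g * (2 * real q ^ 4 * \<tau> ^ 2))"
    using kloosterman_bound[OF assms(1), of m n] \<tau> unfolding \<tau>_def[symmetric]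
    by (simp only: mult.assoc) (intro mult_left_mono, auto)
  also have "\<dots> = real q * (?g * R ^ 4)" by (simp only: R(2)) (simp add: power_numeral_reduce)
  finally have "?k ^ 4 \<le> ?g * R ^ 4" using assms(1) by simp
  also have "\<dots> \<le> ?g ^ 4 * R ^ 4"
    using g by (intro mult_right_mono self_le_power) auto
  finally have "?k ^ 4 \<le> (?g * R) ^ 4" by (simp add: power_mult_distrib)
  then have "?k \<le> ?g * R"
    by (rule power_le_imp_le_base[of _ 3, simplified]) (use g R in auto)
  then show ?thesis by (simp add: R_def \<tau>_def)
qed

text \<open>
  The eleventh root makes the error linear in the divisor function, whose mean value is elementary.
  The fourth power of the relative error is at most \<open>8192 d(q)\<^sup>1\<^sup>1 (1 + ln q)\<^sup>8 / q\<close>; as this error never exceeds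
  one, its eleventh power is not larger than its fourth.
\<close>

definition equidistribution_error :: "nat \<Rightarrow> real" where
  "equidistribution_error q = card {d. d dvd q} * root 11 (8192 * (1 + ln (real q)) ^ 8 / real q)"

text \<open>
  The frequency \<open>(0, 0)\<close> contributes the main term. All others are bounded by the Kloosterman bound
  times the transforms of the two intervals, whose sums cost only logarithms and divisor functions.
\<close>

theorem inverse_pairs_equidistributed:
  assumes q: "q > 0" and A: "{c..<d} \<subseteq> {0..<int q}" and B: "{c'..<d'} \<subseteq> {0..<int q}"
  shows "\<bar>real (card {(a, x) \<in> inverse_pairs q. a \<in> {c..<d} \<and> x \<in> {c'..<d'}})
     - real (card {c..<d}) * real (card {c'..<d'}) * real (totient q) / (real q)\<^sup>2\<bar>
     \<le> real q * min 1 (equidistribution_error q)"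
proof -
  define \<tau> where "\<tau> = real (card {d. d dvd q})"
  define R where "R = root 4 (2 * real q ^ 3 * \<tau> ^ 3)"
  define S where "S = (\<Sum>m\<in>{1..<int q}. transform_bound q m * gcd m (int q))"
  define D where "D = 2 * \<tau> * harm q"
  let ?Z = "{0..<int q}" and ?Z' = "{1..<int q}" and ?K = "kloosterman q"
  let ?A = "interval_transform q {c..<d}" and ?B = "interval_transform q {c'..<d'}"
  let ?T = "card {(a, x) \<in> inverse_pairs q. a \<in> {c..<d} \<and> x \<in> {c'..<d'}}"
  let ?M = "card {c..<d} * card {c'..<d'} * totient q"
  have "\<tau> \<ge> 1" using q unfolding \<tau>_def
    by (metis (mono_tags, lifting) One_nat_def Suc_leI card_gt_0_iff dvd_refl empty_iff finite_divisors_nat mem_Collect_eq of_nat_1 of_nat_le_iff)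
  have "harm q \<ge> (1::real)" using harm_mono[of 1 q, where 'a=real] q by (simp add: harm_expand)
  have D: "D \<ge> 2" using mult_mono[OF \<open>\<tau> \<ge> 1\<close> \<open>harm q \<ge> 1\<close>] \<open>\<tau> \<ge> 1\<close> by (simp add: D_def)
  have R: "R \<ge> 0" "R ^ 4 = 2 * real q ^ 3 * \<tau> ^ 3" using \<open>\<tau> \<ge> 1\<close> by (auto simp: R_def)
  have tb: "transform_bound q m \<ge> 0" if "m \<in> ?Z" for m
    using that by (auto simp: transform_bound_def)
  have S: "S \<le> real q * D" "S \<ge> 0"
    using sum_transform_bound_gcd_le[OF q] tb
    by (auto simp: S_def D_def \<tau>_def intro!: sum_nonneg mult_nonneg_nonneg)
  have split: "?Z = insert 0 ?Z'" using q by auto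
  have sum_tb: "(\<Sum>n\<in>?Z. transform_bound q n) \<le> real q + S"
  proof -
    have "(\<Sum>n\<in>?Z'. transform_bound q n * 1) \<le> S"
      unfolding S_def
    proof (intro sum_mono mult_left_mono)
      fix n assume "n \<in> ?Z'"
      then have "gcd n (int q) > 0" by simp
      then show "1 \<le> real_of_int (gcd n (int q))" by linarith
    qed (use tb in auto)
    then show ?thesis unfolding split by (simp add: transform_bound_def)
  qed
  have nonzero: "norm (?A m * ?B n * ?K m n) \<le> transform_bound q m * gcd m (int q) * (transform_bound q n * R)"
    if "m \<in> ?Z'" "n \<in> ?Z" for m n
  proof -
    have "norm (?A m * ?B n * ?K m n) \<le> transform_bound q m * transform_bound q n * (gcd m (int q) * R)"
      unfolding norm_mult R_def \<tau>_def
      by (intro mult_mono norm_interval_transform_le norm_kloosterman_le mult_nonneg_nonneg tb q A B) (use that in auto)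
    then show ?thesis by (simp add: mult_ac)
  qed
  have zero: "norm (?A 0 * ?B n * ?K 0 n) \<le> transform_bound q n * gcd n (int q) * (real q * R)"
    if "n \<in> ?Z'" for n
  proof -
    have "norm (?A 0 * ?B n * ?K n 0) \<le> transform_bound q 0 * transform_bound q n * (gcd n (int q) * R)"
      unfolding norm_mult R_def \<tau>_def
      by (intro mult_mono norm_interval_transform_le norm_kloosterman_le mult_nonneg_nonneg tb q A B) (use that q in auto)
    then show ?thesis by (simp add: transform_bound_def kloosterman_commute[of q 0] mult_ac)
  qed
  have "of_nat (q ^ 2 * ?T) = (\<Sum>m\<in>?Z. \<Sum>n\<in>?Z. ?A m * ?B n * ?K m n)"
    using count_inverse_pairs_eq[OF q A B] by (simp add: sum.cartesian_product)
  also have "\<dots> = ?A 0 * ?B 0 * ?K 0 0 + (\<Sum>n\<in>?Z'. ?A 0 * ?B n * ?K 0 n) + (\<Sum>m\<in>?Z'. \<Sum>n\<in>?Z. ?A m * ?B n * ?K m n)"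
    unfolding split by simp
  also have "?A 0 * ?B 0 * ?K 0 0 = of_nat ?M"
    by (simp add: interval_transform_def kloosterman_def card_inverse_pairs[OF q] case_prod_beta)
  finally have "of_nat (q ^ 2 * ?T) - of_nat ?M
     = (\<Sum>n\<in>?Z'. ?A 0 * ?B n * ?K 0 n) + (\<Sum>m\<in>?Z'. \<Sum>n\<in>?Z. ?A m * ?B n * ?K m n)" by simp
  then have "norm (of_nat (q ^ 2 * ?T) - of_nat ?M :: complex)
     \<le> (\<Sum>n\<in>?Z'. norm (?A 0 * ?B n * ?K 0 n)) + (\<Sum>m\<in>?Z'. \<Sum>n\<in>?Z. norm (?A m * ?B n * ?K m n))"
    by (simp only:) (intro order.trans[OF norm_triangle_ineq] add_mono norm_sum sum_norm_le order_refl)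
  also have "\<dots> \<le> (\<Sum>n\<in>?Z'. transform_bound q n * gcd n (int q) * (real q * R)) +
     (\<Sum>m\<in>?Z'. \<Sum>n\<in>?Z. transform_bound q m * gcd m (int q) * (transform_bound q n * R))"
    by (intro add_mono sum_mono zero nonzero) auto
  also have "\<dots> = S * (real q * R) + S * ((\<Sum>n\<in>?Z. transform_bound q n) * R)"
    by (simp add: S_def sum_distrib_left[symmetric] sum_distrib_right[symmetric])
  also have "\<dots> \<le> S * (real q * R) + S * ((real q + S) * R)"
    using sum_tb S R by (intro add_mono mult_left_mono mult_right_mono order_refl) auto
  also have "\<dots> \<le> (real q * D) * (real q * R) + (real q * D) * ((real q + real q * D) * R)"
    using S R D by (intro add_mono mult_mono order_refl mult_nonneg_nonneg add_nonneg_nonneg) auto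
  also have "\<dots> = (real q)\<^sup>2 * (R * D * (2 + D))"
    by (simp add: power2_eq_square algebra_simps)
  also have "\<dots> \<le> (real q)\<^sup>2 * (R * D * (2 * D))"
    using D R by (intro mult_left_mono mult_nonneg_nonneg) auto
  finally have bound: "norm (of_nat (q ^ 2 * ?T) - of_nat ?M :: complex) \<le> (real q)\<^sup>2 * (2 * R * D\<^sup>2)"
    by (simp add: power2_eq_square mult_ac)
  define e where "e = \<bar>real ?T - real ?M / (real q)\<^sup>2\<bar> / real q"
  have "norm (of_nat (q ^ 2 * ?T) - of_nat ?M :: complex) = \<bar>real (q ^ 2 * ?T) - real ?M\<bar>"
  proof -
    have "(of_nat a - of_nat b :: complex) = of_real (real a - real b)" for a b by simp
    then show ?thesis by (simp only: norm_of_real)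
  qed
  also have "real (q ^ 2 * ?T) - real ?M = (real q)\<^sup>2 * (real ?T - real ?M / (real q)\<^sup>2)"
    using q by (simp add: right_diff_distrib)
  also have "\<bar>\<dots>\<bar> = (real q)\<^sup>2 * (real q * e)"
    using q by (simp add: e_def abs_mult)
  finally have "(real q)\<^sup>2 * (real q * e) \<le> (real q)\<^sup>2 * (2 * R * D\<^sup>2)" using bound by simp
  then have e_le: "real q * e \<le> 2 * R * D\<^sup>2" using q by simp
  have e0: "e \<ge> 0" by (simp add: e_def)
  have e1: "e \<le> 1"
  proof -
    have "?T \<le> card (inverse_pairs q)" by (intro card_mono) auto
    also have "\<dots> \<le> q" using card_inverse_pairs[OF q] totient_le by simp
    finally have T: "?T \<le> q" .
    have "card {c..<d} \<le> q" "card {c'..<d'} \<le> q"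
      using card_mono[OF _ A] card_mono[OF _ B] by auto
    then have "?M \<le> q * q * q" by (intro mult_le_mono totient_le)
    then have "real ?M \<le> real q * (real q)\<^sup>2"
      by (metis of_nat_le_iff of_nat_mult power2_eq_square mult.assoc)
    then have "real ?M / (real q)\<^sup>2 \<le> real q" "0 \<le> real ?M / (real q)\<^sup>2" using q by (auto simp: divide_simps)
    with T have "\<bar>real ?T - real ?M / (real q)\<^sup>2\<bar> \<le> real q" by linarith
    then show ?thesis using q by (simp add: e_def)
  qed
  have ln: "harm q \<le> 1 + ln (real q)" by (rule harm_le_1_plus_ln[OF q])
  have "(real q * e) ^ 4 \<le> (2 * R * D\<^sup>2) ^ 4" using e_le e0 by (intro power_mono) auto
  also have "\<dots> = 8192 * \<tau> ^ 11 * harm q ^ 8 * real q ^ 3"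
  proof -
    have "(2 * R * D\<^sup>2) ^ 4 = 16 * R ^ 4 * D ^ 8" by (simp add: power_mult_distrib flip: power_mult)
    then show ?thesis unfolding R(2) D_def by (simp add: power_mult_distrib power_numeral_reduce)
  qed
  also have "\<dots> \<le> 8192 * \<tau> ^ 11 * (1 + ln (real q)) ^ 8 * real q ^ 3"
    using \<open>\<tau> \<ge> 1\<close> \<open>harm q \<ge> 1\<close> ln by (intro mult_left_mono mult_right_mono power_mono) auto
  finally have "real q ^ 3 * (real q * e ^ 4) \<le> real q ^ 3 * (8192 * \<tau> ^ 11 * (1 + ln (real q)) ^ 8)"
    by (simp add: power_mult_distrib power_numeral_reduce mult_ac)
  then have e4: "e ^ 4 \<le> \<tau> ^ 11 * (8192 * (1 + ln (real q)) ^ 8 / real q)"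
    using q by (simp add: field_simps)
  have "e ^ 11 \<le> e ^ 4" using e0 e1 by (intro power_decreasing) auto
  also note e4
  also have "\<tau> ^ 11 * (8192 * (1 + ln (real q)) ^ 8 / real q) = equidistribution_error q ^ 11"
    using q by (simp add: equidistribution_error_def \<tau>_def power_mult_distrib odd_real_root_pow)
  finally have "e ^ 11 \<le> equidistribution_error q ^ 11" .
  moreover have "equidistribution_error q \<ge> 0"
    using q by (auto simp: equidistribution_error_def intro!: mult_nonneg_nonneg real_root_ge_zero divide_nonneg_nonneg)
  ultimately have "e \<le> equidistribution_error q"
    by (intro power_le_imp_le_base[of e 10 "equidistribution_error q"]) auto
  with e1 have "real q * e \<le> real q * min 1 (equidistribution_error q)"
    by (intro mult_left_mono) auto
  then show ?thesis using q by (simp add: e_def)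
qed

section \<open>Limits of interval functions and mean values\<close>

text \<open>
  Additive functions of intervals converge if they do so on every short interval up to a relative
  error; the errors add up to at most \<open>\<eta> (b - a)\<close>. Both the Riemann sums below and the passage from slopes
  to directions use this form of a partition argument.
\<close>

lemma local_to_global:
  fixes G :: "'a \<Rightarrow> real \<Rightarrow> real" and F :: "real \<Rightarrow> real"
  assumes "a \<le> b"
    and local: "\<And>\<eta>. \<eta> > 0 \<Longrightarrow> \<exists>d>0. \<forall>y\<ge>a. \<forall>y'\<le>b. y < y' \<and> y' - y < d \<longrightarrow>
      (\<forall>\<^sub>F \<epsilon> in L. \<bar>(G \<epsilon> y' - G \<epsilon> y) - (F y' - F y)\<bar> \<le> \<eta> * (y' - y))"
  shows "((\<lambda>\<epsilon>. G \<epsilon> b - G \<epsilon> a) \<longlongrightarrow> F b - F a) L"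
proof (cases "a = b")
  case True
  then show ?thesis by simp
next
  case False
  with assms(1) have ab: "a < b" by simp
  show ?thesis
  proof (rule tendstoI)
    fix e :: real assume e: "e > 0"
    define \<eta> where "\<eta> = e / (2 * (b - a))"
    have \<eta>: "\<eta> > 0" using e ab by (simp add: \<eta>_def)
    obtain d where d: "d > 0" and loc: "\<And>y y'. a \<le> y \<Longrightarrow> y' \<le> b \<Longrightarrow> y < y' \<Longrightarrow> y' - y < d \<Longrightarrow>
        \<forall>\<^sub>F \<epsilon> in L. \<bar>(G \<epsilon> y' - G \<epsilon> y) - (F y' - F y)\<bar> \<le> \<eta> * (y' - y)"
      using local[OF \<eta>] by blast
    obtain K :: nat where K: "(b - a) / d < real K" using reals_Archimedean2 by blast
    have "(b - a) / d > 0" using ab d by simp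
    then have K0: "real K > 0" using K by linarith
    define w where "w = (b - a) / real K"
    define x where "x i = a + real i * w" for i
    have x0: "x 0 = a" and xK: "x K = b" using K0 by (auto simp: x_def w_def)
    have step: "x (Suc i) - x i = (b - a) / real K" for i
      unfolding w_def[symmetric] x_def by (simp add: algebra_simps)
    have step_pos: "x i < x (Suc i)" for i proof -
      have "(b - a) / real K > 0" using ab K0 by simp
      then show ?thesis using step[of i] by linarith
    qed
    have small: "x (Suc i) - x i < d" for i using K K0 d by (simp add: step field_simps)
    have mono: "mono x" using step_pos by (simp add: incseq_Suc_iff less_imp_le)
    have "\<forall>\<^sub>F \<epsilon> in L. \<forall>i\<in>{..<K}. \<bar>(G \<epsilon> (x (Suc i)) - G \<epsilon> (x i)) - (F (x (Suc i)) - F (x i))\<bar> \<le> \<eta> * (x (Suc i) - x i)"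
    proof (rule eventually_ball_finite, simp, intro ballI)
      fix i assume "i \<in> {..<K}"
      then have "x (Suc i) \<le> x K" by (intro monoD[OF mono]) auto
      moreover have "x 0 \<le> x i" by (intro monoD[OF mono]) auto
      ultimately show "\<forall>\<^sub>F \<epsilon> in L. \<bar>(G \<epsilon> (x (Suc i)) - G \<epsilon> (x i)) - (F (x (Suc i)) - F (x i))\<bar> \<le> \<eta> * (x (Suc i) - x i)"
        using loc step_pos small by (simp add: x0 xK)
    qed
    then show "\<forall>\<^sub>F \<epsilon> in L. dist (G \<epsilon> b - G \<epsilon> a) (F b - F a) < e"
    proof eventually_elim
      case (elim \<epsilon>)
      have "\<bar>(G \<epsilon> b - G \<epsilon> a) - (F b - F a)\<bar> = \<bar>\<Sum>i<K. (G \<epsilon> (x (Suc i)) - G \<epsilon> (x i)) - (F (x (Suc i)) - F (x i))\<bar>"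
        using sum_lessThan_telescope[of "\<lambda>i. G \<epsilon> (x i) - F (x i)" K] by (simp add: x0 xK algebra_simps)
      also have "\<dots> \<le> (\<Sum>i<K. \<eta> * (x (Suc i) - x i))"
        using elim by (intro order.trans[OF sum_abs] sum_mono) auto
      also have "\<dots> = \<eta> * (b - a)"
        by (simp only: sum_distrib_left[symmetric] sum_lessThan_telescope x0 xK)
      also have "\<dots> = e / 2" using ab by (simp add: \<eta>_def divide_simps)
      also have "\<dots> < e" using e by simp
      finally show ?case by (simp add: dist_real_def)
    qed
  qed
qed

lemma real_nat_div_bounds:
  fixes N e :: nat
  shows "real (N div e) \<le> real N / real e" "real N / real e \<le> real (N div e) + 1"
  using floor_divide_of_nat_eq[of N e, where 'a=real] by linarith+

lemma sum_divisor_count_le: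
  assumes "N > 0"
  shows "real (\<Sum>q\<in>{1..N}. card {d. d dvd q}) \<le> real N * (1 + ln (real N))"
proof -
  have "(\<Sum>q\<in>{1..N}. card {d. d dvd q}) = (\<Sum>q\<in>{1..N}. \<Sum>d\<in>{1..N}. if d dvd q then 1 else 0)"
  proof (rule sum.cong[OF refl])
    fix q assume q: "q \<in> {1..N}"
    have "d \<in> {1..N}" if "d dvd q" for d
      using that q dvd_imp_le[of d q] dvd_pos_nat[of q d] by auto
    then have "{d. d dvd q} = {1..N} \<inter> {d. d dvd q}" by blast
    then show "card {d. d dvd q} = (\<Sum>d\<in>{1..N}. if d dvd q then 1 else 0)"
      by (simp add: sum.If_cases)
  qed
  also have "\<dots> = (\<Sum>d\<in>{1..N}. \<Sum>q\<in>{1..N}. if d dvd q then 1 else 0)"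
    by (rule sum.swap)
  also have "real \<dots> \<le> (\<Sum>d\<in>{1..N}. real N * inverse (real d))"
    unfolding of_nat_sum
  proof (rule sum_mono)
    fix d assume d: "d \<in> {1..N}"
    have "(\<Sum>q\<in>{1..N}. if d dvd q then 1 else 0 :: nat) = card {q \<in> {1..N}. d dvd q}"
      by (simp add: sum.If_cases Int_def)
    also have "{q \<in> {1..N}. d dvd q} \<subseteq> (\<lambda>k. d * k) ` {1..N div d}"
      using d by (auto elim!: dvdE simp: less_eq_div_iff_mult_less_eq mult.commute image_iff)
    then have "card {q \<in> {1..N}. d dvd q} \<le> N div d"
      by (metis (no_types, lifting) card_atLeastAtMost card_image_le card_mono diff_Suc_1 finite_atLeastAtMost finite_imageI le_trans)
    also have "real (N div d) \<le> real N * inverse (real d)"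
      using real_nat_div_bounds(1)[of N d] by (simp add: divide_inverse)
    finally show "(\<Sum>q\<in>{1..N}. real (if d dvd q then 1 else 0)) \<le> real N * inverse (real d)"
      unfolding of_nat_sum by simp
  qed
  also have "\<dots> = real N * harm N" by (simp add: harm_def sum_distrib_left)
  also have "\<dots> \<le> real N * (1 + ln (real N))"
    using harm_le_1_plus_ln[OF assms] by (intro mult_left_mono) auto
  finally show ?thesis .
qed

lemma equidistribution_error_nonneg: "0 \<le> equidistribution_error q"
proof (cases "q = 0")
  case False
  then show ?thesis
    by (auto simp: equidistribution_error_def intro!: mult_nonneg_nonneg real_root_ge_zero divide_nonneg_nonneg)
qed (simp add: equidistribution_error_def)

text \<open>
  Below \<open>sqrt N\<close> the trivial bound one suffices. Above it, the root is uniformly small, and the divisor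
  function has mean \<open>O(ln N)\<close>.
\<close>

lemma equidistribution_error_cesaro:
  "(\<lambda>N. (\<Sum>q\<in>{1..N}. min 1 (equidistribution_error q)) / real N) \<longlonglongrightarrow> 0"
proof (rule tendsto_sandwich)
  let ?b = "\<lambda>N. 1 / sqrt (real N) + (1 + ln (real N)) * root 11 (8192 * (1 + ln (real N)) ^ 8 / sqrt (real N))"
  show "\<forall>\<^sub>F N in sequentially. 0 \<le> (\<Sum>q\<in>{1..N}. min 1 (equidistribution_error q)) / real N"
    by (intro always_eventually allI divide_nonneg_nonneg sum_nonneg) (auto simp: equidistribution_error_nonneg)
  show "\<forall>\<^sub>F N in sequentially. (\<Sum>q\<in>{1..N}. min 1 (equidistribution_error q)) / real N \<le> ?b N"
    using eventually_gt_at_top[of 0]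
  proof eventually_elim
    case (elim N)
    let ?M = "sqrt (real N)" and ?r = "root 11 (8192 * (1 + ln (real N)) ^ 8 / sqrt (real N))"
    have "(\<Sum>q\<in>{1..N}. min 1 (equidistribution_error q)) \<le> (\<Sum>q\<in>{1..N}. (if real q \<le> ?M then 1 else 0) + card {d. d dvd q} * ?r)"
    proof (rule sum_mono)
      fix q assume q: "q \<in> {1..N}"
      have r0: "?r \<ge> 0" using elim by (intro real_root_ge_zero divide_nonneg_nonneg) auto
      show "min 1 (equidistribution_error q) \<le> (if real q \<le> ?M then 1 else 0) + card {d. d dvd q} * ?r"
      proof (cases "real q \<le> ?M")
        case True
        then show ?thesis using r0 by (simp add: min.coboundedI1)
      next
        case False
        have "8192 * (1 + ln (real q)) ^ 8 / real q \<le> 8192 * (1 + ln (real N)) ^ 8 / ?M"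
          using q False elim by (intro frac_le mult_left_mono power_mono add_mono) auto
        then have "equidistribution_error q \<le> card {d. d dvd q} * ?r"
          unfolding equidistribution_error_def by (intro mult_left_mono real_root_le_mono) auto
        then show ?thesis using False by (simp add: min.coboundedI2)
      qed
    qed
    also have "\<dots> = real (card {q \<in> {1..N}. real q \<le> ?M}) + real (\<Sum>q\<in>{1..N}. card {d. d dvd q}) * ?r"
      by (simp add: sum.distrib sum_distrib_right sum.If_cases Int_def)
    also have "\<dots> \<le> ?M + (real N * (1 + ln (real N))) * ?r"
    proof (intro add_mono mult_right_mono sum_divisor_count_le elim)
      have "{q \<in> {1..N}. real q \<le> ?M} \<subseteq> {1..nat \<lfloor>?M\<rfloor>}" by (auto simp: le_nat_floor)
      then have "card {q \<in> {1..N}. real q \<le> ?M} \<le> nat \<lfloor>?M\<rfloor>"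
        by (metis card_atLeastAtMost card_mono diff_Suc_1 finite_atLeastAtMost)
      then show "real (card {q \<in> {1..N}. real q \<le> ?M}) \<le> ?M"
        using of_nat_floor[of ?M] by (meson of_nat_le_iff order.trans real_sqrt_ge_zero of_nat_0_le_iff)
      show "?r \<ge> 0" using elim by (intro real_root_ge_zero divide_nonneg_nonneg) auto
    qed
    finally have "(\<Sum>q\<in>{1..N}. min 1 (equidistribution_error q)) / real N \<le> (?M + (real N * (1 + ln (real N))) * ?r) / real N"
      by (rule divide_right_mono) simp
    also have "\<dots> = ?b N"
    proof -
      have "?M / real N = 1 / ?M" using elim by (simp add: field_simps)
      then show ?thesis using elim by (simp add: add_divide_distrib)
    qed
    finally show ?case .
  qed
  have "\<forall>\<^sub>F N :: nat in sequentially. ?b N = 1 / real N powr (1/2) + (1 + ln (real N)) * (8192 * (1 + ln (real N)) ^ 8 / real N powr (1/2)) powr (1/11)"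
    using eventually_gt_at_top[of 0] by eventually_elim (simp add: root_powr_inverse powr_half_sqrt)
  moreover have "(\<lambda>N. 1 / real N powr (1/2) + (1 + ln (real N)) * (8192 * (1 + ln (real N)) ^ 8 / real N powr (1/2)) powr (1/11)) \<longlonglongrightarrow> 0"
    by real_asymp
  ultimately show "?b \<longlonglongrightarrow> 0" by (simp add: tendsto_cong)
qed auto

definition totient_ratio_sum :: "nat \<Rightarrow> real" where
  "totient_ratio_sum N = (\<Sum>q\<in>{1..N}. real (totient q) / real q)"

text \<open>
  Dividing \<open>n = (\<Sum>d | d dvd n. totient d)\<close> by \<open>n = d e\<close> and summing over \<open>n \<le> N\<close>.
\<close>

lemma totient_ratio_sum_inversion: "(\<Sum>e\<in>{1..N}. totient_ratio_sum (N div e) / real e) = real N"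
proof -
  have "real N = (\<Sum>n\<in>{1..N}. (\<Sum>d | d dvd n. real (totient d)) / real n)"
    by (simp add: totient_divisor_sum flip: of_nat_sum)
  also have "\<dots> = (\<Sum>(n, d)\<in>Sigma {1..N} (\<lambda>n. {d. d dvd n}). real (totient d) / real n)"
    unfolding sum_divide_distrib by (intro sum.Sigma) (auto)
  also have "\<dots> = (\<Sum>(e, d)\<in>Sigma {1..N} (\<lambda>e. {1..N div e}). real (totient d) / real d / real e)"
  proof (rule sum.reindex_bij_witness[of _ "\<lambda>p. (snd p * fst p, snd p)" "\<lambda>p. (fst p div snd p, snd p)"])
    fix p assume p: "p \<in> (SIGMA n:{1..N}. {d. d dvd n})"
    then obtain d k where nd: "p = (d * k, d)" and N: "1 \<le> d * k" "d * k \<le> N" by (auto elim!: dvdE)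
    from N(1) have pos: "d > 0" "k > 0" by (auto intro!: Nat.gr0I)
    show "(snd (fst p div snd p, snd p) * fst (fst p div snd p, snd p), snd (fst p div snd p, snd p)) = p"
      using pos by (simp add: nd)
    have "k \<le> d * k" using pos by simp
    then have "k \<le> N" using N(2) by linarith
    have "d \<le> N div k" using N(2) pos by (simp add: less_eq_div_iff_mult_less_eq)
    then show "(fst p div snd p, snd p) \<in> (SIGMA e:{1..N}. {1..N div e})"
      using pos \<open>k \<le> N\<close> by (simp add: nd)
    show "(case (fst p div snd p, snd p) of (e, d) \<Rightarrow> real (totient d) / real d / real e)
        = (case p of (n, d) \<Rightarrow> real (totient d) / real n)"
      using pos by (simp add: nd)
  next
    fix p assume "p \<in> (SIGMA e:{1..N}. {1..N div e})"
    then show "(fst (snd p * fst p, snd p) div snd (snd p * fst p, snd p), snd (snd p * fst p, snd p)) = p"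
      "(snd p * fst p, snd p) \<in> (SIGMA n:{1..N}. {d. d dvd n})"
      by (auto simp: less_eq_div_iff_mult_less_eq)
  qed
  also have "\<dots> = (\<Sum>e\<in>{1..N}. totient_ratio_sum (N div e) / real e)"
    unfolding totient_ratio_sum_def sum_divide_distrib by (intro sum.Sigma[symmetric]) auto
  finally show ?thesis by simp
qed

text \<open>
  What matters below is that the bound is less than one.
\<close>

lemma sum_inverse_squares_from_2: "(\<Sum>e\<in>{2..N}. 1 / (real e)\<^sup>2) \<le> 3/4"
proof -
  have "(\<Sum>e\<in>{2..Suc (Suc n)}. 1 / (real e)\<^sup>2) \<le> 3/4 - 1 / real (Suc (Suc n))" for n
  proof (induction n)
    case (Suc n)
    have "1 / (real (Suc (Suc (Suc n))))\<^sup>2 \<le> 1 / (real (Suc (Suc n)) * real (Suc (Suc (Suc n))))"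
      by (intro divide_left_mono) (auto simp: power2_eq_square)
    also have "\<dots> = 1 / real (Suc (Suc n)) - 1 / real (Suc (Suc (Suc n)))"
      by (simp add: field_simps)
    finally show ?case using Suc by simp
  qed (simp add: numeral_2_eq_2 atLeastAtMostSuc_conv)
  then have *: "(\<Sum>e\<in>{2..Suc (Suc n)}. 1 / (real e)\<^sup>2) \<le> 3/4" for n
    by (rule order.trans) simp
  show ?thesis
  proof (cases "N < 2")
    case False
    then obtain n where "N = Suc (Suc n)" by (metis Suc_1 add_2_eq_Suc le_Suc_ex not_less)
    then show ?thesis using * by simp
  qed simp
qed

lemma little_o_linear_bound:
  fixes f :: "nat \<Rightarrow> real"
  assumes "(\<lambda>N. f N / real N) \<longlonglongrightarrow> 0" "\<delta> > 0"
  shows "\<exists>C\<ge>0. \<forall>N. \<bar>f N\<bar> \<le> \<delta> * real N + C"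
proof -
  obtain M where M: "\<And>N. N \<ge> M \<Longrightarrow> \<bar>f N / real N\<bar> < \<delta>"
    using LIMSEQ_D[OF assms] by auto
  let ?C = "\<Sum>N\<le>M. \<bar>f N\<bar>"
  have C: "?C \<ge> 0" by (simp add: sum_nonneg)
  have "\<bar>f N\<bar> \<le> \<delta> * real N + ?C" for N
  proof (cases "N \<le> M")
    case True
    then have "\<bar>f N\<bar> \<le> ?C" by (intro member_le_sum) auto
    then show ?thesis using assms(2) by (simp add: add_increasing)
  next
    case False
    then have "\<bar>f N\<bar> < \<delta> * real N" using M[of N] by (simp add: divide_simps split: if_splits)
    then show ?thesis using C by linarith
  qed
  with C show ?thesis by blast
qed

lemma harm_over_n_tendsto_0: "(\<lambda>N. harm N / real N :: real) \<longlonglongrightarrow> 0"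
proof (rule tendsto_sandwich[of "\<lambda>_. 0"])
  show "\<forall>\<^sub>F N in sequentially. harm N / real N \<le> (1 + ln (real N)) / real N"
    using eventually_gt_at_top[of 0]
    by eventually_elim (simp add: divide_right_mono harm_le_1_plus_ln)
  show "(\<lambda>N. (1 + ln (real N)) / real N) \<longlonglongrightarrow> 0" by real_asymp
qed (auto simp: harm_nonneg)

text \<open>
  With \<open>r N = totient_ratio_sum N - c N\<close> and \<open>c = 6 / \<pi>\<^sup>2\<close>, the inversion formula gives
  \<open>\<bar>r N\<bar> \<le> (\<Sum>e = 2..N. \<bar>r (N div e)\<bar> / e) + o(N)\<close>. Hence a bound \<open>\<bar>r N\<bar> \<le> a N + O(1)\<close> improves itself by a
  constant factor, because \<open>(\<Sum>e\<ge>2. 1 / e\<^sup>2) < 1\<close>. The value of \<open>c\<close> is the one for which the terms linear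
  in \<open>N\<close> cancel.
\<close>

theorem totient_ratio_mean: "(\<lambda>N. totient_ratio_sum N / real N) \<longlonglongrightarrow> 6 / pi\<^sup>2"
proof -
  define c where "c = 6 / pi\<^sup>2"
  define r where "r N = totient_ratio_sum N - c * real N" for N
  define T where "T N = real N - c * (\<Sum>e\<in>{1..N}. real (N div e) / real e)" for N
  have c: "0 < c" "c \<le> 1"
  proof -
    have "pi\<^sup>2 > 3\<^sup>2" using pi_gt3 by (intro power_strict_mono) auto
    then show "0 < c" "c \<le> 1" by (auto simp: c_def divide_simps)
  qed
  have sum_r: "(\<Sum>e\<in>{1..N}. r (N div e) / real e) = T N" for N
    using totient_ratio_sum_inversion[of N]
    by (simp add: r_def T_def diff_divide_distrib sum_subtractf sum_distrib_left)
  have T: "(\<lambda>N. T N / real N) \<longlonglongrightarrow> 0"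
  proof (rule Lim_null_comparison)
    let ?s = "\<lambda>N. \<Sum>e<N. 1 / (real e + 1)\<^sup>2"
    show "\<forall>\<^sub>F N in sequentially. norm (T N / real N) \<le> \<bar>1 - c * ?s N\<bar> + harm N / real N"
      using eventually_gt_at_top[of 0]
    proof eventually_elim
      case (elim N)
      define D where "D = (\<Sum>e\<in>{1..N}. real N / real e / real e - real (N div e) / real e)"
      have "0 \<le> real N / real e / real e - real (N div e) / real e \<and>
         real N / real e / real e - real (N div e) / real e \<le> inverse (real e)" if "e \<in> {1..N}" for e
      proof -
        have e: "real e > 0" using that by simp
        have "real N / real e - real (N div e) \<le> 1" "0 \<le> real N / real e - real (N div e)"
          using real_nat_div_bounds[of N e] by auto
        then have "(real N / real e - real (N div e)) / real e \<le> 1 / real e" "0 \<le> (real N / real e - real (N div e)) / real e"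
          using e by (auto intro: divide_right_mono)
        then show ?thesis by (simp add: diff_divide_distrib inverse_eq_divide)
      qed
      then have D: "0 \<le> D" "D \<le> harm N"
        unfolding D_def harm_def by (auto intro!: sum_nonneg sum_mono)
      have "(\<Sum>e\<in>{1..N}. real N / real e / real e) = real N * ?s N"
        unfolding sum_distrib_left
        by (rule sum.reindex_bij_witness[of _ Suc "\<lambda>e. e - 1"]) (auto simp: power2_eq_square)
      then have "T N = real N * (1 - c * ?s N) + c * D"
        by (simp add: T_def D_def sum_subtractf algebra_simps)
      then have "T N / real N = (1 - c * ?s N) + c * D / real N"
        using elim by (simp add: add_divide_distrib)
      moreover have "c * D / real N \<le> harm N / real N" "0 \<le> c * D / real N"
        using c D mult_mono[of c 1 D "harm N"] by (auto intro!: divide_right_mono)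
      ultimately show ?case unfolding real_norm_def by linarith
    qed
    have "?s \<longlonglongrightarrow> pi\<^sup>2 / 6"
      using inverse_squares_sums by (simp add: sums_def add.commute)
    then have "(\<lambda>N. \<bar>1 - c * ?s N\<bar> + harm N / real N) \<longlonglongrightarrow> \<bar>1 - c * (pi\<^sup>2 / 6)\<bar> + 0"
      by (intro tendsto_intros harm_over_n_tendsto_0)
    then show "(\<lambda>N. \<bar>1 - c * ?s N\<bar> + harm N / real N) \<longlonglongrightarrow> 0" by (simp add: c_def)
  qed
  have iter: "\<exists>C\<ge>0. \<forall>N. \<bar>r N\<bar> \<le> (7/8) ^ k * real N + C" for k
  proof (induction k)
    case 0
    have "\<bar>r N\<bar> \<le> real N" for N
    proof -
      have "totient_ratio_sum N \<le> (\<Sum>q\<in>{1..N}. 1)"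
        unfolding totient_ratio_sum_def by (intro sum_mono) (auto simp: totient_le divide_le_eq)
      moreover have "totient_ratio_sum N \<ge> 0"
        unfolding totient_ratio_sum_def by (intro sum_nonneg) auto
      moreover have "0 \<le> c * real N" "c * real N \<le> real N"
        using c mult_right_mono[of c 1 "real N"] by auto
      ultimately show ?thesis unfolding r_def by simp
    qed
    then show ?case by (intro exI[of _ 0]) simp
  next
    case (Suc k)
    \<comment> \<open>One step gains a factor \<open>3/4\<close> from the squares; the margin up to \<open>7/8\<close> pays for the error terms of order \<open>o(N)\<close>.\<close>
    define a :: real where "a = (7/8) ^ k"
    have a: "a > 0" by (simp add: a_def)
    obtain C where C: "C \<ge> 0" "\<And>N. \<bar>r N\<bar> \<le> a * real N + C" using Suc by (auto simp: a_def)
    have "(\<lambda>N. (\<bar>T N\<bar> + C * harm N) / real N) \<longlonglongrightarrow> 0"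
    proof -
      have "(\<lambda>N. \<bar>T N / real N\<bar> + C * (harm N / real N)) \<longlonglongrightarrow> \<bar>0\<bar> + C * 0"
        by (intro tendsto_intros T harm_over_n_tendsto_0)
      then show ?thesis by (simp add: add_divide_distrib)
    qed
    from little_o_linear_bound[OF this, of "a / 8"]
    obtain C' where C': "C' \<ge> 0" "\<And>N. \<bar>\<bar>T N\<bar> + C * harm N\<bar> \<le> (a / 8) * real N + C'"
      using a by auto
    have "\<bar>r N\<bar> \<le> (7/8) ^ Suc k * real N + C'" for N
    proof (cases "N = 0")
      case True
      then show ?thesis using C' by (simp add: r_def totient_ratio_sum_def)
    next
      case False
      then have "{1..N} = insert 1 {2..N}" by auto
      then have "r N + (\<Sum>e\<in>{2..N}. r (N div e) / real e) = T N"
        using sum_r[of N] by simp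
      then have "\<bar>r N\<bar> \<le> \<bar>T N\<bar> + \<bar>\<Sum>e\<in>{2..N}. r (N div e) / real e\<bar>" by linarith
      also have "\<bar>\<Sum>e\<in>{2..N}. r (N div e) / real e\<bar> \<le> (\<Sum>e\<in>{2..N}. a * real N * (1 / (real e)\<^sup>2) + C * inverse (real e))"
      proof (intro order.trans[OF sum_abs] sum_mono)
        fix e assume "e \<in> {2..N}"
        then have e: "real e > 0" by simp
        have "\<bar>r (N div e)\<bar> \<le> a * real (N div e) + C" by (rule C)
        also have "\<dots> \<le> a * (real N / real e) + C"
          using mult_left_mono[OF real_nat_div_bounds(1)[of N e], of a] a by simp
        finally have "\<bar>r (N div e)\<bar> / real e \<le> (a * (real N / real e) + C) / real e"
          using e by (intro divide_right_mono) auto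
        then show "\<bar>r (N div e) / real e\<bar> \<le> a * real N * (1 / (real e)\<^sup>2) + C * inverse (real e)"
          using e by (simp add: add_divide_distrib power2_eq_square inverse_eq_divide)
      qed
      also have "\<dots> = a * real N * (\<Sum>e\<in>{2..N}. 1 / (real e)\<^sup>2) + C * (\<Sum>e\<in>{2..N}. inverse (real e))"
        by (simp only: sum.distrib sum_distrib_left)
      also have "\<dots> \<le> a * real N * (3/4) + C * harm N"
        unfolding harm_def using a C(1) sum_inverse_squares_from_2[of N]
        by (intro add_mono mult_left_mono sum_mono2) auto
      finally have "\<bar>r N\<bar> \<le> a * real N * (3/4) + (\<bar>T N\<bar> + C * harm N)" by simp
      also have "\<dots> \<le> a * real N * (3/4) + ((a / 8) * real N + C')"
        using C'(2)[of N] by linarith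
      finally show ?thesis by (simp add: a_def mult_ac)
    qed
    then show ?case using C'(1) by blast
  qed
  have "(\<lambda>N. r N / real N) \<longlonglongrightarrow> 0"
  proof (rule LIMSEQ_I)
    fix e :: real assume e: "e > 0"
    obtain k where k: "(7/8 :: real) ^ k < e / 2"
      using real_arch_pow_inv[of "e/2" "7/8"] e by auto
    obtain C where C: "C \<ge> 0" "\<And>N. \<bar>r N\<bar> \<le> (7/8) ^ k * real N + C" using iter by blast
    obtain M where M: "real M > 2 * C / e" using reals_Archimedean2 by blast
    show "\<exists>no. \<forall>N\<ge>no. norm (r N / real N - 0) < e"
    proof (intro exI[of _ "Suc M"] allI impI)
      fix N assume N: "N \<ge> Suc M"
      then have "real N > 2 * C / e" "real N > 0" using M by auto
      then have "C < e / 2 * real N" using e by (simp add: field_simps)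
      moreover have "(7/8) ^ k * real N \<le> e / 2 * real N" using k by (intro mult_right_mono) auto
      ultimately have "\<bar>r N\<bar> < e * real N" using C(2)[of N] by linarith
      then show "norm (r N / real N - 0) < e" using \<open>real N > 0\<close> by (simp add: divide_simps)
    qed
  qed
  then have "(\<lambda>N. r N / real N + c) \<longlonglongrightarrow> 0 + c" by (intro tendsto_intros)
  moreover have "\<forall>\<^sub>F N in sequentially. r N / real N + c = totient_ratio_sum N / real N"
    using eventually_gt_at_top[of 0] by eventually_elim (simp add: r_def diff_divide_distrib)
  ultimately show ?thesis by (simp add: c_def tendsto_cong)
qed

lemma scaled_floor_tendsto:
  assumes "y \<ge> 0"
  shows "((\<lambda>\<delta>. \<delta> * real (nat \<lfloor>y / \<delta>\<rfloor>)) \<longlongrightarrow> y) (at_right 0)"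
proof (rule tendsto_sandwich)
  have *: "y - \<delta> \<le> \<delta> * real (nat \<lfloor>y / \<delta>\<rfloor>) \<and> \<delta> * real (nat \<lfloor>y / \<delta>\<rfloor>) \<le> y" if "\<delta> > 0" for \<delta> :: real
  proof -
    have "y / \<delta> - 1 \<le> real (nat \<lfloor>y / \<delta>\<rfloor>)" "real (nat \<lfloor>y / \<delta>\<rfloor>) \<le> y / \<delta>"
      using assms that by (auto simp: divide_nonneg_pos)
    then show ?thesis using that by (auto simp: field_simps)
  qed
  show "\<forall>\<^sub>F \<delta> in at_right 0. y - \<delta> \<le> \<delta> * real (nat \<lfloor>y / \<delta>\<rfloor>)"
    "\<forall>\<^sub>F \<delta> in at_right 0. \<delta> * real (nat \<lfloor>y / \<delta>\<rfloor>) \<le> y"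
    using * by (auto simp: eventually_at_right_field intro!: exI[of _ 1])
  show "((\<lambda>\<delta>. y - \<delta>) \<longlongrightarrow> y) (at_right 0)"
    by (auto intro!: tendsto_eq_intros)
qed auto

lemma scaled_mean_tendsto:
  fixes a :: "nat \<Rightarrow> real"
  assumes a: "(\<lambda>N. a N / real N) \<longlonglongrightarrow> c" and "a 0 = 0" and y: "y \<ge> 0"
  shows "((\<lambda>\<delta>. \<delta> * a (nat \<lfloor>y / \<delta>\<rfloor>)) \<longlongrightarrow> c * y) (at_right 0)"
proof (cases "y = 0")
  case True
  then show ?thesis using assms by simp
next
  case False
  then have y: "y > 0" using y by simp
  have "filterlim (\<lambda>\<delta>. y / \<delta>) at_top (at_right 0)" using y by real_asymp
  then have *: "\<forall>\<^sub>F \<delta> in at_right 0. real Z \<le> y / \<delta>" for Z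
    by (simp add: filterlim_at_top)
  have "filterlim (\<lambda>\<delta>. nat \<lfloor>y / \<delta>\<rfloor>) at_top (at_right 0)"
    unfolding filterlim_at_top
  proof
    fix Z show "\<forall>\<^sub>F \<delta> in at_right 0. Z \<le> nat \<lfloor>y / \<delta>\<rfloor>"
      using *[of Z] by (rule eventually_mono) (rule le_nat_floor)
  qed
  then have "((\<lambda>\<delta>. a (nat \<lfloor>y / \<delta>\<rfloor>) / real (nat \<lfloor>y / \<delta>\<rfloor>) * (\<delta> * real (nat \<lfloor>y / \<delta>\<rfloor>))) \<longlongrightarrow> c * y) (at_right 0)"
    using y by (intro tendsto_mult scaled_floor_tendsto filterlim_compose[OF a]) auto
  moreover have "a N / real N * (\<delta> * real N) = \<delta> * a N" for N \<delta>
    using assms(2) by (cases "N = 0") auto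
  ultimately show ?thesis by (simp only:)
qed

text \<open>
  A Riemann sum whose points carry the weights \<open>\<phi>(q) / q\<close>. On a short interval the function \<open>g\<close> is nearly
  constant and the weights may be replaced by their mean.
\<close>

lemma totient_riemann_sum:
  assumes g: "continuous_on {0..x} g" and x: "0 \<le> x"
  shows "((\<lambda>\<delta>. \<Sum>q\<in>{1..nat \<lfloor>x / \<delta>\<rfloor>}. \<delta> * (real (totient q) / real q) * g (\<delta> * real q))
    \<longlongrightarrow> 6 / pi\<^sup>2 * integral {0..x} g) (at_right 0)"
proof -
  define c where "c = 6 / pi\<^sup>2"
  have c: "c > 0" by (simp add: c_def)
  define b where "b q = real (totient q) / real q" for q
  define G where "G \<delta> y = (\<Sum>q\<in>{1..nat \<lfloor>y / \<delta>\<rfloor>}. \<delta> * b q * g (\<delta> * real q))" for \<delta> y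
  define S where "S \<delta> y = \<delta> * totient_ratio_sum (nat \<lfloor>y / \<delta>\<rfloor>)" for \<delta> y
  have b: "b q \<ge> 0" for q by (simp add: b_def)
  have S: "((\<lambda>\<delta>. S \<delta> y) \<longlongrightarrow> c * y) (at_right 0)" if "y \<ge> 0" for y
    unfolding S_def c_def by (rule scaled_mean_tendsto[OF totient_ratio_mean _ that]) (simp add: totient_ratio_sum_def)
  have int: "g integrable_on {u..v}" if "0 \<le> u" "v \<le> x" for u v
    by (rule integrable_continuous_interval) (rule continuous_on_subset[OF g], use that in auto)
  have unif: "uniformly_continuous_on {0..x} g"
    by (rule compact_uniformly_continuous[OF g]) simp
  have "((\<lambda>\<delta>. G \<delta> x - G \<delta> 0) \<longlongrightarrow> c * integral {0..x} g - c * integral {0..0} g) (at_right 0)"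
  proof (rule local_to_global[OF x])
    fix \<eta> :: real assume \<eta>: "\<eta> > 0"
    define e where "e = \<eta> / (3 * c)"
    have e: "e > 0" using \<eta> c by (simp add: e_def)
    obtain d where d: "d > 0" "\<And>u v. u \<in> {0..x} \<Longrightarrow> v \<in> {0..x} \<Longrightarrow> \<bar>u - v\<bar> < d \<Longrightarrow> \<bar>g u - g v\<bar> < e"
      using unif e unfolding uniformly_continuous_on_def dist_real_def by metis
    show "\<exists>d>0. \<forall>y\<ge>0. \<forall>y'\<le>x. y < y' \<and> y' - y < d \<longrightarrow>
      (\<forall>\<^sub>F \<delta> in at_right 0. \<bar>(G \<delta> y' - G \<delta> y) - (c * integral {0..y'} g - c * integral {0..y} g)\<bar> \<le> \<eta> * (y' - y))"
    proof (intro exI[of _ d] conjI d(1) allI impI; elim conjE)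
      fix y y' assume y: "0 \<le> y" "y' \<le> x" "y < y'" "y' - y < d"
      have close: "\<bar>g u - g y'\<bar> \<le> e" if "u \<in> {y..y'}" for u
        using d(2)[of u y'] y that by auto
      have I: "\<bar>(c * integral {0..y'} g - c * integral {0..y} g) - c * (g y' * (y' - y))\<bar> \<le> c * (e * (y' - y))"
      proof -
        have "integral {0..y} g + integral {y..y'} g = integral {0..y'} g"
          using y by (intro Henstock_Kurzweil_Integration.integral_combine int) auto
        then have "(c * integral {0..y'} g - c * integral {0..y} g) - c * (g y' * (y' - y)) = c * (integral {y..y'} g - g y' * (y' - y))"
          by (simp add: algebra_simps flip: \<open>_ = integral {0..y'} g\<close>)
        moreover have "integral {y..y'} g - g y' * (y' - y) = integral {y..y'} (\<lambda>u. g u - g y')"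
          using y by (subst Henstock_Kurzweil_Integration.integral_diff) (auto intro: int)
        moreover have "\<bar>integral {y..y'} (\<lambda>u. g u - g y')\<bar> \<le> e * (y' - y)"
        proof -
          have "norm (integral {y..y'} (\<lambda>u. g u - g y')) \<le> integral {y..y'} (\<lambda>u. e)"
            using y by (intro integral_norm_bound_integral Henstock_Kurzweil_Integration.integrable_diff int) (auto simp: close)
          then show ?thesis using y by (simp add: mult.commute)
        qed
        ultimately show ?thesis using c by (simp add: abs_mult)
      qed
      have main: "\<bar>(G \<delta> y' - G \<delta> y) - (c * integral {0..y'} g - c * integral {0..y} g)\<bar>
        \<le> (e + c * e) * 0 + e * (S \<delta> y' - S \<delta> y) + \<bar>g y'\<bar> * \<bar>(S \<delta> y' - S \<delta> y) - c * (y' - y)\<bar> + c * (e * (y' - y))"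
        if \<delta>: "\<delta> > 0" for \<delta>
      proof -
        define n n' where "n = nat \<lfloor>y / \<delta>\<rfloor>" and "n' = nat \<lfloor>y' / \<delta>\<rfloor>"
        have "n \<le> n'" unfolding n_def n'_def using y \<delta>
          by (intro nat_mono floor_mono divide_right_mono) auto
        then have un: "{1..n'} = {1..n} \<union> {n<..n'}" by auto
        have G: "G \<delta> y' - G \<delta> y = (\<Sum>q\<in>{n<..n'}. \<delta> * b q * g (\<delta> * real q))"
          unfolding G_def n_def[symmetric] n'_def[symmetric] un by (subst sum.union_disjoint) auto
        have SS: "S \<delta> y' - S \<delta> y = (\<Sum>q\<in>{n<..n'}. \<delta> * b q)"
          unfolding S_def totient_ratio_sum_def b_def[symmetric] n_def[symmetric] n'_def[symmetric] un
          by (subst sum.union_disjoint) (auto simp: distrib_left sum_distrib_left)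
        have "\<bar>(G \<delta> y' - G \<delta> y) - g y' * (S \<delta> y' - S \<delta> y)\<bar> = \<bar>\<Sum>q\<in>{n<..n'}. \<delta> * b q * (g (\<delta> * real q) - g y')\<bar>"
          unfolding G SS by (simp add: sum_distrib_left sum_subtractf algebra_simps)
        also have "\<dots> \<le> (\<Sum>q\<in>{n<..n'}. \<delta> * b q * e)"
        proof (intro order.trans[OF sum_abs] sum_mono)
          fix q assume q: "q \<in> {n<..n'}"
          then have "nat \<lfloor>y / \<delta>\<rfloor> < q" by (simp add: n_def)
          then have "y / \<delta> < real q" by linarith
          moreover have "real q \<le> y' / \<delta>"
            using q y \<delta> unfolding n'_def by (simp add: le_nat_iff le_floor_iff)
          ultimately have "\<delta> * real q \<in> {y..y'}" using \<delta> by (simp add: field_simps)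
          then show "\<bar>\<delta> * b q * (g (\<delta> * real q) - g y')\<bar> \<le> \<delta> * b q * e"
            using \<delta> b[of q] unfolding abs_mult by (intro mult_mono close) auto
        qed
        also have "\<dots> = e * (S \<delta> y' - S \<delta> y)"
          unfolding SS by (simp add: sum_distrib_left mult_ac)
        finally have 1: "\<bar>(G \<delta> y' - G \<delta> y) - g y' * (S \<delta> y' - S \<delta> y)\<bar> \<le> e * (S \<delta> y' - S \<delta> y)" .
        have "(G \<delta> y' - G \<delta> y) - (c * integral {0..y'} g - c * integral {0..y} g)
          = ((G \<delta> y' - G \<delta> y) - g y' * (S \<delta> y' - S \<delta> y)) + g y' * ((S \<delta> y' - S \<delta> y) - c * (y' - y))
            - ((c * integral {0..y'} g - c * integral {0..y} g) - c * (g y' * (y' - y)))"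
          by (simp add: algebra_simps)
        moreover have "\<bar>g y' * ((S \<delta> y' - S \<delta> y) - c * (y' - y))\<bar> = \<bar>g y'\<bar> * \<bar>(S \<delta> y' - S \<delta> y) - c * (y' - y)\<bar>"
          by (rule abs_mult)
        ultimately show ?thesis using 1 I by linarith
      qed
      have "((\<lambda>\<delta>. (e + c * e) * 0 + e * (S \<delta> y' - S \<delta> y) + \<bar>g y'\<bar> * \<bar>(S \<delta> y' - S \<delta> y) - c * (y' - y)\<bar> + c * (e * (y' - y)))
        \<longlongrightarrow> (e + c * e) * 0 + e * (c * y' - c * y) + \<bar>g y'\<bar> * \<bar>(c * y' - c * y) - c * (y' - y)\<bar> + c * (e * (y' - y))) (at_right 0)"
        using y by (intro tendsto_intros S) auto
      moreover have "(e + c * e) * 0 + e * (c * y' - c * y) + \<bar>g y'\<bar> * \<bar>(c * y' - c * y) - c * (y' - y)\<bar> + c * (e * (y' - y)) < \<eta> * (y' - y)"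
      proof -
        have "e * (c * y' - c * y) + c * (e * (y' - y)) = 2/3 * (\<eta> * (y' - y))"
          using c by (simp add: e_def field_simps)
        moreover have "\<eta> * (y' - y) > 0" using \<eta> y by simp
        ultimately show ?thesis by (simp add: algebra_simps)
      qed
      ultimately have "\<forall>\<^sub>F \<delta> in at_right 0. (e + c * e) * 0 + e * (S \<delta> y' - S \<delta> y) + \<bar>g y'\<bar> * \<bar>(S \<delta> y' - S \<delta> y) - c * (y' - y)\<bar> + c * (e * (y' - y)) < \<eta> * (y' - y)"
        by (rule order_tendstoD(2))
      moreover have "\<forall>\<^sub>F \<delta>::real in at_right 0. \<delta> > 0" by (rule eventually_at_right_less)
      ultimately show "\<forall>\<^sub>F \<delta> in at_right 0. \<bar>(G \<delta> y' - G \<delta> y) - (c * integral {0..y'} g - c * integral {0..y} g)\<bar> \<le> \<eta> * (y' - y)"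
        by eventually_elim (use main in fastforce)
    qed
  qed
  then show ?thesis by (simp add: G_def b_def c_def)
qed

section \<open>Points whose least good denominator is q\<close>

definition first_approx_at :: "real \<Rightarrow> nat \<Rightarrow> int \<Rightarrow> real set" where
  "first_approx_at \<delta> q a = {t. \<bar>real q * t - of_int a\<bar> \<le> \<delta> \<and>
     (\<forall>q'\<in>{1..<q}. \<forall>b::int. \<delta> < \<bar>real q' * t - of_int b\<bar>)}"

text \<open>
  For \<open>x > 0\<close> this is \<open>min \<delta> ((1 - \<delta> q) / x)\<close>. In the present form it is continuous and decreasing on all
  of \<open>[0, \<infinity>)\<close>, with value \<open>\<delta>\<close> at \<open>0\<close>.
\<close>

definition gap_weight :: "real \<Rightarrow> nat \<Rightarrow> real \<Rightarrow> real" where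
  "gap_weight \<delta> q x = (1 - \<delta> * real q) / max x ((1 - \<delta> * real q) / \<delta>)"

lemma gap_weight_eq_min:
  assumes "\<delta> > 0" "\<delta> * real q < 1" "x > 0"
  shows "gap_weight \<delta> q x = min \<delta> ((1 - \<delta> * real q) / x)"
  using assms by (auto simp: gap_weight_def max_def min_def field_simps)

lemma gap_weight_antimono:
  assumes "\<delta> > 0" "\<delta> * real q < 1" "0 \<le> x" "x \<le> y"
  shows "gap_weight \<delta> q y \<le> gap_weight \<delta> q x"
proof -
  have "(1 - \<delta> * real q) / \<delta> > 0" using assms by simp
  then show ?thesis
    unfolding gap_weight_def using assms
    by (intro divide_left_mono mult_pos_pos) (auto simp: less_max_iff_disj)
qed

lemma gap_weight_bounds:
  assumes "\<delta> > 0" "\<delta> * real q < 1" "0 \<le> x"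
  shows "0 \<le> gap_weight \<delta> q x" "gap_weight \<delta> q x \<le> \<delta>"
proof -
  have pos: "(1 - \<delta> * real q) / \<delta> > 0" using assms by simp
  then show "0 \<le> gap_weight \<delta> q x" unfolding gap_weight_def using assms by auto
  have "gap_weight \<delta> q x \<le> gap_weight \<delta> q 0" using gap_weight_antimono[of \<delta> q 0 x] assms by simp
  also have "\<dots> = \<delta>" using pos assms by (simp add: gap_weight_def)
  finally show "gap_weight \<delta> q x \<le> \<delta>" .
qed

text \<open>
  If \<open>g = gcd a q > 1\<close>, then the denominator \<open>q / g\<close> does even better.
\<close>

lemma first_approx_at_not_coprime:
  assumes "q > 0" "\<delta> > 0" "\<not> coprime a (int q)"
  shows "first_approx_at \<delta> q a = {}"
proof -
  define g where "g = gcd a (int q)"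
  have "g > 0" "g \<noteq> 1" using assms by (auto simp: g_def coprime_iff_gcd_eq_1)
  then have g: "g \<ge> 2" by linarith
  obtain a' q' where a': "a = g * a'" and q': "int q = g * q'"
    using gcd_dvd1[of a "int q"] gcd_dvd2[of a "int q"] unfolding g_def[symmetric] by (auto elim!: dvdE)
  have "q' > 0" using q' g assms by (metis of_nat_0_less_iff zero_less_mult_pos order_less_le_trans zero_less_numeral)
  moreover have "q' < int q" using q' g \<open>q' > 0\<close> by (simp add: less_le) 
  ultimately have nq': "nat q' \<in> {1..<q}" by auto
  have "t \<notin> first_approx_at \<delta> q a" for t
  proof
    assume t: "t \<in> first_approx_at \<delta> q a"
    have "real q = of_int g * of_int q'" using q' by (metis of_int_mult of_int_of_nat_eq)
    then have "real q * t - of_int a = of_int g * (real (nat q') * t - of_int a')"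
      using \<open>q' > 0\<close> by (simp add: a' algebra_simps)
    then have "of_int g * \<bar>real (nat q') * t - of_int a'\<bar> \<le> \<delta>"
      using t g by (simp add: first_approx_at_def abs_mult)
    moreover have "1 * \<bar>real (nat q') * t - of_int a'\<bar> \<le> of_int g * \<bar>real (nat q') * t - of_int a'\<bar>"
      using g by (intro mult_right_mono) auto
    ultimately have "\<bar>real (nat q') * t - of_int a'\<bar> \<le> \<delta>"
      by (metis mult_1 order.trans)
    moreover have "\<delta> < \<bar>real (nat q') * t - of_int a'\<bar>"
      using t nq' unfolding first_approx_at_def by blast
    ultimately show False by linarith
  qed
  then show ?thesis by blast
qed

lemma inverse_pairs_pos:
  assumes "q \<ge> 2" "(a, x) \<in> inverse_pairs q"
  shows "1 \<le> x" "x < int q" "1 \<le> a" "a < int q"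
proof -
  have "x \<noteq> 0" "a \<noteq> 0" using assms by (auto simp: inverse_pairs_def cong_def)
  then show "1 \<le> x" "x < int q" "1 \<le> a" "a < int q" using assms(2) by (auto simp: inverse_pairs_def)
qed

text \<open>
  For \<open>t = (a + s) / q\<close> and a denominator \<open>q' < q\<close> put \<open>r = q' a - b q\<close>; then
  \<open>q (q' t - b) = r + q' s\<close> with \<open>\<bar>q' s\<bar> < u = \<delta> q < 1\<close>. As \<open>a\<close> is coprime to \<open>q\<close>, \<open>r \<noteq> 0\<close>, and \<open>\<bar>r\<bar> \<ge> 2\<close>
  is harmless. So only \<open>r = 1\<close>, that is \<open>q' = x\<close>, and \<open>r = -1\<close>, that is \<open>q' = q - x\<close>, can matter, the former for
  negative and the latter for positive \<open>s\<close>.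
\<close>

lemma first_approx_at_contains:
  assumes \<delta>: "\<delta> > 0" "\<delta> * real q < 1" and q: "q \<ge> 2" and ax: "(a, x) \<in> inverse_pairs q"
    and t1: "- gap_weight \<delta> q x < real q * t - a" and t2: "real q * t - a < gap_weight \<delta> q (real q - x)"
  shows "t \<in> first_approx_at \<delta> q a"
proof -
  define u where "u = \<delta> * real q"
  define s where "s = real q * t - a"
  have u: "u < 1" "u > 0" using \<delta> q by (auto simp: u_def)
  note x = inverse_pairs_pos[OF q ax]
  have x': "real_of_int x > 0" "real q - x > 0" using x by linarith+
  have s: "- s < \<delta>" "- s < (1 - u) / x" "s < \<delta>" "s < (1 - u) / (real q - x)"
    using t1 t2 gap_weight_eq_min[OF \<delta> x'(1)] gap_weight_eq_min[OF \<delta> x'(2)] by (auto simp: s_def u_def)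
  have "\<delta> < \<bar>real q' * t - of_int b\<bar>" if q': "q' \<in> {1..<q}" for q' b
  proof -
    define r where "r = int q' * a - b * int q"
    have key: "real q * (real q' * t - of_int b) = of_int r + real q' * s"
      by (simp add: r_def s_def algebra_simps)
    have cop: "coprime a (int q)"
      using ax fst_image_inverse_pairs[of q] q by force
    have "r \<noteq> 0"
    proof
      assume "r = 0"
      then have "int q dvd a * int q'" by (simp add: r_def mult.commute)
      then have "int q dvd int q'" using cop by (simp add: coprime_commute coprime_dvd_mult_right_iff)
      then show False using q' zdvd_imp_le[of "int q" "int q'"] by simp
    qed
    have qs: "\<bar>real q' * s\<bar> < u"
    proof -
      have "real q' * \<bar>s\<bar> \<le> real q * \<bar>s\<bar>" using q' by (intro mult_right_mono) auto
      also have "\<dots> < real q * \<delta>" using s q by (intro mult_strict_left_mono) auto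
      finally show ?thesis by (simp add: abs_mult u_def mult.commute)
    qed
    have "u < \<bar>of_int r + real q' * s\<bar>"
    proof -
      consider "r \<ge> 2" | "r \<le> -2" | "r = 1" | "r = -1" using \<open>r \<noteq> 0\<close> by linarith
      then show ?thesis
      proof cases
        case 1
        then have "real_of_int r \<ge> 2" by simp
        then show ?thesis using qs u by linarith
      next
        case 2
        then have "real_of_int r \<le> -2" by linarith
        then show ?thesis using qs u by linarith
      next
        case 3
        then have "a * int q' = 1 + int q * b" by (simp add: r_def algebra_simps)
        then have "(a, int q') \<in> inverse_pairs q"
          using q' ax by (auto simp: inverse_pairs_def cong_def)
        then have "int q' = x" using ax by (metis inverse_pairs_unique)
        then have "real q' = of_int x" by (metis of_int_of_nat_eq)
        then have "real q' * (- s) < 1 - u" using s(2) x' by (simp add: field_simps)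
        then show ?thesis using 3 qs u by simp
      next
        case 4
        then have "a * (int q - int q') = 1 + int q * (a - b)" by (simp add: r_def algebra_simps)
        then have "(a, int q - int q') \<in> inverse_pairs q"
          using q' ax by (auto simp: inverse_pairs_def cong_def)
        then have "int q - int q' = x" using ax by (metis inverse_pairs_unique)
        then have "real q' = real q - of_int x" by (metis add_diff_cancel_left' diff_add_cancel of_int_diff of_int_of_nat_eq)
        then have "real q' * s < 1 - u"
          using s(4) unfolding pos_less_divide_eq[OF x'(2)] by (simp add: mult.commute)
        then show ?thesis using 4 qs u by simp
      qed
    qed
    then have "real q * \<delta> < \<bar>real q * (real q' * t - of_int b)\<bar>"
      unfolding key u_def by (simp only: mult.commute)
    also have "\<dots> = real q * \<bar>real q' * t - of_int b\<bar>" by (simp add: abs_mult)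
    finally have "real q * \<delta> < real q * \<bar>real q' * t - of_int b\<bar>" .
    then show ?thesis using q by (simp add: mult_less_cancel_left)
  qed
  moreover have "\<bar>real q * t - of_int a\<bar> \<le> \<delta>" using s by (simp add: s_def)
  ultimately show ?thesis by (simp add: first_approx_at_def)
qed

text \<open>
  Beyond the two ends, the denominator \<open>x\<close> on the left and \<open>q - x\<close> on the right is already good enough.
\<close>

lemma first_approx_at_bounded:
  assumes \<delta>: "\<delta> > 0" "\<delta> * real q < 1" and q: "q \<ge> 2" and ax: "(a, x) \<in> inverse_pairs q"
    and t: "t \<in> first_approx_at \<delta> q a"
  shows "- gap_weight \<delta> q x \<le> real q * t - a" "real q * t - a \<le> gap_weight \<delta> q (real q - x)"
proof -
  define u where "u = \<delta> * real q"
  define s where "s = real q * t - a"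
  have u: "u < 1" "u > 0" using \<delta> q by (auto simp: u_def)
  note x = inverse_pairs_pos[OF q ax]
  have x': "real_of_int x > 0" "real q - x > 0" using x by linarith+
  have s: "\<bar>s\<bar> \<le> \<delta>" using t by (simp add: first_approx_at_def s_def)
  obtain k where k: "a * x = 1 + int q * k"
    using ax by (auto simp: inverse_pairs_def) (metis cong_iff_lin cong_sym)
  have new: "u < \<bar>of_int (int q' * a - b * int q) + real q' * s\<bar>" if "q' \<in> {1..<q}" for q' b
  proof -
    have "real q * \<delta> < real q * \<bar>real q' * t - of_int b\<bar>"
      using t that q by (intro mult_strict_left_mono) (auto simp: first_approx_at_def)
    also have "\<dots> = \<bar>real q * (real q' * t - of_int b)\<bar>" by (simp add: abs_mult)
    also have "real q * (real q' * t - of_int b) = of_int (int q' * a - b * int q) + real q' * s"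
      by (simp add: s_def algebra_simps)
    finally show ?thesis by (simp add: u_def mult.commute)
  qed
  have "- s \<le> (1 - u) / x"
  proof (rule ccontr)
    assume "\<not> - s \<le> (1 - u) / x"
    then have 1: "x * (- s) > 1 - u" using x' by (simp add: field_simps)
    have 2: "x * (- s) \<le> u"
    proof -
      have "x * (- s) \<le> x * \<delta>" using s x' by (intro mult_left_mono) auto
      also have "x * \<delta> \<le> real q * \<delta>" using x' \<delta> by (intro mult_right_mono) auto
      finally have "x * (- s) \<le> real q * \<delta>" .
      then show ?thesis by (simp add: u_def mult.commute)
    qed
    have "real (nat x) = x" using x by simp
    moreover have "int (nat x) * a - k * int q = 1" using k x by (simp add: algebra_simps)
    moreover have "nat x \<in> {1..<q}" using x by (simp add: nat_less_iff)
    ultimately have "u < \<bar>1 + x * s\<bar>" using new[of "nat x" k] by simp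
    then show False using 1 2 u by simp
  qed
  moreover have "s \<le> (1 - u) / (real q - x)"
  proof (rule ccontr)
    assume "\<not> s \<le> (1 - u) / (real q - x)"
    then have 1: "(real q - x) * s > 1 - u" using x' by (simp add: field_simps)
    have 2: "(real q - x) * s \<le> u"
    proof -
      have "(real q - x) * s \<le> (real q - x) * \<delta>" using s x' by (intro mult_left_mono) auto
      also have "(real q - x) * \<delta> \<le> real q * \<delta>" using x' \<delta> by (intro mult_right_mono) auto
      finally have "(real q - x) * s \<le> real q * \<delta>" .
      then show ?thesis by (simp add: u_def mult.commute)
    qed
    have "real (nat (int q - x)) = real q - x" using x by simp
    moreover have "int (nat (int q - x)) * a - (a - k) * int q = - 1" using k x by (simp add: algebra_simps)
    moreover have "nat (int q - x) \<in> {1..<q}" using x by (simp add: nat_less_iff)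
    ultimately have "u < \<bar>- 1 + (real q - x) * s\<bar>" using new[of "nat (int q - x)" "a - k"] by simp
    then show False using 1 2 u by simp
  qed
  ultimately show "- gap_weight \<delta> q x \<le> real q * t - a" "real q * t - a \<le> gap_weight \<delta> q (real q - x)"
    using s gap_weight_eq_min[OF \<delta> x'(1)] gap_weight_eq_min[OF \<delta> x'(2)] by (auto simp: s_def u_def)
qed

lemma first_approx_at_borel [measurable]: "first_approx_at \<delta> q a \<in> sets borel"
proof -
  have "first_approx_at \<delta> q a = {t. \<bar>real q * t - of_int a\<bar> \<le> \<delta>} \<inter>
      (\<Inter>q'\<in>{1..<q}. \<Inter>b. {t. \<delta> < \<bar>real q' * t - of_int b\<bar>}) "
    by (auto simp: first_approx_at_def)
  moreover have "{t. \<bar>real q * t - of_int a\<bar> \<le> \<delta>} \<in> sets borel"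
    by (intro borel_closed closed_Collect_le continuous_intros)
  moreover have "{t. \<delta> < \<bar>real q' * t - of_int b\<bar>} \<in> sets borel" for q' and b :: int
    by (intro borel_open open_Collect_less continuous_intros)
  then have "(\<Inter>b::int. {t. \<delta> < \<bar>real q' * t - of_int b\<bar>}) \<in> sets borel" for q'
    by (intro sets.countable_INT') auto
  then have "(\<Inter>q'\<in>{1..<q}. \<Inter>b::int. {t. \<delta> < \<bar>real q' * t - of_int b\<bar>}) \<in> sets borel"
    by (cases "{1..<q} = {}") (auto intro!: sets.countable_INT'' sets.finite_INT)
  ultimately show ?thesis by auto
qed

lemma measure_first_approx_at:
  assumes \<delta>: "\<delta> > 0" "\<delta> * real q < 1" and q: "q \<ge> 2" and ax: "(a, x) \<in> inverse_pairs q"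
  shows "measure lborel (first_approx_at \<delta> q a) = (gap_weight \<delta> q x + gap_weight \<delta> q (real q - x)) / real q"
proof (rule antisym)
  let ?l = "(a - gap_weight \<delta> q x) / real q" and ?r = "(a + gap_weight \<delta> q (real q - x)) / real q"
  note x = inverse_pairs_pos[OF q ax]
  have x': "real_of_int x > 0" "real q - x > 0" using x by linarith+
  have lr: "?l \<le> ?r" using gap_weight_bounds(1)[OF \<delta>, of x] gap_weight_bounds(1)[OF \<delta>, of "real q - x"] x' q
    by (intro divide_right_mono) auto
  have sub: "first_approx_at \<delta> q a \<subseteq> {?l..?r}"
  proof
    fix t assume "t \<in> first_approx_at \<delta> q a"
    from first_approx_at_bounded[OF \<delta> q ax this] show "t \<in> {?l..?r}"
      using q by (simp add: divide_le_eq le_divide_eq algebra_simps)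
  qed
  have sup: "{?l<..<?r} \<subseteq> first_approx_at \<delta> q a"
  proof
    fix t assume "t \<in> {?l<..<?r}"
    then show "t \<in> first_approx_at \<delta> q a"
      using q by (intro first_approx_at_contains[OF \<delta> q ax]) (auto simp: divide_less_eq less_divide_eq algebra_simps)
  qed
  have fm: "first_approx_at \<delta> q a \<in> fmeasurable lborel"
    by (rule fmeasurableI2[OF _ sub]) (auto simp: fmeasurable_def emeasure_lborel_Icc_eq)
  have len: "?r - ?l = (gap_weight \<delta> q x + gap_weight \<delta> q (real q - x)) / real q"
    by (simp add: diff_divide_distrib[symmetric])
  show "measure lborel (first_approx_at \<delta> q a) \<le> (gap_weight \<delta> q x + gap_weight \<delta> q (real q - x)) / real q"
    using measure_mono_fmeasurable[OF sub, of lborel] lr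
    by (auto simp: fmeasurable_def emeasure_lborel_Icc_eq len)
  show "(gap_weight \<delta> q x + gap_weight \<delta> q (real q - x)) / real q \<le> measure lborel (first_approx_at \<delta> q a)"
    using measure_mono_fmeasurable[OF sup _ fm] lr by (auto simp: len)
qed

lemma weighted_sum_antimono_bound:
  fixes c w :: "nat \<Rightarrow> real"
  assumes C: "\<And>k. k \<le> n \<Longrightarrow> \<bar>\<Sum>i<k. c i\<bar> \<le> M"
    and w: "\<And>i j. i \<le> j \<Longrightarrow> j < n \<Longrightarrow> w j \<le> w i" "\<And>i. i < n \<Longrightarrow> 0 \<le> w i"
    and n: "n > 0"
  shows "\<bar>\<Sum>i<n. c i * w i\<bar> \<le> M * w 0"
proof -
  have ind: "\<bar>(\<Sum>i<Suc k. c i * w i) - (\<Sum>i<Suc k. c i) * w k\<bar> \<le> M * (w 0 - w k)" if "k < n" for k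
    using that
  proof (induction k)
    case (Suc k)
    have "(\<Sum>i<Suc (Suc k). c i * w i) - (\<Sum>i<Suc (Suc k). c i) * w (Suc k)
      = ((\<Sum>i<Suc k. c i * w i) - (\<Sum>i<Suc k. c i) * w k) + (\<Sum>i<Suc k. c i) * (w k - w (Suc k))"
      by (simp add: algebra_simps)
    moreover have "\<bar>(\<Sum>i<Suc k. c i) * (w k - w (Suc k))\<bar> \<le> M * (w k - w (Suc k))"
      unfolding abs_mult using C[of "Suc k"] w(1)[of k "Suc k"] Suc.prems
      by (intro mult_mono) auto
    moreover have "M * (w 0 - w (Suc k)) = M * (w 0 - w k) + M * (w k - w (Suc k))"
      by (simp add: algebra_simps)
    ultimately show ?case using Suc by linarith
  qed simp
  obtain m where m: "n = Suc m" using n by (cases n) auto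
  have "\<bar>(\<Sum>i<n. c i) * w m\<bar> \<le> M * w m"
    unfolding abs_mult using C[of n] w(2)[of m] m by (intro mult_mono) auto
  moreover have "M * (w 0 - w m) + M * w m = M * w 0" by (simp add: algebra_simps)
  ultimately show ?thesis using ind[of m] m by fastforce
qed

text \<open>
  Summation by parts: counts that are uniform on initial segments are uniform against every decreasing weight.
\<close>

lemma weighted_count_bound:
  fixes w :: "nat \<Rightarrow> real"
  assumes P: "finite P" "\<And>p. p \<in> P \<Longrightarrow> f p < n"
    and count: "\<And>k. k \<le> n \<Longrightarrow> \<bar>real (card {p \<in> P. f p < k}) - \<rho> * real k\<bar> \<le> M"
    and w: "\<And>i j. i \<le> j \<Longrightarrow> j < n \<Longrightarrow> w j \<le> w i" "\<And>i. i < n \<Longrightarrow> 0 \<le> w i"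
    and n: "n > 0"
  shows "\<bar>(\<Sum>p\<in>P. w (f p)) - \<rho> * (\<Sum>i<n. w i)\<bar> \<le> M * w 0"
proof -
  define m where "m i = real (card {p \<in> P. f p = i})" for i
  have "(\<Sum>p\<in>P. w (f p)) = (\<Sum>i<n. \<Sum>p\<in>{p \<in> P. f p = i}. w (f p))"
    using P by (intro sum.group[symmetric]) auto
  also have "\<dots> = (\<Sum>i<n. m i * w i)"
    by (intro sum.cong refl) (simp add: m_def)
  finally have "(\<Sum>p\<in>P. w (f p)) - \<rho> * (\<Sum>i<n. w i) = (\<Sum>i<n. (m i - \<rho>) * w i)"
    by (simp add: sum_distrib_left sum_subtractf algebra_simps)
  moreover have "\<bar>\<Sum>i<n. (m i - \<rho>) * w i\<bar> \<le> M * w 0"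
  proof (rule weighted_sum_antimono_bound[OF _ w n])
    fix k assume k: "k \<le> n"
    have "card {p \<in> P. f p < k} = (\<Sum>p\<in>{p \<in> P. f p < k}. 1)" by simp
    also have "\<dots> = (\<Sum>i<k. \<Sum>p\<in>{p \<in> {p \<in> P. f p < k}. f p = i}. 1)"
      using P by (intro sum.group[symmetric]) auto
    also have "\<dots> = (\<Sum>i<k. card {p \<in> P. f p = i})"
      by (intro sum.cong refl) (auto intro!: arg_cong[where f=card])
    finally have "real (card {p \<in> P. f p < k}) = (\<Sum>i<k. m i)" by (simp add: m_def)
    then show "\<bar>\<Sum>i<k. m i - \<rho>\<bar> \<le> M" using count[OF k] by (simp add: sum_subtractf mult.commute)
  qed auto
  ultimately show ?thesis by simp
qed

text \<open>
  The mean value of \<open>min 1 ((1 - u) / (u v))\<close> over \<open>v\<close> in \<open>[0, 1]\<close> (see \<open>integral_gap_weight\<close>). Up to the factor \<open>12 / \<pi>\<^sup>2\<close> it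
  is the density of the limit law.
\<close>

definition gap_profile :: "real \<Rightarrow> real" where
  "gap_profile u = (if u \<le> 1/2 then 1 else (1 - u) / u * (1 + ln (u / (1 - u))))"

lemma sum_le_integral_antimono:
  fixes f :: "real \<Rightarrow> real"
  assumes cont: "continuous_on {0..} f" and anti: "\<And>x y. 0 \<le> x \<Longrightarrow> x \<le> y \<Longrightarrow> f y \<le> f x"
  shows "(\<Sum>i<n. f (real i + 1)) \<le> integral {0..real n} f" "integral {0..real n} f \<le> (\<Sum>i<n. f (real i))"
proof -
  have int: "f integrable_on {a..b}" if "0 \<le> a" for a b
    using that by (intro integrable_continuous_interval continuous_on_subset[OF cont]) auto
  have step: "integral {0..real (Suc n)} f = integral {0..real n} f + integral {real n..real n + 1} f" for n
    using Henstock_Kurzweil_Integration.integral_combine[of 0 "real n" "real n + 1" f] int by (simp add: add.commute)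
  have lo: "f (real n + 1) \<le> integral {real n..real n + 1} f" for n
    using integral_le[of "\<lambda>_. f (real n + 1)" "{real n..real n + 1}" f] int anti by (simp add: integrable_const_ivl)
  have hi: "integral {real n..real n + 1} f \<le> f (real n)" for n
    using integral_le[of f "{real n..real n + 1}" "\<lambda>_. f (real n)"] int anti
    by (simp add: integrable_const_ivl)
  show "(\<Sum>i<n. f (real i + 1)) \<le> integral {0..real n} f"
    by (induction n) (use step lo in \<open>auto intro: add_mono\<close>)
  show "integral {0..real n} f \<le> (\<Sum>i<n. f (real i))"
    by (induction n) (use step hi in \<open>auto intro: add_mono\<close>)
qed

lemma gap_weight_continuous:
  assumes "\<delta> > 0" "\<delta> * real q < 1"
  shows "continuous_on {0..} (gap_weight \<delta> q)"
proof -
  have "(1 - \<delta> * real q) / \<delta> > 0" using assms by simp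
  then show ?thesis
    unfolding gap_weight_def[abs_def] by (intro continuous_intros) (auto simp: max_def)
qed

text \<open>
  The weight is constant up to \<open>k = (1 - u) / \<delta>\<close> and decays like \<open>(1 - u) / x\<close> afterwards; \<open>k\<close> exceeds \<open>q\<close> exactly
  if \<open>u \<le> 1/2\<close>.
\<close>

lemma integral_gap_weight:
  assumes \<delta>: "\<delta> > 0" "\<delta> * real q < 1" and q: "q > 0"
  shows "integral {0..real q} (gap_weight \<delta> q) = real q * \<delta> * gap_profile (\<delta> * real q)"
proof -
  define u where "u = \<delta> * real q"
  define k where "k = (1 - u) / \<delta>"
  have u: "0 < u" "u < 1" using assms by (auto simp: u_def)
  have k: "k > 0" using u \<delta> by (simp add: k_def)
  have \<delta>k: "(1 - u) / k = \<delta>" using u \<delta> by (simp add: k_def)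
  have w: "gap_weight \<delta> q = (\<lambda>x. (1 - u) / max x k)"
    by (simp add: gap_weight_def[abs_def] u_def k_def)
  have qk: "real q \<le> k \<longleftrightarrow> u \<le> 1/2" using \<delta> by (auto simp: k_def u_def field_simps)
  have int: "gap_weight \<delta> q integrable_on {a..b}" if "0 \<le> a" for a b
    using that by (intro integrable_continuous_interval continuous_on_subset[OF gap_weight_continuous[OF \<delta>]]) auto
  show ?thesis
  proof (cases "u \<le> 1/2")
    case True
    then have "real q \<le> k" using qk by simp
    then have "integral {0..real q} (gap_weight \<delta> q) = integral {0..real q} (\<lambda>_. \<delta>)"
      unfolding w by (intro integral_cong) (auto simp: max_def \<delta>k)
    then show ?thesis using True q by (simp add: gap_profile_def u_def)
  next
    case False
    then have kq: "k < real q" using qk by simp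
    have "integral {0..real q} (gap_weight \<delta> q) = integral {0..k} (gap_weight \<delta> q) + integral {k..real q} (gap_weight \<delta> q)"
      using k kq int by (intro Henstock_Kurzweil_Integration.integral_combine[symmetric]) auto
    also have "integral {0..k} (gap_weight \<delta> q) = integral {0..k} (\<lambda>_. \<delta>)"
      unfolding w by (intro integral_cong) (auto simp: max_def \<delta>k)
    also have "\<dots> = 1 - u" using k \<delta> by (simp add: k_def)
    also have "integral {k..real q} (gap_weight \<delta> q) = integral {k..real q} (\<lambda>x. (1 - u) / x)"
      unfolding w by (intro integral_cong) (auto simp: max_def)
    also have "\<dots> = (1 - u) * ln (real q) - (1 - u) * ln k"
      using k kq by (intro integral_unique fundamental_theorem_of_calculus)
        (auto intro!: derivative_eq_intros simp flip: has_real_derivative_iff_has_vector_derivative)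
    also have "\<dots> = (1 - u) * ln (u / (1 - u))"
    proof -
      have "real q / k = u / (1 - u)" using \<delta> u by (simp add: k_def u_def)
      then have "ln (u / (1 - u)) = ln (real q / k)" by simp
      also have "\<dots> = ln (real q) - ln k" using k kq by (intro ln_divide_pos) auto
      finally show ?thesis by (simp add: right_diff_distrib)
    qed
    finally have "integral {0..real q} (gap_weight \<delta> q) = (1 - u) * (1 + ln (u / (1 - u)))"
      by (simp add: algebra_simps)
    then show ?thesis using False u q \<delta> by (simp add: gap_profile_def u_def mult.commute)
  qed
qed

lemma gap_profile_bounds:
  assumes "\<delta> > 0" "\<delta> * real q < 1" "q > 0"
  shows "0 \<le> gap_profile (\<delta> * real q)" "gap_profile (\<delta> * real q) \<le> 1"
proof -
  have int: "gap_weight \<delta> q integrable_on {0..real q}"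
    by (intro integrable_continuous_interval continuous_on_subset[OF gap_weight_continuous]) (use assms in auto)
  have "0 \<le> integral {0..real q} (gap_weight \<delta> q)"
    using gap_weight_bounds(1) assms by (intro Henstock_Kurzweil_Integration.integral_nonneg int) auto
  moreover have "integral {0..real q} (gap_weight \<delta> q) \<le> integral {0..real q} (\<lambda>_. \<delta>)"
    using gap_weight_bounds(2) assms by (intro integral_le int integrable_const_ivl) auto
  moreover have "0 < real q * \<delta>" using assms by simp
  ultimately show "0 \<le> gap_profile (\<delta> * real q)" "gap_profile (\<delta> * real q) \<le> 1"
    using assms by (auto simp: integral_gap_weight zero_le_mult_iff)
qed

lemma sum_measure_first_approx_at_eq:
  assumes \<delta>: "\<delta> > 0" "\<delta> * real q < 1" and q: "q \<ge> 2" and A: "A \<subseteq> {0..<int q}"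
  shows "(\<Sum>a\<in>A. measure lborel (first_approx_at \<delta> q a))
    = (\<Sum>p\<in>{p \<in> inverse_pairs q. fst p \<in> A}. gap_weight \<delta> q (real_of_int (snd p)) + gap_weight \<delta> q (real q - real_of_int (snd p))) / real q"
proof -
  let ?P = "{p \<in> inverse_pairs q. fst p \<in> A}"
  have fin: "finite A" using A by (rule finite_subset) simp
  have img: "fst ` ?P = {a \<in> A. coprime a (int q)}"
  proof -
    have "fst ` ?P = {a \<in> fst ` inverse_pairs q. a \<in> A}" by auto
    also have "\<dots> = {a \<in> A. coprime a (int q)}"
      using fst_image_inverse_pairs[of q] q A by auto
    finally show ?thesis .
  qed
  have "(\<Sum>a\<in>A. measure lborel (first_approx_at \<delta> q a)) = (\<Sum>a\<in>fst ` ?P. measure lborel (first_approx_at \<delta> q a))"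
    unfolding img using fin q \<delta>(1) first_approx_at_not_coprime by (intro sum.mono_neutral_right) auto
  also have "\<dots> = (\<Sum>p\<in>?P. measure lborel (first_approx_at \<delta> q (fst p)))"
    by (rule sum.reindex[unfolded comp_def]) (rule inj_on_subset[OF inj_on_fst_inverse_pairs], auto)
  also have "\<dots> = (\<Sum>p\<in>?P. (gap_weight \<delta> q (real_of_int (snd p)) + gap_weight \<delta> q (real q - real_of_int (snd p))) / real q)"
    by (intro sum.cong refl measure_first_approx_at[OF \<delta> q]) auto
  finally show ?thesis by (simp only: sum_divide_distrib)
qed

text \<open>
  The weight at \<open>x\<close> and the weight at \<open>q - x\<close> are both decreasing, the first in \<open>x\<close> and the second in
  \<open>q - 1 - x\<close>. So the equidistribution of inverses applies to each, and either Riemann sum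
  differs from the integral of the weight by at most its value at \<open>0\<close>.
\<close>

lemma sum_measure_first_approx_at:
  assumes \<delta>: "\<delta> > 0" "\<delta> * real q < 1" and q: "q \<ge> 2" and A: "{c..<d} \<subseteq> {0..<int q}"
  shows "\<bar>(\<Sum>a\<in>{c..<d}. measure lborel (first_approx_at \<delta> q a))
     - 2 * (real (card {c..<d}) * real (totient q) / (real q)\<^sup>2) * (\<delta> * gap_profile (\<delta> * real q))\<bar>
     \<le> 2 * \<delta> * min 1 (equidistribution_error q) + 2 * \<delta> / real q"
proof -
  define \<rho> where "\<rho> = real (card {c..<d}) * real (totient q) / (real q)\<^sup>2"
  define M where "M = real q * min 1 (equidistribution_error q)"
  define J where "J = integral {0..real q} (gap_weight \<delta> q)"
  let ?P = "{p \<in> inverse_pairs q. fst p \<in> {c..<d}}" and ?w = "gap_weight \<delta> q"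
  have pos: "q > 0" using q by simp
  have J: "J = real q * \<delta> * gap_profile (\<delta> * real q)"
    unfolding J_def by (rule integral_gap_weight[OF \<delta> pos])
  have range: "0 \<le> snd p" "snd p < int q" if "p \<in> ?P" for p
    using that by (auto simp: inverse_pairs_def)
  have fin: "finite ?P" by simp
  have S1: "\<bar>(\<Sum>p\<in>?P. ?w (real (nat (snd p)))) - \<rho> * (\<Sum>i<q. ?w (real i))\<bar> \<le> M * ?w (real 0)"
  proof (rule weighted_count_bound[where f = "\<lambda>p. nat (snd p)" and w = "\<lambda>i. ?w (real i)", OF fin])
    fix k assume k: "k \<le> q"
    have "{p \<in> ?P. nat (snd p) < k} = {(a, x) \<in> inverse_pairs q. a \<in> {c..<d} \<and> x \<in> {0..<int k}}"
      by (auto simp: inverse_pairs_def nat_less_iff)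
    then show "\<bar>real (card {p \<in> ?P. nat (snd p) < k}) - \<rho> * real k\<bar> \<le> M"
      using inverse_pairs_equidistributed[OF pos A, of 0 "int k"] k
      by (simp add: \<rho>_def M_def mult_ac)
  qed (use range pos \<delta> in \<open>auto simp: nat_less_iff intro: gap_weight_antimono gap_weight_bounds\<close>)
  have S2: "\<bar>(\<Sum>p\<in>?P. ?w (real (q - 1 - nat (snd p)) + 1)) - \<rho> * (\<Sum>i<q. ?w (real i + 1))\<bar> \<le> M * ?w (real 0 + 1)"
  proof (rule weighted_count_bound[where f = "\<lambda>p. q - 1 - nat (snd p)" and w = "\<lambda>i. ?w (real i + 1)", OF fin])
    fix k assume k: "k \<le> q"
    have "{p \<in> ?P. q - 1 - nat (snd p) < k} = {(a, x) \<in> inverse_pairs q. a \<in> {c..<d} \<and> x \<in> {int q - int k..<int q}}"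
      using k by (auto simp: inverse_pairs_def)
    then show "\<bar>real (card {p \<in> ?P. q - 1 - nat (snd p) < k}) - \<rho> * real k\<bar> \<le> M"
      using inverse_pairs_equidistributed[OF pos A, of "int q - int k" "int q"] k
      by (simp add: \<rho>_def M_def mult_ac)
  qed (use range pos \<delta> in \<open>auto intro: gap_weight_antimono gap_weight_bounds\<close>)
  have "?w (real (nat (snd p))) = ?w (real_of_int (snd p))" "?w (real (q - 1 - nat (snd p)) + 1) = ?w (real q - real_of_int (snd p))" if "p \<in> ?P" for p
  proof -
    show "?w (real (nat (snd p))) = ?w (real_of_int (snd p))" using range[OF that] by simp
    have "real (q - 1 - nat (snd p)) + 1 = real q - real_of_int (snd p)" using range[OF that] pos by (simp add: of_nat_diff nat_less_iff le_nat_iff Suc_leI nat_le_iff)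
    then show "?w (real (q - 1 - nat (snd p)) + 1) = ?w (real q - real_of_int (snd p))" by simp
  qed
  then have "(\<Sum>a\<in>{c..<d}. measure lborel (first_approx_at \<delta> q a))
     = ((\<Sum>p\<in>?P. ?w (real (nat (snd p)))) + (\<Sum>p\<in>?P. ?w (real (q - 1 - nat (snd p)) + 1))) / real q"
    unfolding sum_measure_first_approx_at_eq[OF \<delta> q A] by (simp add: sum.distrib)
  then have total: "real q * (\<Sum>a\<in>{c..<d}. measure lborel (first_approx_at \<delta> q a))
     = (\<Sum>p\<in>?P. ?w (real (nat (snd p)))) + (\<Sum>p\<in>?P. ?w (real (q - 1 - nat (snd p)) + 1))"
    using pos by simp
  have cont: "continuous_on {0..} ?w" by (rule gap_weight_continuous[OF \<delta>])
  have J1: "(\<Sum>i<q. ?w (real i + 1)) \<le> J" and J2: "J \<le> (\<Sum>i<q. ?w (real i))"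
    unfolding J_def using sum_le_integral_antimono[OF cont] gap_weight_antimono[OF \<delta>] by auto
  have "(\<Sum>i<q. ?w (real (Suc i)) - ?w (real i)) = ?w (real q) - ?w (real 0)"
    by (rule sum_lessThan_telescope)
  then have tele: "(\<Sum>i<q. ?w (real i)) - (\<Sum>i<q. ?w (real i + 1)) = ?w 0 - ?w (real q)"
    by (simp add: sum_subtractf add.commute)
  have w0: "?w 0 \<le> \<delta>" "?w 1 \<le> \<delta>" "?w (real q) \<ge> 0"
    using gap_weight_bounds[OF \<delta>] by auto
  have \<rho>: "0 \<le> \<rho>" "\<rho> \<le> 1"
  proof -
    have "card {c..<d} \<le> q" using card_mono[OF _ A] by simp
    then have "real (card {c..<d} * totient q) \<le> real (q * q)"
      using totient_le[of q] by (intro of_nat_mono mult_le_mono)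
    then show "0 \<le> \<rho>" "\<rho> \<le> 1" using pos by (auto simp: \<rho>_def divide_le_eq power2_eq_square)
  qed
  have M: "M \<ge> 0" by (simp add: M_def equidistribution_error_nonneg)
  have "\<bar>\<rho> * (\<Sum>i<q. ?w (real i)) - \<rho> * J\<bar> \<le> \<delta>" "\<bar>\<rho> * (\<Sum>i<q. ?w (real i + 1)) - \<rho> * J\<bar> \<le> \<delta>"
  proof -
    have *: "\<bar>\<rho> * s - \<rho> * J\<bar> \<le> \<delta>" if "\<bar>s - J\<bar> \<le> \<delta>" for s
    proof -
      have "\<bar>\<rho> * s - \<rho> * J\<bar> = \<rho> * \<bar>s - J\<bar>" using \<rho> by (simp add: right_diff_distrib[symmetric] abs_mult)
      also have "\<dots> \<le> 1 * \<delta>" using \<rho> that by (intro mult_mono) auto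
      finally show ?thesis by simp
    qed
    show "\<bar>\<rho> * (\<Sum>i<q. ?w (real i)) - \<rho> * J\<bar> \<le> \<delta>" "\<bar>\<rho> * (\<Sum>i<q. ?w (real i + 1)) - \<rho> * J\<bar> \<le> \<delta>"
      using J1 J2 tele w0 by (auto intro!: *)
  qed
  moreover have "M * ?w (real 0) \<le> M * \<delta>" "M * ?w (real 0 + 1) \<le> M * \<delta>"
    using M w0 by (auto intro!: mult_left_mono)
  ultimately have "\<bar>real q * (\<Sum>a\<in>{c..<d}. measure lborel (first_approx_at \<delta> q a)) - 2 * \<rho> * J\<bar> \<le> 2 * M * \<delta> + 2 * \<delta>"
    using S1 S2 unfolding total by linarith
  then have "\<bar>real q * ((\<Sum>a\<in>{c..<d}. measure lborel (first_approx_at \<delta> q a)) - 2 * \<rho> * (\<delta> * gap_profile (\<delta> * real q)))\<bar>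
     \<le> real q * (2 * \<delta> * min 1 (equidistribution_error q) + 2 * \<delta> / real q)"
    using pos by (simp add: J M_def algebra_simps)
  then show ?thesis using pos by (simp add: abs_mult \<rho>_def)
qed

definition first_approx :: "real \<Rightarrow> nat \<Rightarrow> real set" where
  "first_approx \<delta> q = (\<Union>a. first_approx_at \<delta> q a)"

lemma first_approx_borel [measurable]: "first_approx \<delta> q \<in> sets borel"
  unfolding first_approx_def by (intro sets.countable_UN') auto

lemma abs_measure_diff_le:
  assumes "X \<in> fmeasurable M" "V \<in> fmeasurable M" "E \<in> fmeasurable M" "X \<subseteq> V \<union> E" "V \<subseteq> X \<union> E"
  shows "\<bar>measure M X - measure M V\<bar> \<le> measure M E"
proof -
  have "measure M A \<le> measure M B + measure M E"
    if "A \<in> fmeasurable M" "B \<in> fmeasurable M" "A \<subseteq> B \<union> E" for A B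
  proof -
    have "measure M A \<le> measure M (B \<union> E)"
      using that assms(3) by (intro measure_mono_fmeasurable) auto
    also have "\<dots> \<le> measure M B + measure M E"
      using that assms(3) by (intro measure_Un_le) auto
    finally show ?thesis .
  qed
  from this[of X V] this[of V X] show ?thesis using assms by linarith
qed

lemma Icc_fmeasurable [simp]: "{a..b::real} \<in> fmeasurable lborel"
  by (auto simp: fmeasurable_def emeasure_lborel_Icc_eq)

text \<open>
  Replacing the condition that \<open>t\<close> lies in \<open>[\<alpha>, \<beta>]\<close> by the same condition on \<open>a / q\<close> changes the set only within \<open>\<delta> / q\<close> of
  the two ends.
\<close>

lemma measure_first_approx:
  assumes \<delta>: "\<delta> > 0" "\<delta> < 1/2" "\<delta> * real q < 1" and q: "q \<ge> 2" and \<alpha>\<beta>: "0 \<le> \<alpha>" "\<alpha> \<le> \<beta>" "\<beta> \<le> 1"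
  shows "\<bar>measure lborel (first_approx \<delta> q \<inter> {\<alpha>..\<beta>})
     - 2 * (\<beta> - \<alpha>) * (\<delta> * (real (totient q) / real q) * gap_profile (\<delta> * real q))\<bar>
     \<le> 2 * \<delta> * min 1 (equidistribution_error q) + 10 * \<delta> / real q"
proof -
  define c where "c = \<lfloor>\<alpha> * real q\<rfloor> + 1"
  define d where "d = min (\<lfloor>\<beta> * real q\<rfloor> + 1) (int q)"
  have pos: "real q > 0" using q by simp
  have A: "{c..<d} \<subseteq> {0..<int q}"
  proof -
    have "0 \<le> \<lfloor>\<alpha> * real q\<rfloor>" using \<alpha>\<beta> by simp
    then show ?thesis by (auto simp: c_def d_def)
  qed
  have A_iff: "a \<in> {c..<d} \<longleftrightarrow> \<alpha> * real q < a \<and> a \<le> \<beta> * real q \<and> a < int q" for a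
    by (auto simp: c_def d_def floor_less_iff le_floor_iff) linarith+
  let ?X = "first_approx \<delta> q \<inter> {\<alpha>..\<beta>}" and ?V = "\<Union>a\<in>{c..<d}. first_approx_at \<delta> q a"
  let ?E = "{\<alpha> - \<delta> / real q..\<alpha> + \<delta> / real q} \<union> {\<beta> - \<delta> / real q..\<beta> + \<delta> / real q}"
  have near: "\<bar>t - a / real q\<bar> \<le> \<delta> / real q" if "t \<in> first_approx_at \<delta> q a" for t a
  proof -
    have "\<bar>real q * t - a\<bar> = real q * \<bar>t - a / real q\<bar>"
      using pos by (simp add: abs_mult[symmetric, of "real q", simplified] right_diff_distrib)
    then show ?thesis using that pos by (simp add: first_approx_at_def field_simps)
  qed
  have fm: "first_approx_at \<delta> q a \<in> fmeasurable lborel" for a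
  proof (rule fmeasurableI2[OF Icc_fmeasurable])
    show "first_approx_at \<delta> q a \<subseteq> {a / real q - \<delta> / real q..a / real q + \<delta> / real q}"
      using near[of _ a] by (fastforce simp: abs_le_iff)
  qed simp
  have disj: "disjoint_family_on (first_approx_at \<delta> q) {c..<d}"
  proof (unfold disjoint_family_on_def, intro ballI impI)
    fix a b :: int assume "a \<noteq> b"
    have False if "t \<in> first_approx_at \<delta> q a" "t \<in> first_approx_at \<delta> q b" for t
    proof -
      have "\<bar>real q * t - a\<bar> \<le> \<delta>" "\<bar>real q * t - b\<bar> \<le> \<delta>" using that by (auto simp: first_approx_at_def)
      then have "\<bar>real_of_int a - b\<bar> < 1" using \<delta> by linarith
      then show False using \<open>a \<noteq> b\<close> by linarith
    qed
    then show "first_approx_at \<delta> q a \<inter> first_approx_at \<delta> q b = {}" by blast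
  qed
  have V: "measure lborel ?V = (\<Sum>a\<in>{c..<d}. measure lborel (first_approx_at \<delta> q a))"
    using fm disj by (intro measure_finite_Union) (auto simp: fmeasurable_def less_top[symmetric])
  have E: "measure lborel ?E \<le> 4 * \<delta> / real q"
  proof -
    have "measure lborel ?E \<le> measure lborel {\<alpha> - \<delta> / real q..\<alpha> + \<delta> / real q} + measure lborel {\<beta> - \<delta> / real q..\<beta> + \<delta> / real q}"
      by (rule measure_Un_le) auto
    then show ?thesis using \<delta> pos by simp
  qed
  have XV: "\<bar>measure lborel ?X - measure lborel ?V\<bar> \<le> measure lborel ?E"
  proof (rule abs_measure_diff_le)
    show "?X \<in> fmeasurable lborel" by (rule fmeasurableI2[OF Icc_fmeasurable[of \<alpha> \<beta>]]) auto
    show "?V \<in> fmeasurable lborel" using fm by (intro fmeasurable.finite_UN) auto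
    show "?E \<in> fmeasurable lborel" by (intro fmeasurable.Un) auto
    show "?X \<subseteq> ?V \<union> ?E"
    proof
      fix t assume t: "t \<in> ?X"
      then obtain a where a: "t \<in> first_approx_at \<delta> q a" by (auto simp: first_approx_def)
      note n = near[OF a]
      have "coprime a (int q)" using a first_approx_at_not_coprime[of q \<delta> a] \<delta> q by fastforce
      then have aq: "a \<noteq> int q" using q by auto
      show "t \<in> ?V \<union> ?E"
      proof (cases "a \<in> {c..<d}")
        case False
        then have "a \<le> \<alpha> * real q \<or> \<beta> * real q < a \<or> int q \<le> a" using A_iff[of a] by linarith
        then have "a / real q \<le> \<alpha> \<or> \<beta> \<le> a / real q"
        proof (elim disjE)
          assume "int q \<le> a"
          then have "int q < a" using aq by simp
          then have "real q \<le> of_int a" by linarith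
          then have "\<beta> * real q \<le> a" using \<alpha>\<beta> pos mult_right_mono[of \<beta> 1 "real q"] by linarith
          then show ?thesis using pos by (simp add: le_divide_eq)
        qed (use pos in \<open>auto simp: divide_le_eq le_divide_eq\<close>)
        then show ?thesis using n t by auto
      qed (use a in auto)
    qed
    show "?V \<subseteq> ?X \<union> ?E"
    proof
      fix t assume "t \<in> ?V"
      then obtain a where a: "a \<in> {c..<d}" "t \<in> first_approx_at \<delta> q a" by auto
      note n = near[OF a(2)]
      have "\<alpha> < a / real q" "a / real q \<le> \<beta>" using a(1) A_iff[of a] pos by (auto simp: less_divide_eq divide_le_eq)
      then show "t \<in> ?X \<union> ?E" using n a(2) by (auto simp: first_approx_def)
    qed
  qed
  let ?n = "real (card {c..<d})" and ?D = "\<delta> * gap_profile (\<delta> * real q)"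
  have n: "\<bar>?n - (\<beta> - \<alpha>) * real q\<bar> \<le> 2"
  proof -
    have "\<lfloor>\<alpha> * real q\<rfloor> \<le> \<lfloor>\<beta> * real q\<rfloor>" using \<alpha>\<beta> by (intro floor_mono mult_right_mono) auto
    moreover have "\<lfloor>\<beta> * real q\<rfloor> \<le> int q"
      using \<alpha>\<beta> mult_right_mono[of \<beta> 1 "real q"] by (simp add: floor_le_iff)
    ultimately have "\<lfloor>\<beta> * real q\<rfloor> - \<lfloor>\<alpha> * real q\<rfloor> - 1 \<le> int (card {c..<d}) \<and> int (card {c..<d}) \<le> \<lfloor>\<beta> * real q\<rfloor> - \<lfloor>\<alpha> * real q\<rfloor>"
      by (auto simp: c_def d_def)
    then have "\<lfloor>\<beta> * real q\<rfloor> - \<lfloor>\<alpha> * real q\<rfloor> - (1::real) \<le> ?n \<and> ?n \<le> \<lfloor>\<beta> * real q\<rfloor> - (\<lfloor>\<alpha> * real q\<rfloor>::real)" by linarith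
    moreover have "(\<beta> - \<alpha>) * real q = \<beta> * real q - \<alpha> * real q" by (simp add: algebra_simps)
    ultimately show ?thesis by linarith
  qed
  have D: "0 \<le> ?D" "?D \<le> \<delta>"
    using gap_profile_bounds[of \<delta> q] \<delta> q by (auto intro!: mult_left_le)
  have "2 * (?n * real (totient q) / (real q)\<^sup>2) * ?D - 2 * (\<beta> - \<alpha>) * (\<delta> * (real (totient q) / real q) * gap_profile (\<delta> * real q))
      = (?n - (\<beta> - \<alpha>) * real q) * (2 * (real (totient q) / real q) * ?D / real q)"
    using pos by (simp add: power2_eq_square field_simps)
  also have "\<bar>\<dots>\<bar> \<le> 2 * (2 * \<delta> / real q)"
  proof -
    have "real (totient q) / real q \<le> 1" using totient_le[of q] pos by (simp add: divide_le_eq)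
    then have "2 * (real (totient q) / real q) * ?D / real q \<le> 2 * 1 * \<delta> / real q"
      using D by (intro divide_right_mono mult_mono) auto
    then show ?thesis unfolding abs_mult using n D by (intro mult_mono) auto
  qed
  finally have "\<bar>2 * (?n * real (totient q) / (real q)\<^sup>2) * ?D - 2 * (\<beta> - \<alpha>) * (\<delta> * (real (totient q) / real q) * gap_profile (\<delta> * real q))\<bar>
     \<le> 4 * \<delta> / real q" by simp
  note main = this
  have triangle: "\<bar>X - m\<bar> \<le> e1 + (e2 + e3)" if "\<bar>X - V\<bar> \<le> e1" "\<bar>V - s\<bar> \<le> e2" "\<bar>s - m\<bar> \<le> e3"
    for X V s m e1 e2 e3 :: real
    using that by linarith
  have "\<bar>measure lborel ?X - 2 * (\<beta> - \<alpha>) * (\<delta> * (real (totient q) / real q) * gap_profile (\<delta> * real q))\<bar>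
     \<le> 4 * \<delta> / real q + ((2 * \<delta> * min 1 (equidistribution_error q) + 2 * \<delta> / real q) + 4 * \<delta> / real q)"
    by (rule triangle[OF order.trans[OF XV E] _ main])
       (use sum_measure_first_approx_at[OF \<delta>(1,3) q A] V in simp)
  also have "\<dots> = 2 * \<delta> * min 1 (equidistribution_error q) + (4 * \<delta> + 2 * \<delta> + 4 * \<delta>) / real q"
    by (simp only: add_divide_distrib)
  finally show ?thesis by simp
qed

section \<open>The limit law of the least denominator\<close>

definition approx_within :: "real \<Rightarrow> real \<Rightarrow> real set" where
  "approx_within \<delta> y = {t. \<exists>q::nat. 1 \<le> q \<and> real q \<le> y \<and> (\<exists>a::int. \<bar>real q * t - of_int a\<bar> \<le> \<delta>)}"

lemma approx_within_mono:
  "\<delta> \<le> \<delta>' \<Longrightarrow> y \<le> y' \<Longrightarrow> approx_within \<delta> y \<subseteq> approx_within \<delta>' y'"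
  unfolding approx_within_def by (auto intro: order.trans)

lemma approx_within_eq_Union:
  "approx_within \<delta> y = (\<Union>q\<in>{1..nat \<lfloor>y\<rfloor>}. first_approx \<delta> q)"
proof (intro equalityI subsetI)
  fix t assume "t \<in> approx_within \<delta> y"
  then obtain q0 where q0: "1 \<le> q0" "real q0 \<le> y" "\<exists>a::int. \<bar>real q0 * t - of_int a\<bar> \<le> \<delta>"
    by (auto simp: approx_within_def)
  define P where "P q \<longleftrightarrow> 1 \<le> q \<and> (\<exists>a::int. \<bar>real q * t - of_int a\<bar> \<le> \<delta>)" for q
  define q where "q = (LEAST q. P q)"
  have "P q0" using q0 by (simp add: P_def)
  then have "P q" "q \<le> q0" unfolding q_def by (auto intro: LeastI Least_le)
  have min: "\<not> P q'" if "q' < q" for q' using that not_less_Least unfolding q_def by blast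
  obtain a :: int where "\<bar>real q * t - of_int a\<bar> \<le> \<delta>" using \<open>P q\<close> by (auto simp: P_def)
  then have "t \<in> first_approx_at \<delta> q a"
    using min by (force simp: first_approx_at_def P_def not_le)
  moreover have "q \<in> {1..nat \<lfloor>y\<rfloor>}"
    using \<open>P q\<close> \<open>q \<le> q0\<close> q0 by (auto simp: P_def intro!: le_nat_floor)
  ultimately show "t \<in> (\<Union>q\<in>{1..nat \<lfloor>y\<rfloor>}. first_approx \<delta> q)" by (auto simp: first_approx_def)
next
  fix t assume "t \<in> (\<Union>q\<in>{1..nat \<lfloor>y\<rfloor>}. first_approx \<delta> q)"
  then obtain q a where q: "1 \<le> q" "q \<le> nat \<lfloor>y\<rfloor>" "t \<in> first_approx_at \<delta> q a"
    by (auto simp: first_approx_def)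
  then have "real q \<le> y" by linarith
  with q show "t \<in> approx_within \<delta> y" by (auto simp: approx_within_def first_approx_at_def)
qed

lemma approx_within_borel [measurable]: "approx_within \<delta> y \<in> sets borel"
  unfolding approx_within_eq_Union by (intro sets.finite_UN) auto

text \<open>
  In the unit interval there are \<open>q + 1\<close> fractions with denominator \<open>q\<close>, and \<open>(q + 1) / q \<le> 2\<close>.
\<close>

lemma measure_near_le:
  assumes \<delta>: "\<delta> > 0" "\<delta> < 1" and q: "q \<ge> 1" and \<alpha>\<beta>: "0 \<le> \<alpha>" "\<beta> \<le> 1"
    and X: "X \<in> sets borel" "\<And>t. t \<in> X \<Longrightarrow> \<alpha> \<le> t \<and> t \<le> \<beta> \<and> (\<exists>a::int. \<bar>real q * t - of_int a\<bar> \<le> \<delta>)"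
  shows "measure lborel X \<le> 4 * \<delta>"
proof -
  have pos: "real q > 0" using q by simp
  let ?I = "\<lambda>a::int. {(a - \<delta>) / real q..(a + \<delta>) / real q}"
  have "X \<subseteq> (\<Union>a\<in>{0..int q}. ?I a)"
  proof
    fix t assume t: "t \<in> X"
    then obtain a :: int where a: "\<bar>real q * t - of_int a\<bar> \<le> \<delta>" using X by blast
    have "0 \<le> t" "t \<le> 1" using X(2)[OF t] \<alpha>\<beta> by auto
    then have "0 \<le> real q * t" "real q * t \<le> real q" using pos by (auto simp: mult_left_le)
    then have "a \<in> {0..int q}" using a \<delta> by auto
    moreover have "t \<in> ?I a" using a pos by (auto simp: divide_le_eq le_divide_eq mult.commute abs_le_iff)
    ultimately show "t \<in> (\<Union>a\<in>{0..int q}. ?I a)" by blast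
  qed
  then have "measure lborel X \<le> measure lborel (\<Union>a\<in>{0..int q}. ?I a)"
    using X(1) by (intro measure_mono_fmeasurable fmeasurable.finite_UN) auto
  also have "\<dots> \<le> (\<Sum>a\<in>{0..int q}. measure lborel (?I a))"
    by (intro measure_UNION_le) auto
  also have "\<dots> = (\<Sum>a\<in>{0..int q}. 2 * \<delta> / real q)"
    using \<delta> pos by (intro sum.cong refl) (simp add: divide_right_mono diff_divide_distrib[symmetric])
  also have "\<dots> = 2 * \<delta> * ((real q + 1) / real q)" by simp
  also have "\<dots> \<le> 2 * \<delta> * 2" using \<delta> q by (intro mult_left_mono) (auto simp: divide_le_eq)
  finally show ?thesis by simp
qed

text \<open>
  The sets with least denominator \<open>q\<close> are disjoint, so their measures add up. The hypothesis \<open>x < 1\<close> ensures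
  \<open>\<delta> q < 1\<close> for all the denominators that occur.
\<close>

lemma measure_approx_within:
  assumes \<delta>: "\<delta> > 0" "\<delta> < 1/2" and x: "0 \<le> x" "x < 1" and \<alpha>\<beta>: "0 \<le> \<alpha>" "\<alpha> \<le> \<beta>" "\<beta> \<le> 1"
  defines "N \<equiv> nat \<lfloor>x / \<delta>\<rfloor>"
  shows "\<bar>measure lborel (approx_within \<delta> (x / \<delta>) \<inter> {\<alpha>..\<beta>})
     - 2 * (\<beta> - \<alpha>) * (\<Sum>q\<in>{1..N}. \<delta> * (real (totient q) / real q) * gap_profile (\<delta> * real q))\<bar>
     \<le> 2 * (\<delta> * (\<Sum>q\<in>{1..N}. min 1 (equidistribution_error q))) + 10 * (\<delta> * harm N)"
proof -
  let ?X = "\<lambda>q. first_approx \<delta> q \<inter> {\<alpha>..\<beta>}"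
  let ?m = "\<lambda>q. 2 * (\<beta> - \<alpha>) * (\<delta> * (real (totient q) / real q) * gap_profile (\<delta> * real q))"
  have small: "\<delta> * real q < 1" if "q \<in> {1..N}" for q
  proof -
    have "1 \<le> q" "q \<le> nat \<lfloor>x / \<delta>\<rfloor>" using that by (auto simp: N_def)
    then have "real q \<le> x / \<delta>" by linarith
    then have "real q * \<delta> \<le> x" using \<delta> by (simp add: le_divide_eq)
    then show ?thesis using x by (simp add: mult.commute)
  qed
  have term_bound: "\<bar>measure lborel (?X q) - ?m q\<bar> \<le> 2 * \<delta> * min 1 (equidistribution_error q) + 10 * \<delta> * inverse (real q)" if q: "q \<in> {1..N}" for q
  proof (cases "q \<ge> 2")
    case True
    then show ?thesis using measure_first_approx[OF \<delta> small[OF q] True \<alpha>\<beta>] by (simp add: divide_inverse)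
  next
    case False
    then have [simp]: "q = 1" using q by auto
    have "measure lborel (?X 1) \<le> 4 * \<delta>"
      using \<delta> \<alpha>\<beta> by (intro measure_near_le[where q = 1]) (auto simp: first_approx_def first_approx_at_def)
    moreover have "0 \<le> ?m 1" "?m 1 \<le> 2 * \<delta>"
    proof -
      have g: "0 \<le> gap_profile (\<delta> * real 1)" "gap_profile (\<delta> * real 1) \<le> 1"
        using gap_profile_bounds[of \<delta> 1] \<delta> by auto
      then show "0 \<le> ?m 1" using \<delta> \<alpha>\<beta> by simp
      have "(\<beta> - \<alpha>) * (\<delta> * gap_profile \<delta>) \<le> 1 * (\<delta> * 1)"
        using g \<delta> \<alpha>\<beta> by (intro mult_mono mult_left_mono) auto
      moreover have "?m 1 = 2 * ((\<beta> - \<alpha>) * (\<delta> * gap_profile \<delta>))" by (simp add: algebra_simps)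
      ultimately show "?m 1 \<le> 2 * \<delta>" by linarith
    qed
    moreover have "0 \<le> 2 * \<delta> * min 1 (equidistribution_error 1)"
      using \<delta> equidistribution_error_nonneg[of 1] by simp
    moreover have "0 \<le> measure lborel (?X 1)" by simp
    ultimately show ?thesis using \<delta> by (simp only: \<open>q = 1\<close> of_nat_1 inverse_1)
  qed
  have disj: "disjoint_family_on ?X {1..N}"
  proof (unfold disjoint_family_on_def, intro ballI impI)
    fix p q assume pq: "p \<in> {1..N}" "q \<in> {1..N}" "p \<noteq> q"
    have "\<not> (t \<in> first_approx \<delta> p \<and> t \<in> first_approx \<delta> q)" if "1 \<le> p" "p < q" for t p q
    proof
      assume "t \<in> first_approx \<delta> p \<and> t \<in> first_approx \<delta> q"
      then obtain a b where "\<bar>real p * t - of_int a\<bar> \<le> \<delta>" "t \<in> first_approx_at \<delta> q b"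
        by (auto simp: first_approx_def first_approx_at_def)
      moreover from this(2) have "\<delta> < \<bar>real p * t - of_int a\<bar>"
        using that unfolding first_approx_at_def by auto
      ultimately show False by simp
    qed
    then show "?X p \<inter> ?X q = {}" using pq by (cases "p < q") (auto simp: not_less le_less)
  qed
  have "measure lborel (approx_within \<delta> (x / \<delta>) \<inter> {\<alpha>..\<beta>}) = measure lborel (\<Union>q\<in>{1..N}. ?X q)"
    unfolding approx_within_eq_Union N_def by (simp add: Int_UN_distrib2 flip: UN_extend_simps(4))
  also have "\<dots> = (\<Sum>q\<in>{1..N}. measure lborel (?X q))"
  proof (intro measure_finite_Union disj)
    fix q
    have "?X q \<in> fmeasurable lborel" by (rule fmeasurableI2[OF Icc_fmeasurable[of \<alpha> \<beta>]]) auto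
    then show "emeasure lborel (?X q) \<noteq> \<infinity>" by (auto simp: fmeasurable_def)
  qed auto
  finally have "measure lborel (approx_within \<delta> (x / \<delta>) \<inter> {\<alpha>..\<beta>}) = (\<Sum>q\<in>{1..N}. measure lborel (?X q))" .
  then have eq: "measure lborel (approx_within \<delta> (x / \<delta>) \<inter> {\<alpha>..\<beta>}) - 2 * (\<beta> - \<alpha>) * (\<Sum>q\<in>{1..N}. \<delta> * (real (totient q) / real q) * gap_profile (\<delta> * real q))
     = (\<Sum>q\<in>{1..N}. measure lborel (?X q) - ?m q)"
    by (simp only: sum_subtractf sum_distrib_left)
  have "\<bar>\<Sum>q\<in>{1..N}. measure lborel (?X q) - ?m q\<bar> \<le> (\<Sum>q\<in>{1..N}. 2 * \<delta> * min 1 (equidistribution_error q) + 10 * \<delta> * inverse (real q))"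
    by (intro order.trans[OF sum_abs] sum_mono term_bound)
  moreover have "(\<Sum>q\<in>{1..N}. 2 * \<delta> * min 1 (equidistribution_error q) + 10 * \<delta> * inverse (real q))
     = 2 * (\<delta> * (\<Sum>q\<in>{1..N}. min 1 (equidistribution_error q))) + 10 * (\<delta> * harm N)"
    by (simp add: sum.distrib sum_distrib_left harm_def mult.assoc)
  ultimately show ?thesis unfolding eq by (simp only:)
qed

lemma continuous_on_gap_profile: "continuous_on {0..1} gap_profile"
proof -
  let ?g = "\<lambda>u::real. (1 - u) / u * (1 + ln (u / (1 - u)))"
  have "continuous_on {1/2..1} ?g"
    unfolding continuous_on_eq_continuous_within
  proof
    fix u :: real assume u: "u \<in> {1/2..1}"
    show "continuous (at u within {1/2..1}) ?g"
    proof (cases "u = 1")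
      case True
      have "(?g \<longlongrightarrow> 0) (at_left 1)" by real_asymp
      moreover have "at 1 within {1/2..1} = at_left (1::real)"
        by (rule at_within_Icc_at_left) simp
      ultimately show ?thesis by (simp add: continuous_within True)
    next
      case False
      have "continuous_on {0<..<1} ?g" by (intro continuous_intros) auto
      then have "isCont ?g u"
        using u False by (auto simp: continuous_on_eq_continuous_at)
      then show ?thesis by (rule continuous_at_imp_continuous_at_within)
    qed
  qed
  then have "continuous_on ({0..1/2} \<union> {1/2..1}) (\<lambda>u. if u \<le> 1/2 then 1 else ?g u)"
  proof (intro continuous_on_If)
    show "1 = ?g u" if "u \<in> {1/2..1}" "u \<le> 1/2" for u
    proof -
      have "u = 1/2" using that by simp
      show ?thesis unfolding \<open>u = 1/2\<close> by simp
    qed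
  qed auto
  moreover have "{0..1/2} \<union> {1/2..1} = {0..1::real}" by auto
  ultimately show ?thesis by (simp add: gap_profile_def[abs_def])
qed

lemma gap_profile_nonneg_le_1:
  assumes "u \<in> {0..1}"
  shows "0 \<le> gap_profile u" "gap_profile u \<le> 1"
proof -
  have "0 \<le> gap_profile u \<and> gap_profile u \<le> 1"
  proof (cases "u = 1 \<or> u = 0")
    case False
    then have "0 < u" "u < 1" using assms by auto
    then show ?thesis using gap_profile_bounds[of u 1] by simp
  qed (auto simp: gap_profile_def)
  then show "0 \<le> gap_profile u" "gap_profile u \<le> 1" by auto
qed

text \<open>
  The truncation makes the function a distribution function on the whole line.
\<close>

definition limit_cdf :: "real \<Rightarrow> real" where
  "limit_cdf x = 12 / pi\<^sup>2 * integral {0..min (max x 0) 1} gap_profile"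

lemma gap_profile_integrable: "0 \<le> a \<Longrightarrow> b \<le> 1 \<Longrightarrow> gap_profile integrable_on {a..b}"
  by (intro integrable_continuous_interval continuous_on_subset[OF continuous_on_gap_profile]) auto

lemma limit_cdf_mono_lipschitz:
  assumes "x \<le> y"
  shows "0 \<le> limit_cdf y - limit_cdf x" "limit_cdf y - limit_cdf x \<le> 2 * (y - x)"
proof -
  let ?x = "min (max x 0) 1" and ?y = "min (max y 0) 1"
  have le: "?x \<le> ?y" "?y - ?x \<le> y - x" using assms by auto
  have "integral {0..?x} gap_profile + integral {?x..?y} gap_profile = integral {0..?y} gap_profile"
    using le by (intro Henstock_Kurzweil_Integration.integral_combine gap_profile_integrable) auto
  then have "integral {?x..?y} gap_profile = integral {0..?y} gap_profile - integral {0..?x} gap_profile" by simp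
  then have eq: "limit_cdf y - limit_cdf x = 12 / pi\<^sup>2 * integral {?x..?y} gap_profile"
    unfolding limit_cdf_def by (simp only: right_diff_distrib)
  have "0 \<le> integral {?x..?y} gap_profile"
    using gap_profile_nonneg_le_1(1) by (intro Henstock_Kurzweil_Integration.integral_nonneg gap_profile_integrable) auto
  moreover have "integral {?x..?y} gap_profile \<le> integral {?x..?y} (\<lambda>_. 1)"
    using gap_profile_nonneg_le_1(2) by (intro integral_le gap_profile_integrable integrable_const_ivl) auto
  moreover have "pi\<^sup>2 \<ge> 3\<^sup>2" using pi_gt3 by (intro power_mono) auto
  then have "12 / pi\<^sup>2 \<le> 2" by (simp add: divide_le_eq)
  ultimately show "0 \<le> limit_cdf y - limit_cdf x" "limit_cdf y - limit_cdf x \<le> 2 * (y - x)"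
  proof -
    assume I: "0 \<le> integral {?x..?y} gap_profile" "integral {?x..?y} gap_profile \<le> integral {?x..?y} (\<lambda>_. 1)"
      and c: "12 / pi\<^sup>2 \<le> 2"
    have "integral {?x..?y} (\<lambda>_. 1) = ?y - ?x" using le(1) by simp
    with I(2) le have "integral {?x..?y} gap_profile \<le> y - x" by linarith
    from mult_mono[OF c this _ I(1)]
    have "12 / pi\<^sup>2 * integral {?x..?y} gap_profile \<le> 2 * (y - x)" by simp
    then show "limit_cdf y - limit_cdf x \<le> 2 * (y - x)" by (simp only: eq)
    show "0 \<le> limit_cdf y - limit_cdf x" unfolding eq using I(1) by (intro mult_nonneg_nonneg) auto
  qed
qed

lemma limit_cdf_lipschitz: "\<bar>limit_cdf u - limit_cdf v\<bar> \<le> 2 * \<bar>u - v\<bar>"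
  using limit_cdf_mono_lipschitz[of u v] limit_cdf_mono_lipschitz[of v u] by (cases "u \<le> v") auto

lemma continuous_on_limit_cdf: "continuous_on UNIV limit_cdf"
proof (rule continuous_onI)
  fix x e :: real assume "e > 0"
  then show "\<exists>d>0. \<forall>x'\<in>UNIV. dist x' x < d \<longrightarrow> dist (limit_cdf x') (limit_cdf x) \<le> e"
    by (intro exI[of _ "e / 2"]) (auto simp: dist_real_def intro: order.trans[OF limit_cdf_lipschitz])
qed

lemma measure_approx_within_tendsto_below:
  assumes x: "x < 1" and \<alpha>\<beta>: "0 \<le> \<alpha>" "\<alpha> \<le> \<beta>" "\<beta> \<le> 1"
  shows "((\<lambda>\<delta>. measure lborel (approx_within \<delta> (x / \<delta>) \<inter> {\<alpha>..\<beta>})) \<longlongrightarrow> (\<beta> - \<alpha>) * limit_cdf x) (at_right 0)"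
proof (cases "x < 0")
  case True
  have "\<forall>\<^sub>F \<delta>::real in at_right 0. \<delta> > 0" by (rule eventually_at_right_less)
  then have "\<forall>\<^sub>F \<delta> in at_right 0. measure lborel (approx_within \<delta> (x / \<delta>) \<inter> {\<alpha>..\<beta>}) = 0"
  proof eventually_elim
    case (elim \<delta>)
    then have "x / \<delta> < 0" using True by (simp add: divide_neg_pos)
    then have "approx_within \<delta> (x / \<delta>) = {}" by (auto simp: approx_within_def) 
    then show ?case by simp
  qed
  then show ?thesis using True by (simp add: limit_cdf_def tendsto_eventually)
next
  case False
  then have x0: "0 \<le> x" by simp
  define N where "N \<delta> = nat \<lfloor>x / \<delta>\<rfloor>" for \<delta>
  let ?S = "\<lambda>\<delta>. 2 * (\<beta> - \<alpha>) * (\<Sum>q\<in>{1..N \<delta>}. \<delta> * (real (totient q) / real q) * gap_profile (\<delta> * real q))"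
  let ?e = "\<lambda>\<delta>. 2 * (\<delta> * (\<Sum>q\<in>{1..N \<delta>}. min 1 (equidistribution_error q))) + 10 * (\<delta> * harm (N \<delta>))"
  have "(?S \<longlongrightarrow> 2 * (\<beta> - \<alpha>) * (6 / pi\<^sup>2 * integral {0..x} gap_profile)) (at_right 0)"
    unfolding N_def using x x0
    by (intro tendsto_mult tendsto_const totient_riemann_sum continuous_on_subset[OF continuous_on_gap_profile]) auto
  moreover have "2 * (\<beta> - \<alpha>) * (6 / pi\<^sup>2 * integral {0..x} gap_profile) = (\<beta> - \<alpha>) * limit_cdf x"
    using x x0 by (simp add: limit_cdf_def)
  ultimately have S: "(?S \<longlongrightarrow> (\<beta> - \<alpha>) * limit_cdf x) (at_right 0)" by simp
  have e1: "((\<lambda>\<delta>. \<delta> * (\<Sum>q\<in>{1..N \<delta>}. min 1 (equidistribution_error q))) \<longlongrightarrow> 0 * x) (at_right 0)"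
    unfolding N_def by (rule scaled_mean_tendsto[OF equidistribution_error_cesaro _ x0]) simp
  have e2: "((\<lambda>\<delta>. \<delta> * harm (N \<delta>)) \<longlongrightarrow> 0 * x) (at_right 0)"
    unfolding N_def by (rule scaled_mean_tendsto[OF harm_over_n_tendsto_0 _ x0]) (simp add: harm_expand)
  have "(?e \<longlongrightarrow> 2 * (0 * x) + 10 * (0 * x)) (at_right 0)"
    by (intro tendsto_add tendsto_mult_left e1 e2)
  then have e: "(?e \<longlongrightarrow> 0) (at_right 0)" by simp
  have "\<forall>\<^sub>F \<delta>::real in at_right 0. \<delta> > 0" by (rule eventually_at_right_less)
  moreover have "\<forall>\<^sub>F \<delta>::real in at_right 0. \<delta> < 1/2"
    by (rule eventually_at_rightI[of 0 "1/2"]) auto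
  ultimately have "\<forall>\<^sub>F \<delta> in at_right 0. norm (measure lborel (approx_within \<delta> (x / \<delta>) \<inter> {\<alpha>..\<beta>}) - ?S \<delta>) \<le> ?e \<delta>"
    by eventually_elim (use measure_approx_within[OF _ _ x0 x \<alpha>\<beta>] in \<open>simp add: N_def\<close>)
  then have "((\<lambda>\<delta>. measure lborel (approx_within \<delta> (x / \<delta>) \<inter> {\<alpha>..\<beta>}) - ?S \<delta>) \<longlongrightarrow> 0) (at_right 0)"
    by (rule Lim_null_comparison[OF _ e])
  from tendsto_add[OF this S] show ?thesis by simp
qed

lemma approx_within_dirichlet:
  assumes "\<delta> > 0"
  shows "t \<in> approx_within \<delta> (1 / \<delta> + 1)"
proof -
  define N where "N = nat \<lceil>1 / \<delta>\<rceil>"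
  have N: "N > 0" "1 / \<delta> \<le> real N" "real N \<le> 1 / \<delta> + 1" using assms by (auto simp: N_def)
  obtain h k where hk: "0 < k" "k \<le> int N" "\<bar>of_int k * t - of_int h\<bar> < 1 / N"
    using Dirichlet_approx[OF N(1), of t] by blast
  have "1 / real N \<le> \<delta>" using N assms by (simp add: field_simps)
  then have "\<bar>of_int k * t - of_int h\<bar> \<le> \<delta>" using hk by linarith
  moreover have "1 \<le> nat k" "real (nat k) \<le> 1 / \<delta> + 1" using hk N by linarith+
  ultimately show ?thesis using hk(1) unfolding approx_within_def
    by (intro CollectI exI[of _ "nat k"]) auto
qed

text \<open>
  By Dirichlet's theorem all slopes have a good denominator up to \<open>1 / \<delta> + 1\<close>. The denominators between
  \<open>x / \<delta>\<close> and this bound are at most \<open>(1 - x) / \<delta> + 2\<close> in number and each accounts for measure at most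
  \<open>4 \<delta>\<close>, so no mass is lost as \<open>x\<close> tends to \<open>1\<close>.
\<close>

lemma limit_cdf_1: "limit_cdf 1 = 1"
proof -
  have both: "limit_cdf x \<le> 1 \<and> 1 - 4 * (1 - x) \<le> limit_cdf x" if x: "0 \<le> x" "x < 1" for x
  proof -
    have lim: "((\<lambda>\<delta>. measure lborel (approx_within \<delta> (x / \<delta>) \<inter> {0..1})) \<longlongrightarrow> limit_cdf x) (at_right 0)"
      using measure_approx_within_tendsto_below[of x 0 1] x by simp
    have fm: "approx_within \<delta> y \<inter> {0..1} \<in> fmeasurable lborel" for \<delta> y
      by (rule fmeasurableI2[OF Icc_fmeasurable[of 0 1]]) auto
    have "measure lborel (approx_within \<delta> (x / \<delta>) \<inter> {0..1}) \<le> 1" for \<delta>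
      using measure_mono_fmeasurable[of "approx_within \<delta> (x / \<delta>) \<inter> {0..1}" "{0..1}" lborel] by auto
    then have "limit_cdf x \<le> 1"
      by (intro tendsto_upperbound[OF lim]) auto
    moreover have "1 - 4 * (1 - x) \<le> limit_cdf x"
    proof (rule tendsto_le[OF _ lim])
      show "((\<lambda>\<delta>::real. 1 - 4 * (1 - x) - 12 * \<delta>) \<longlongrightarrow> 1 - 4 * (1 - x)) (at_right 0)"
        by (auto intro!: tendsto_eq_intros)
      have "\<forall>\<^sub>F \<delta>::real in at_right 0. \<delta> > 0" by (rule eventually_at_right_less)
      moreover have "\<forall>\<^sub>F \<delta>::real in at_right 0. \<delta> < 1/2"
        by (rule eventually_at_rightI[of 0 "1/2"]) auto
      ultimately show "\<forall>\<^sub>F \<delta> in at_right 0. 1 - 4 * (1 - x) - 12 * \<delta> \<le> measure lborel (approx_within \<delta> (x / \<delta>) \<inter> {0..1})"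
      proof eventually_elim
        case (elim \<delta>)
        let ?n = "nat \<lfloor>x / \<delta>\<rfloor>" and ?m = "nat \<lfloor>1 / \<delta> + 1\<rfloor>"
        let ?X = "approx_within \<delta> (x / \<delta>) \<inter> {0..1}" and ?Y = "\<lambda>q. first_approx \<delta> q \<inter> {0..1}"
        have Y: "measure lborel (?Y q) \<le> 4 * \<delta>" if "q \<ge> 1" for q
          using elim that by (intro measure_near_le[where q = q and \<alpha> = 0 and \<beta> = 1]) (auto simp: first_approx_def first_approx_at_def)
        have sub: "{0..1} \<subseteq> ?X \<union> (\<Union>q\<in>{?n<..?m}. ?Y q)"
        proof
          fix t :: real assume t: "t \<in> {0..1}"
          have "t \<in> (\<Union>q\<in>{1..?m}. first_approx \<delta> q)"
            using approx_within_dirichlet[of \<delta> t] elim unfolding approx_within_eq_Union by simp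
          then obtain p where p: "p \<in> {1..?m}" "t \<in> first_approx \<delta> p" by blast
          then show "t \<in> ?X \<union> (\<Union>q\<in>{?n<..?m}. ?Y q)"
            using t unfolding approx_within_eq_Union by (cases "p \<le> ?n") auto
        qed
        have fmY: "?Y q \<in> fmeasurable lborel" for q
          by (rule fmeasurableI2[OF Icc_fmeasurable[of 0 1]]) auto
        have "1 = measure lborel {0..1::real}" by simp
        also have "\<dots> \<le> measure lborel (?X \<union> (\<Union>q\<in>{?n<..?m}. ?Y q))"
          using fm fmY by (intro measure_mono_fmeasurable[OF sub] fmeasurable.Un fmeasurable.finite_UN) auto
        also have "\<dots> \<le> measure lborel ?X + measure lborel (\<Union>q\<in>{?n<..?m}. ?Y q)"
          using fm fmY by (intro measure_Un_le) auto
        also have "measure lborel (\<Union>q\<in>{?n<..?m}. ?Y q) \<le> (\<Sum>q\<in>{?n<..?m}. measure lborel (?Y q))"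
          by (intro measure_UNION_le) auto
        also have "\<dots> \<le> (\<Sum>q\<in>{?n<..?m}. 4 * \<delta>)"
          by (intro sum_mono Y) auto
        also have "\<dots> = 4 * \<delta> * real (?m - ?n)" by simp
        also have "\<dots> \<le> 4 * \<delta> * ((1 - x) / \<delta> + 2)"
        proof (intro mult_left_mono)
          have "?n \<le> ?m" using elim x by (intro nat_mono floor_mono) (auto simp: field_simps)
          then have "real (?m - ?n) = real ?m - real ?n" by (rule of_nat_diff)
          moreover have "real ?m \<le> 1 / \<delta> + 1" using elim by (intro of_nat_floor) auto
          moreover have "real ?n \<ge> x / \<delta> - 1" by linarith
          ultimately show "real (?m - ?n) \<le> (1 - x) / \<delta> + 2" by (simp add: diff_divide_distrib)
        qed (use elim in simp)
        also have "\<dots> = 4 * (1 - x) + 8 * \<delta>" using elim by (simp add: field_simps)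
        finally show ?case using elim by simp
      qed
    qed simp
    ultimately show ?thesis by simp
  qed
  have near_1: "\<bar>limit_cdf 1 - 1\<bar> \<le> 6 * e" if "0 < e" "e \<le> 1" for e
    using both[of "1 - e"] limit_cdf_mono_lipschitz[of "1 - e" 1] that by auto
  have "\<bar>limit_cdf 1 - 1\<bar> \<le> 0 + e" if "e > 0" for e
    using near_1[of "min 1 (e / 6)"] that by linarith
  then have "\<bar>limit_cdf 1 - 1\<bar> \<le> 0" by (rule field_le_epsilon)
  then show ?thesis by simp
qed

lemma limit_cdf_outside: "x \<le> 0 \<Longrightarrow> limit_cdf x = 0" "1 \<le> x \<Longrightarrow> limit_cdf x = 1"
proof -
  show "limit_cdf x = 0" if "x \<le> 0"
  proof -
    have "min (max x 0) 1 = 0" using that by simp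
    then show ?thesis by (simp add: limit_cdf_def)
  qed
  show "limit_cdf x = 1" if "1 \<le> x"
  proof -
    have "limit_cdf x = limit_cdf 1" using that by (simp add: limit_cdf_def)
    then show ?thesis by (simp only: limit_cdf_1)
  qed
qed

lemma limit_cdf_bounds: "0 \<le> limit_cdf x" "limit_cdf x \<le> 1"
  using limit_cdf_mono_lipschitz(1)[of "min x 0" x] limit_cdf_mono_lipschitz(1)[of x "max x 1"]
    limit_cdf_outside(1)[of "min x 0"] limit_cdf_outside(2)[of "max x 1"] by simp_all

theorem measure_approx_within_tendsto:
  assumes \<alpha>\<beta>: "0 \<le> \<alpha>" "\<alpha> \<le> \<beta>" "\<beta> \<le> 1"
  shows "((\<lambda>\<delta>. measure lborel (approx_within \<delta> (x / \<delta>) \<inter> {\<alpha>..\<beta>})) \<longlongrightarrow> (\<beta> - \<alpha>) * limit_cdf x) (at_right 0)"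
proof (cases "x < 1")
  case True
  then show ?thesis by (rule measure_approx_within_tendsto_below[OF _ \<alpha>\<beta>])
next
  case False
  let ?m = "\<lambda>y \<delta>. measure lborel (approx_within \<delta> (y / \<delta>) \<inter> {\<alpha>..\<beta>})"
  have cdf: "limit_cdf x = 1" using False by (simp add: limit_cdf_outside)
  have fm: "approx_within \<delta> y \<inter> {\<alpha>..\<beta>} \<in> fmeasurable lborel" for \<delta> y
    by (rule fmeasurableI2[OF Icc_fmeasurable[of \<alpha> \<beta>]]) auto
  have up: "?m x \<delta> \<le> \<beta> - \<alpha>" for \<delta>
    using measure_mono_fmeasurable[of "approx_within \<delta> (x / \<delta>) \<inter> {\<alpha>..\<beta>}" "{\<alpha>..\<beta>}" lborel] \<alpha>\<beta> by auto
  show ?thesis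
  proof (rule order_tendstoI)
    fix b assume "b < (\<beta> - \<alpha>) * limit_cdf x"
    then have b: "b < \<beta> - \<alpha>" by (simp add: cdf)
    define e where "e = (\<beta> - \<alpha> - b) / 4"
    have e: "e > 0" using b by (simp add: e_def)
    have "1 - 2 * e \<le> limit_cdf (1 - e)" using limit_cdf_mono_lipschitz(2)[of "1 - e" 1] limit_cdf_1 e by simp
    then have "(\<beta> - \<alpha>) * (1 - 2 * e) \<le> (\<beta> - \<alpha>) * limit_cdf (1 - e)" using \<alpha>\<beta> by (intro mult_left_mono) auto
    moreover have "(\<beta> - \<alpha>) * (2 * e) \<le> 1 * (2 * e)" using \<alpha>\<beta> e by (intro mult_right_mono) auto
    moreover have "(\<beta> - \<alpha>) * (1 - 2 * e) = (\<beta> - \<alpha>) - (\<beta> - \<alpha>) * (2 * e)" by (simp add: algebra_simps)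
    moreover have "2 * e < \<beta> - \<alpha> - b" using b by (simp add: e_def)
    ultimately have "b < (\<beta> - \<alpha>) * limit_cdf (1 - e)" by linarith
    with measure_approx_within_tendsto_below[OF _ \<alpha>\<beta>, of "1 - e"] e
    have "\<forall>\<^sub>F \<delta> in at_right 0. b < ?m (1 - e) \<delta>" by (intro order_tendstoD(1)) auto
    moreover have "\<forall>\<^sub>F \<delta>::real in at_right 0. \<delta> > 0" by (rule eventually_at_right_less)
    ultimately show "\<forall>\<^sub>F \<delta> in at_right 0. b < ?m x \<delta>"
    proof eventually_elim
      case (elim \<delta>)
      have "(1 - e) / \<delta> \<le> x / \<delta>" using False e elim by (intro divide_right_mono) auto
      then have "approx_within \<delta> ((1 - e) / \<delta>) \<subseteq> approx_within \<delta> (x / \<delta>)" by (intro approx_within_mono) auto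
      then have "?m (1 - e) \<delta> \<le> ?m x \<delta>" using fm by (intro measure_mono_fmeasurable) auto
      then show ?case using elim by simp
    qed
  next
    fix b assume "(\<beta> - \<alpha>) * limit_cdf x < b"
    then have "\<beta> - \<alpha> < b" by (simp add: cdf)
    then show "\<forall>\<^sub>F \<delta> in at_right 0. ?m x \<delta> < b" using up by (intro always_eventually allI) (rule le_less_trans)
  qed
qed

section \<open>Free paths and Diophantine approximation\<close>

lemma hitting_times_bdd_below: "bdd_below (hitting_times S \<omega>)"
  by (rule bdd_belowI[of _ 0]) (auto simp: hitting_times_def)

lemma tan_le_1_angle: "0 \<le> tan \<omega> \<and> tan \<omega> \<le> 1" if "0 \<le> \<omega>" "\<omega> \<le> pi/4"
proof -
  have "tan \<omega> \<le> tan (pi/4)" using that by (intro tan_mono_le) (use pi_gt_zero in linarith)+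
  moreover have "0 \<le> tan \<omega>" using that by (cases "\<omega> = 0") (auto intro!: less_imp_le tan_gt_zero)
  ultimately show ?thesis by (simp add: tan_45)
qed

text \<open>
  The lattice point \<open>(x, y)\<close> has signed distance \<open>d\<close> to the line in direction \<open>\<omega>\<close>, and its projection lies at
  the time \<open>s\<close>.
\<close>

lemma circle_decomposition:
  fixes \<omega> \<tau> x y :: real
  defines "d \<equiv> x * sin \<omega> - y * cos \<omega>" and "s \<equiv> x * cos \<omega> + y * sin \<omega>"
  shows "(\<tau> * cos \<omega> - x)\<^sup>2 + (\<tau> * sin \<omega> - y)\<^sup>2 = (\<tau> - s)\<^sup>2 + d\<^sup>2"
    and "cos \<omega> \<noteq> 0 \<Longrightarrow> x / cos \<omega> = s + d * tan \<omega>"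
proof -
  have c: "cos \<omega> * cos \<omega> = 1 - sin \<omega> * sin \<omega>"
    using sin_cos_squared_add3[of \<omega>] by linarith
  have x: "x = s * cos \<omega> + d * sin \<omega>" unfolding d_def s_def using c by algebra
  have y: "y = s * sin \<omega> - d * cos \<omega>" unfolding d_def s_def using c by algebra
  show "(\<tau> * cos \<omega> - x)\<^sup>2 + (\<tau> * sin \<omega> - y)\<^sup>2 = (\<tau> - s)\<^sup>2 + d\<^sup>2"
    unfolding d_def s_def using c by algebra
  show "x / cos \<omega> = s + d * tan \<omega>" if "cos \<omega> \<noteq> 0"
    using that by (subst x) (simp add: tan_def add_divide_distrib)
qed

text \<open>
  Since \<open>0 \<le> sin \<omega> \<le> cos \<omega>\<close>, a nonzero lattice point within \<open>\<epsilon> < 1/2\<close> of the ray cannot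
  lie on the vertical axis or to its left.
\<close>

lemma first_quadrant_lattice_point:
  assumes \<omega>: "0 \<le> \<omega>" "\<omega> \<le> pi/4" and \<epsilon>: "0 < \<epsilon>" "\<epsilon> < 1/2" and "\<tau> > 0"
    and near: "\<bar>\<tau> * cos \<omega> - of_int k\<bar> \<le> \<epsilon>" "\<bar>\<tau> * sin \<omega> - of_int h\<bar> \<le> \<epsilon>" and "(k, h) \<noteq> (0, 0)"
  shows "1 \<le> k"
proof (rule ccontr)
  have c: "cos \<omega> > 0" by (rule cos_pos_angle[OF \<omega>])
  have "sin \<omega> = tan \<omega> * cos \<omega>" using c by (simp add: tan_def)
  then have s: "0 \<le> sin \<omega>" "sin \<omega> \<le> cos \<omega>"
    using tan_le_1_angle[OF \<omega>] c by (auto simp: mult_le_cancel_right1)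
  then have le: "0 \<le> \<tau> * sin \<omega>" "\<tau> * sin \<omega> \<le> \<tau> * cos \<omega>" using \<open>\<tau> > 0\<close> by auto
  assume "\<not> 1 \<le> k"
  then have "real_of_int k \<le> 0" by simp
  then have "\<tau> * cos \<omega> \<le> \<epsilon>" "real_of_int k > -1" using near le \<epsilon> by linarith+
  then have "k = 0" using \<open>\<not> 1 \<le> k\<close> by linarith
  moreover have "real_of_int h < 1" "real_of_int h > -1" using near le \<epsilon> \<open>\<tau> * cos \<omega> \<le> \<epsilon>\<close> by linarith+
  then have "h = 0" by linarith
  ultimately show False using assms by simp
qed

text \<open>
  The ray leaves the disc around \<open>(q, a)\<close> at a time that differs from \<open>q / cos \<omega>\<close> by at most
  \<open>\<bar>d tan \<omega>\<bar> + \<epsilon> \<le> 2 \<epsilon>\<close>.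
\<close>

lemma circle_path_le:
  assumes \<omega>: "0 \<le> \<omega>" "\<omega> \<le> pi/4" and \<epsilon>: "0 < \<epsilon>" "\<epsilon> < 1/2"
    and t: "tan \<omega> \<in> approx_within (\<epsilon> / cos \<omega>) (y * cos \<omega>)"
  shows "circle_path \<epsilon> \<omega> \<le> y + 2 * \<epsilon>"
proof -
  obtain q :: nat and a :: int where q: "1 \<le> q" "real q \<le> y * cos \<omega>" and a: "\<bar>real q * tan \<omega> - of_int a\<bar> \<le> \<epsilon> / cos \<omega>"
    using t by (auto simp: approx_within_def)
  have c: "cos \<omega> > 0" by (rule cos_pos_angle[OF \<omega>])
  define d where "d = real q * sin \<omega> - of_int a * cos \<omega>"
  define s where "s = real q * cos \<omega> + of_int a * sin \<omega>"
  define \<tau> where "\<tau> = s + sqrt (\<epsilon>\<^sup>2 - d\<^sup>2)"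
  have "d = (real q * tan \<omega> - of_int a) * cos \<omega>" using c by (simp add: d_def tan_def field_simps)
  then have "\<bar>d\<bar> = \<bar>real q * tan \<omega> - of_int a\<bar> * cos \<omega>" using c by (simp add: abs_mult)
  also have "\<dots> \<le> \<epsilon>" using a c by (simp add: pos_le_divide_eq)
  finally have d: "\<bar>d\<bar> \<le> \<epsilon>" .
  then have d2: "d\<^sup>2 \<le> \<epsilon>\<^sup>2" using \<epsilon> by (simp add: abs_le_square_iff[symmetric])
  have r: "0 \<le> sqrt (\<epsilon>\<^sup>2 - d\<^sup>2)" "sqrt (\<epsilon>\<^sup>2 - d\<^sup>2) \<le> \<epsilon>"
    using d2 \<epsilon> by (auto intro: real_le_lsqrt)
  have qs: "real q / cos \<omega> = s + d * tan \<omega>"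
    unfolding d_def s_def using circle_decomposition(2)[of \<omega> "real q" "of_int a"] c by simp
  have "\<bar>d * tan \<omega>\<bar> \<le> \<epsilon> * 1" unfolding abs_mult
    using d tan_le_1_angle[OF \<omega>] \<epsilon> by (intro mult_mono) auto
  then have s: "\<bar>real q / cos \<omega> - s\<bar> \<le> \<epsilon>" using qs by simp
  have "real q / cos \<omega> \<ge> real q / 1" using c q by (intro divide_left_mono) auto
  then have "\<tau> > 0" using s r q \<epsilon> unfolding \<tau>_def by linarith
  have "(\<tau> * cos \<omega> - real q)\<^sup>2 + (\<tau> * sin \<omega> - of_int a)\<^sup>2 = (\<tau> - s)\<^sup>2 + d\<^sup>2"
    unfolding d_def s_def by (rule circle_decomposition(1))
  also have "\<dots> = \<epsilon>\<^sup>2" using d2 by (simp add: \<tau>_def)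
  finally have "(\<tau> * cos \<omega> - real q, \<tau> * sin \<omega> - of_int a) \<in> circle_scatterer \<epsilon>"
    by (simp add: circle_scatterer_def)
  moreover have "(real q, of_int a) \<in> nonzero_lattice" using q by (auto simp: nonzero_lattice_def)
  ultimately have "(\<tau> * cos \<omega> - real q, \<tau> * sin \<omega> - of_int a) + (real q, of_int a) \<in> circle_scatterer \<epsilon> + nonzero_lattice"
    by (rule set_plus_intro)
  then have "\<tau> \<in> hitting_times (circle_scatterer \<epsilon> + nonzero_lattice) \<omega>"
    using \<open>\<tau> > 0\<close> by (simp add: hitting_times_def)
  then have "circle_path \<epsilon> \<omega> \<le> \<tau>"
    unfolding circle_path_def by (rule cInf_lower[OF _ hitting_times_bdd_below])
  moreover have "real q / cos \<omega> \<le> y" using q c by (simp add: pos_divide_le_eq)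
  ultimately show ?thesis using s r unfolding \<tau>_def by linarith
qed

lemma circle_path_less:
  assumes \<omega>: "0 \<le> \<omega>" "\<omega> \<le> pi/4" and \<epsilon>: "0 < \<epsilon>" "\<epsilon> < 1/2" and y: "circle_path \<epsilon> \<omega> < y"
  shows "tan \<omega> \<in> approx_within (\<epsilon> / cos \<omega>) ((y + 2 * \<epsilon>) * cos \<omega>)"
proof -
  have c: "cos \<omega> > 0" by (rule cos_pos_angle[OF \<omega>])
  obtain \<tau> where "\<tau> \<in> hitting_times (circle_scatterer \<epsilon> + nonzero_lattice) \<omega>" and \<tau>: "\<tau> < y"
    using cInf_lessD[OF circle_hitting_times_nonempty[OF \<epsilon> \<omega>]] y unfolding circle_path_def by blast
  then have pos: "\<tau> > 0" and "(\<tau> * cos \<omega>, \<tau> * sin \<omega>) \<in> circle_scatterer \<epsilon> + nonzero_lattice"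
    by (auto simp: hitting_times_def)
  then obtain u v k h where kh: "u\<^sup>2 + v\<^sup>2 = \<epsilon>\<^sup>2" "(k, h) \<in> nonzero_lattice" "\<tau> * cos \<omega> = u + k" "\<tau> * sin \<omega> = v + h"
    by (auto simp: circle_scatterer_def elim!: set_plus_elim)
  then obtain q a :: int where qa: "k = of_int q" "h = of_int a" "(q, a) \<noteq> (0, 0)"
    by (auto simp: nonzero_lattice_def elim!: Ints_cases)
  define d where "d = of_int q * sin \<omega> - of_int a * cos \<omega>"
  define s where "s = of_int q * cos \<omega> + of_int a * sin \<omega>"
  have "(\<tau> - s)\<^sup>2 + d\<^sup>2 = (\<tau> * cos \<omega> - of_int q)\<^sup>2 + (\<tau> * sin \<omega> - of_int a)\<^sup>2"
    unfolding d_def s_def by (rule circle_decomposition(1)[symmetric])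
  also have "\<dots> = \<epsilon>\<^sup>2" using kh qa by simp
  finally have "(\<tau> - s)\<^sup>2 + d\<^sup>2 = \<epsilon>\<^sup>2" .
  then have "(\<tau> - s)\<^sup>2 \<le> \<epsilon>\<^sup>2" "d\<^sup>2 \<le> \<epsilon>\<^sup>2" "u\<^sup>2 \<le> \<epsilon>\<^sup>2" "v\<^sup>2 \<le> \<epsilon>\<^sup>2" using kh(1)
    by (smt (verit) zero_le_power2)+
  then have b: "\<bar>\<tau> - s\<bar> \<le> \<epsilon>" "\<bar>d\<bar> \<le> \<epsilon>" "\<bar>u\<bar> \<le> \<epsilon>" "\<bar>v\<bar> \<le> \<epsilon>"
    using \<epsilon> by (simp_all add: abs_le_square_iff[symmetric])
  have q: "1 \<le> q"
    using first_quadrant_lattice_point[OF \<omega> \<epsilon> pos, of q a] kh qa b by simp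
  have qs: "of_int q / cos \<omega> = s + d * tan \<omega>"
    unfolding d_def s_def using circle_decomposition(2)[of \<omega> "of_int q" "of_int a"] c by simp
  have "\<bar>d * tan \<omega>\<bar> \<le> \<epsilon> * 1" unfolding abs_mult
    using b tan_le_1_angle[OF \<omega>] \<epsilon> by (intro mult_mono) auto
  then have "of_int q / cos \<omega> \<le> y + 2 * \<epsilon>" using qs b \<tau> by linarith
  then have "real (nat q) \<le> (y + 2 * \<epsilon>) * cos \<omega>" using c q by (simp add: pos_divide_le_eq)
  moreover have "\<bar>real (nat q) * tan \<omega> - of_int a\<bar> \<le> \<epsilon> / cos \<omega>"
  proof -
    have "real (nat q) * tan \<omega> - of_int a = d / cos \<omega>" using c q by (simp add: d_def tan_def field_simps)
    then show ?thesis using b c by (simp add: divide_right_mono)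
  qed
  moreover have "1 \<le> nat q" using q by simp
  ultimately show ?thesis unfolding approx_within_def by blast
qed

lemma cross_path_le:
  assumes \<omega>: "0 \<le> \<omega>" "\<omega> \<le> pi/4" and \<epsilon>: "0 < \<epsilon>"
    and t: "tan \<omega> \<in> approx_within \<epsilon> (y * cos \<omega>)"
  shows "cross_path \<epsilon> \<omega> \<le> y"
proof -
  obtain q :: nat and a :: int where q: "1 \<le> q" "real q \<le> y * cos \<omega>" and a: "\<bar>real q * tan \<omega> - of_int a\<bar> \<le> \<epsilon>"
    using t by (auto simp: approx_within_def)
  have c: "cos \<omega> > 0" by (rule cos_pos_angle[OF \<omega>])
  let ?\<tau> = "real q / cos \<omega>"
  have "(0, real q * tan \<omega> - of_int a) + (real q, of_int a) \<in> cross_scatterer \<epsilon> + nonzero_lattice"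
    using q a by (intro set_plus_intro) (auto simp: cross_scatterer_def nonzero_lattice_def abs_le_iff)
  then have "?\<tau> \<in> hitting_times (cross_scatterer \<epsilon> + nonzero_lattice) \<omega>"
    using q c by (simp add: hitting_times_def tan_def)
  then have "cross_path \<epsilon> \<omega> \<le> ?\<tau>"
    unfolding cross_path_def by (rule cInf_lower[OF _ hitting_times_bdd_below])
  moreover have "?\<tau> \<le> y" using q c by (simp add: pos_divide_le_eq)
  ultimately show ?thesis by linarith
qed

text \<open>
  A hit of the horizontal arm at \<open>(q, a)\<close> with offset \<open>u\<close> entails \<open>\<bar>q tan \<omega> - a\<bar> = \<bar>u\<bar> tan \<omega> \<le> \<epsilon>\<close>, so it counts
  as a hit of the vertical arm up to \<open>\<epsilon>\<close> in time.
\<close>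

lemma cross_path_less:
  assumes \<omega>: "0 \<le> \<omega>" "\<omega> \<le> pi/4" and \<epsilon>: "0 < \<epsilon>" "\<epsilon> < 1/2" and y: "cross_path \<epsilon> \<omega> < y"
  shows "tan \<omega> \<in> approx_within \<epsilon> (y * cos \<omega> + \<epsilon>)"
proof -
  have c: "cos \<omega> > 0" by (rule cos_pos_angle[OF \<omega>])
  obtain \<tau> where "\<tau> \<in> hitting_times (cross_scatterer \<epsilon> + nonzero_lattice) \<omega>" and \<tau>: "\<tau> < y"
    using cInf_lessD[OF cross_hitting_times_nonempty[OF \<epsilon>(1) \<omega>]] y unfolding cross_path_def by blast
  then have pos: "\<tau> > 0" and "(\<tau> * cos \<omega>, \<tau> * sin \<omega>) \<in> cross_scatterer \<epsilon> + nonzero_lattice"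
    by (auto simp: hitting_times_def)
  then obtain u v k h where kh: "(u, v) \<in> cross_scatterer \<epsilon>" "(k, h) \<in> nonzero_lattice" "\<tau> * cos \<omega> = u + k" "\<tau> * sin \<omega> = v + h"
    by (auto elim!: set_plus_elim)
  then obtain q a :: int where qa: "k = of_int q" "h = of_int a" "(q, a) \<noteq> (0, 0)"
    by (auto simp: nonzero_lattice_def elim!: Ints_cases)
  have uv: "\<bar>u\<bar> \<le> \<epsilon>" "\<bar>v\<bar> \<le> \<epsilon>" "u = 0 \<or> v = 0"
    using kh(1) \<epsilon> by (auto simp: cross_scatterer_def)
  have q: "1 \<le> q"
    using first_quadrant_lattice_point[OF \<omega> \<epsilon> pos, of q a] kh qa uv by simp
  have "of_int q * tan \<omega> - of_int a = v - u * tan \<omega>"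
  proof -
    have "\<tau> * sin \<omega> = (\<tau> * cos \<omega>) * tan \<omega>" using c by (simp add: tan_def)
    then show ?thesis using kh qa by (simp add: algebra_simps)
  qed
  moreover have "\<bar>u * tan \<omega>\<bar> \<le> \<epsilon> * 1" unfolding abs_mult
    using uv tan_le_1_angle[OF \<omega>] \<epsilon> by (intro mult_mono) auto
  ultimately have "\<bar>of_int q * tan \<omega> - of_int a\<bar> \<le> \<epsilon>" using uv by auto
  moreover have "\<tau> * cos \<omega> \<le> y * cos \<omega>" using \<tau> c by simp
  then have "of_int q \<le> y * cos \<omega> + \<epsilon>" using kh(3) uv qa by linarith
  moreover have "1 \<le> nat q" "real (nat q) = of_int q" using q by auto
  ultimately show ?thesis unfolding approx_within_def
    by (intro CollectI exI[of _ "nat q"]) auto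
qed

section \<open>From slopes to directions\<close>

lemma tan_borel_measurable: "(tan :: real \<Rightarrow> real) \<in> borel_measurable borel"
  unfolding tan_def[abs_def] by (intro borel_measurable_divide borel_measurable_continuous_onI continuous_intros)

lemma Int_Icc_fmeasurable: "E \<in> sets borel \<Longrightarrow> E \<inter> {a..b::real} \<in> fmeasurable lborel"
  by (rule fmeasurableI2[OF Icc_fmeasurable[of a b]]) auto

lemma measure_tan_vimage:
  assumes ab: "0 \<le> a" "a < b" "b \<le> pi/4" and T: "T \<in> sets borel"
  shows "(cos b)\<^sup>2 * measure lborel (T \<inter> {tan a..tan b}) \<le> measure lborel (tan -` T \<inter> {a..b})"
    and "measure lborel (tan -` T \<inter> {a..b}) \<le> (cos a)\<^sup>2 * measure lborel (T \<inter> {tan a..tan b})"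
proof -
  let ?X = "tan -` T \<inter> {a..b}" and ?Y = "T \<inter> {tan a..tan b}"
  have cos: "0 < cos b" "cos b \<le> cos x" "cos x \<le> cos a" "0 < cos x" if "x \<in> {a..b}" for x
  proof -
    show "0 < cos b" using ab by (intro cos_pos_angle) auto
    show "cos b \<le> cos x" "cos x \<le> cos a" using that ab pi_gt_zero
      by (auto intro!: cos_monotone_0_pi_le)
    then show "0 < cos x" using \<open>0 < cos b\<close> by linarith
  qed
  have inv: "inverse ((cos x)\<^sup>2) \<le> inverse ((cos b)\<^sup>2)" "inverse ((cos a)\<^sup>2) \<le> inverse ((cos x)\<^sup>2)" if "x \<in> {a..b}" for x
    using cos[OF that] by (auto intro!: le_imp_inverse_le power_mono)
  have "tan -` T \<in> sets borel" using measurable_sets[OF tan_borel_measurable T] by simp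
  then have X: "?X \<in> fmeasurable lborel" and Xb: "?X \<in> sets lborel" by (auto intro: Int_Icc_fmeasurable)
  have Y: "?Y \<in> fmeasurable lborel" by (rule Int_Icc_fmeasurable[OF T])
  have e: "emeasure lborel ?X = ennreal (measure lborel ?X)" "emeasure lborel ?Y = ennreal (measure lborel ?Y)"
    using X Y by (auto intro!: emeasure_eq_measure2)
  have "emeasure lborel ?Y = (\<integral>\<^sup>+x. indicator T x * indicator {tan a..tan b} x \<partial>lborel)"
    using Y by (subst nn_integral_indicator[symmetric])
      (auto intro!: nn_integral_cong split: split_indicator)
  also have "\<dots> = (\<integral>\<^sup>+x. indicator T (tan x) * ennreal (inverse ((cos x)\<^sup>2)) * indicator {a..b} x \<partial>lborel)"
  proof (rule nn_integral_substitution_aux)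
    show "(tan has_real_derivative inverse ((cos x)\<^sup>2)) (at x)" if "x \<in> {a..b}" for x
      using cos(4)[OF that] by (intro DERIV_tan) auto
    show "continuous_on {a..b} (\<lambda>x. inverse ((cos x)\<^sup>2))"
      using cos(4) by (intro continuous_intros) fastforce
  qed (use ab T in auto)
  finally have eq: "ennreal (measure lborel ?Y) = (\<integral>\<^sup>+x. indicator T (tan x) * ennreal (inverse ((cos x)\<^sup>2)) * indicator {a..b} x \<partial>lborel)"
    by (simp add: e)
  have "ennreal (measure lborel ?Y) \<le> (\<integral>\<^sup>+x. ennreal (inverse ((cos b)\<^sup>2)) * indicator ?X x \<partial>lborel)"
    unfolding eq using inv
    by (intro nn_integral_mono) (auto split: split_indicator intro!: ennreal_leI)
  also have "\<dots> = ennreal (inverse ((cos b)\<^sup>2) * measure lborel ?X)"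
    using Xb by (simp add: nn_integral_cmult_indicator e ennreal_mult)
  finally have "measure lborel ?Y \<le> inverse ((cos b)\<^sup>2) * measure lborel ?X"
    by (subst (asm) ennreal_le_iff) auto
  then show "(cos b)\<^sup>2 * measure lborel ?Y \<le> measure lborel ?X"
    using cos(1)[of a] ab by (simp add: field_simps)
  have "ennreal (inverse ((cos a)\<^sup>2) * measure lborel ?X) = (\<integral>\<^sup>+x. ennreal (inverse ((cos a)\<^sup>2)) * indicator ?X x \<partial>lborel)"
    using Xb by (simp add: nn_integral_cmult_indicator e ennreal_mult)
  also have "\<dots> \<le> ennreal (measure lborel ?Y)"
    unfolding eq using inv
    by (intro nn_integral_mono) (auto split: split_indicator intro!: ennreal_leI)
  finally have "inverse ((cos a)\<^sup>2) * measure lborel ?X \<le> measure lborel ?Y"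
    by (subst (asm) ennreal_le_iff) auto
  then show "measure lborel ?X \<le> (cos a)\<^sup>2 * measure lborel ?Y"
    using cos(4)[of a] ab by (simp add: field_simps)
qed

lemma cos_block_bounds:
  assumes ab: "0 \<le> a" "a < b" "b \<le> pi/4"
  shows "1/2 \<le> cos b" "cos b < cos a" "cos a \<le> 1" "cos a - cos b \<le> b - a"
proof -
  have "sqrt 2 / 2 \<le> cos b"
    using cos_monotone_0_pi_le[of b "pi/4"] ab by (simp add: cos_45)
  moreover have "1 \<le> sqrt (2::real)" by simp
  ultimately show "1/2 \<le> cos b" by linarith
  show "cos b < cos a" using ab pi_gt_zero by (intro cos_monotone_0_pi) auto
  show "cos a \<le> 1" by simp
  have "\<exists>z. a < z \<and> z < b \<and> cos b - cos a = (b - a) * (- sin z)"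
    using ab(2) by (intro MVT2) (auto intro!: derivative_eq_intros)
  then obtain z where z: "cos b - cos a = (b - a) * (- sin z)" by blast
  have "(b - a) * sin z \<le> (b - a) * 1" using ab by (intro mult_left_mono) auto
  then show "cos a - cos b \<le> b - a" using z by simp
qed

text \<open>
  On a short interval \<open>[a, b]\<close> the event \<open>E \<epsilon>\<close> is squeezed between two events that are expressed
  through approximations to \<open>tan \<omega>\<close> with constants \<open>\<delta>1\<close>, \<open>\<delta>2\<close>, \<open>U\<close>, \<open>L\<close> not depending on \<open>\<omega>\<close>. Their measures converge, and the distortion caused by the
  tangent is between \<open>(cos b)\<^sup>2\<close> and \<open>(cos a)\<^sup>2\<close>. As \<open>limit_cdf\<close> is Lipschitz, the two bounds agree up to
  \<open>O(b - a)\<close>, relative to the length.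
\<close>

theorem directions_tendsto:
  fixes E :: "real \<Rightarrow> real set" and K :: "real \<Rightarrow> real"
  assumes E: "\<And>\<epsilon>. E \<epsilon> \<in> sets borel" and K: "continuous_on {0..pi/4} K" and C: "C \<ge> 0"
    and blocks: "\<And>a b. 0 \<le> a \<Longrightarrow> a < b \<Longrightarrow> b \<le> pi/4 \<Longrightarrow> \<exists>U L \<delta>1 \<delta>2.
      filterlim \<delta>1 (at_right 0) (at_right 0) \<and> filterlim \<delta>2 (at_right 0) (at_right 0) \<and>
      (\<forall>\<omega>\<in>{a..b}. \<bar>U - K \<omega>\<bar> \<le> C * (b - a) \<and> \<bar>L - K \<omega>\<bar> \<le> C * (b - a)) \<and>
      (\<forall>\<^sub>F \<epsilon> in at_right 0. \<forall>\<omega>\<in>{a..b}.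
         (\<omega> \<in> E \<epsilon> \<longrightarrow> tan \<omega> \<in> approx_within (\<delta>1 \<epsilon>) (U / \<delta>1 \<epsilon>)) \<and>
         (tan \<omega> \<in> approx_within (\<delta>2 \<epsilon>) (L / \<delta>2 \<epsilon>) \<longrightarrow> \<omega> \<in> E \<epsilon>))"
    and \<alpha>\<beta>: "0 \<le> \<alpha>" "\<alpha> \<le> \<beta>" "\<beta> \<le> pi/4"
  shows "((\<lambda>\<epsilon>. measure lborel (E \<epsilon> \<inter> {\<alpha>..\<beta>})) \<longlongrightarrow> integral {\<alpha>..\<beta>} (\<lambda>\<omega>. limit_cdf (K \<omega>))) (at_right 0)"
proof -
  define G where "G \<epsilon> y = measure lborel (E \<epsilon> \<inter> {\<alpha>..y})" for \<epsilon> y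
  define H where "H y = integral {\<alpha>..y} (\<lambda>\<omega>. limit_cdf (K \<omega>))" for y
  note lip = limit_cdf_lipschitz
  have cont: "continuous_on {0..pi/4} (\<lambda>\<omega>. limit_cdf (K \<omega>))"
    by (rule continuous_on_compose2[OF continuous_on_limit_cdf K]) auto
  have int: "(\<lambda>\<omega>. limit_cdf (K \<omega>)) integrable_on {a..b}" if "0 \<le> a" "b \<le> pi/4" for a b
    using that by (intro integrable_continuous_interval continuous_on_subset[OF cont]) auto
  have null: "E \<epsilon> \<inter> {y} \<in> null_sets lborel" for \<epsilon> y
    by (rule null_sets_subset[of "{y}"]) (use E in auto)
  have "((\<lambda>\<epsilon>. G \<epsilon> \<beta> - G \<epsilon> \<alpha>) \<longlongrightarrow> H \<beta> - H \<alpha>) (at_right 0)"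
  proof (rule local_to_global[OF \<alpha>\<beta>(2)])
    fix \<eta> :: real assume \<eta>: "\<eta> > 0"
    \<comment> \<open>The total relative error on an interval of length \<open>h\<close> is \<open>(2 C + 8) h\<close>; the extra \<open>1\<close> makes the
      final inequality strict.\<close>
    define d where "d = \<eta> / (2 * C + 9)"
    have d: "d > 0" using \<eta> C by (simp add: d_def)
    show "\<exists>d>0. \<forall>y\<ge>\<alpha>. \<forall>y'\<le>\<beta>. y < y' \<and> y' - y < d \<longrightarrow>
      (\<forall>\<^sub>F \<epsilon> in at_right 0. \<bar>(G \<epsilon> y' - G \<epsilon> y) - (H y' - H y)\<bar> \<le> \<eta> * (y' - y))"
    proof (intro exI[of _ d] conjI d allI impI; elim conjE)
      fix a b assume y: "\<alpha> \<le> a" "b \<le> \<beta>" "a < b" "b - a < d"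
      have ab: "0 \<le> a" "a < b" "b \<le> pi/4" using y \<alpha>\<beta> by auto
      define h where "h = b - a"
      have h: "h > 0" using ab by (simp add: h_def)
      note cb = cos_block_bounds[OF ab]
      have "(2 * C + 9) * h < \<eta>" using y C unfolding d_def h_def by (simp add: pos_less_divide_eq mult.commute)
      then have small: "(2 * C + 8) * h < \<eta>" using h by (simp add: algebra_simps)
      from blocks[OF ab] obtain U L \<delta>1 \<delta>2 where
        \<delta>: "filterlim \<delta>1 (at_right 0) (at_right 0)" "filterlim \<delta>2 (at_right 0) (at_right 0)"
        and UL: "\<And>\<omega>. \<omega> \<in> {a..b} \<Longrightarrow> \<bar>U - K \<omega>\<bar> \<le> C * h \<and> \<bar>L - K \<omega>\<bar> \<le> C * h"
        and ev: "\<forall>\<^sub>F \<epsilon> in at_right 0. \<forall>\<omega>\<in>{a..b}.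
         (\<omega> \<in> E \<epsilon> \<longrightarrow> tan \<omega> \<in> approx_within (\<delta>1 \<epsilon>) (U / \<delta>1 \<epsilon>)) \<and>
         (tan \<omega> \<in> approx_within (\<delta>2 \<epsilon>) (L / \<delta>2 \<epsilon>) \<longrightarrow> \<omega> \<in> E \<epsilon>)"
        unfolding h_def by blast
      define w where "w = tan b - tan a"
      have tans: "0 \<le> tan a" "tan a \<le> tan b" "tan b \<le> 1"
        using tan_le_1_angle[of a] tan_le_1_angle[of b] ab pi_gt_zero by (auto intro!: tan_mono_le)
      have w: "(cos b)\<^sup>2 * w \<le> h" "h \<le> (cos a)\<^sup>2 * w"
        using measure_tan_vimage[OF ab, of UNIV] tans ab by (auto simp: w_def h_def)
      have w0: "0 \<le> w" using tans by (simp add: w_def)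
      \<comment> \<open>The distortion of lengths by the tangent on an interval of length \<open>h\<close> is a factor \<open>1 + O(h)\<close>.\<close>
      have sq: "(cos a)\<^sup>2 \<le> (cos b)\<^sup>2 * (1 + 8 * h)"
      proof -
        have "(cos a)\<^sup>2 - (cos b)\<^sup>2 = (cos a - cos b) * (cos a + cos b)" by (simp add: power2_eq_square algebra_simps)
        also have "\<dots> \<le> h * 2"
        proof (rule mult_mono)
          show "cos a + cos b \<le> 2" using cos_le_one[of a] cos_le_one[of b] by linarith
        qed (use cb h in \<open>auto simp: h_def\<close>)
        also have "\<dots> \<le> 8 * h * (cos b)\<^sup>2"
        proof -
          have "(1/2)\<^sup>2 \<le> (cos b)\<^sup>2" using cb by (intro power_mono) auto
          then have "8 * h * (1/2)\<^sup>2 \<le> 8 * h * (cos b)\<^sup>2" using h by (intro mult_left_mono) auto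
          then show ?thesis by (simp add: power2_eq_square)
        qed
        finally show ?thesis by (simp add: algebra_simps)
      qed
      have upper_w: "(cos a)\<^sup>2 * w \<le> h * (1 + 8 * h)"
      proof -
        have "(cos a)\<^sup>2 * w \<le> (cos b)\<^sup>2 * (1 + 8 * h) * w" using sq w0 by (rule mult_right_mono)
        also have "\<dots> = ((cos b)\<^sup>2 * w) * (1 + 8 * h)" by simp
        also have "\<dots> \<le> h * (1 + 8 * h)" using w h by (intro mult_right_mono) auto
        finally show ?thesis .
      qed
      have lower_w: "h * (1 - 8 * h) \<le> (cos b)\<^sup>2 * w"
      proof (cases "8 * h \<le> 1")
        case True
        have "h * (1 - 8 * h) \<le> ((cos a)\<^sup>2 * w) * (1 - 8 * h)" using w True by (intro mult_right_mono) auto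
        also have "\<dots> \<le> ((cos b)\<^sup>2 * (1 + 8 * h) * w) * (1 - 8 * h)"
          using sq w0 True by (intro mult_right_mono) auto
        also have "\<dots> = ((cos b)\<^sup>2 * w) * (1 - (8 * h)\<^sup>2)" by (simp add: power2_eq_square algebra_simps)
        also have "\<dots> \<le> ((cos b)\<^sup>2 * w) * 1" using w0 by (intro mult_left_mono) auto
        finally show ?thesis by simp
      next
        case False
        then have "h * (1 - 8 * h) \<le> 0" using h by (intro mult_nonneg_nonpos) auto
        moreover have "0 \<le> (cos b)\<^sup>2 * w" using w0 by simp
        ultimately show ?thesis by linarith
      qed
      have H: "H b - H a = integral {a..b} (\<lambda>\<omega>. limit_cdf (K \<omega>))"
        using Henstock_Kurzweil_Integration.integral_combine[of \<alpha> a b "\<lambda>\<omega>. limit_cdf (K \<omega>)"] int[of \<alpha> b] y \<alpha>\<beta>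
        by (simp add: H_def)
      have I1: "h * (limit_cdf U - 2 * C * h) \<le> H b - H a"
      proof -
        have "integral {a..b} (\<lambda>\<omega>. limit_cdf U - 2 * C * h) \<le> integral {a..b} (\<lambda>\<omega>. limit_cdf (K \<omega>))"
        proof (intro integral_le int ab integrable_const_ivl)
          fix \<omega> assume \<omega>: "\<omega> \<in> {a..b}"
          show "limit_cdf U - 2 * C * h \<le> limit_cdf (K \<omega>)" using order.trans[OF lip mult_left_mono[OF conjunct1[OF UL[OF \<omega>]], of 2]] by (simp add: mult.assoc abs_le_iff)
        qed
        then show ?thesis using ab by (simp add: H h_def)
      qed
      have I2: "H b - H a \<le> h * (limit_cdf L + 2 * C * h)"
      proof -
        have "integral {a..b} (\<lambda>\<omega>. limit_cdf (K \<omega>)) \<le> integral {a..b} (\<lambda>\<omega>. limit_cdf L + 2 * C * h)"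
        proof (intro integral_le int ab integrable_const_ivl)
          fix \<omega> assume \<omega>: "\<omega> \<in> {a..b}"
          show "limit_cdf (K \<omega>) \<le> limit_cdf L + 2 * C * h" using order.trans[OF lip mult_left_mono[OF conjunct2[OF UL[OF \<omega>]], of 2]] by (simp add: mult.assoc abs_le_iff)
        qed
        then show ?thesis using ab by (simp add: H h_def)
      qed
      have strict: "h * ((2 * C + 8) * h) < \<eta> * h" using small h by (simp add: mult.commute)
      have lim: "((\<lambda>\<epsilon>. measure lborel (approx_within (\<delta>i \<epsilon>) (V / \<delta>i \<epsilon>) \<inter> {tan a..tan b})) \<longlongrightarrow> w * limit_cdf V) (at_right 0)"
        if "filterlim \<delta>i (at_right 0) (at_right 0)" for \<delta>i V
        unfolding w_def by (rule filterlim_compose[OF measure_approx_within_tendsto[OF tans] that])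
      have up_lim: "(cos a)\<^sup>2 * (w * limit_cdf U) < (H b - H a) + \<eta> * h"
      proof -
        have "((cos a)\<^sup>2 * w) * limit_cdf U \<le> (h * (1 + 8 * h)) * limit_cdf U"
          using upper_w limit_cdf_bounds by (intro mult_right_mono)
        also have "\<dots> = h * limit_cdf U + (8 * h * h) * limit_cdf U" by (simp add: algebra_simps)
        also have "\<dots> \<le> h * limit_cdf U + (8 * h * h) * 1"
          using limit_cdf_bounds h by (intro add_left_mono mult_left_mono) auto
        also have "\<dots> = h * (limit_cdf U - 2 * C * h) + h * ((2 * C + 8) * h)" by (simp add: algebra_simps)
        finally show ?thesis using I1 strict by (simp add: mult.assoc)
      qed
      have low_lim: "(H b - H a) - \<eta> * h < (cos b)\<^sup>2 * (w * limit_cdf L)"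
      proof -
        have "h * (limit_cdf L + 2 * C * h) - h * ((2 * C + 8) * h) = h * limit_cdf L - (8 * h * h) * 1" by (simp add: algebra_simps)
        also have "\<dots> \<le> h * limit_cdf L - (8 * h * h) * limit_cdf L"
          using limit_cdf_bounds h by (intro diff_left_mono mult_left_mono) auto
        also have "\<dots> = (h * (1 - 8 * h)) * limit_cdf L" by (simp add: algebra_simps)
        also have "\<dots> \<le> ((cos b)\<^sup>2 * w) * limit_cdf L"
          using lower_w limit_cdf_bounds by (intro mult_right_mono)
        finally show ?thesis using I2 strict by (simp add: mult.assoc)
      qed
      have "\<forall>\<^sub>F \<epsilon> in at_right 0. (cos a)\<^sup>2 * measure lborel (approx_within (\<delta>1 \<epsilon>) (U / \<delta>1 \<epsilon>) \<inter> {tan a..tan b}) < (H b - H a) + \<eta> * h"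
        by (rule order_tendstoD(2)[OF tendsto_mult_left[OF lim[OF \<delta>(1)]] up_lim])
      moreover have "\<forall>\<^sub>F \<epsilon> in at_right 0. (H b - H a) - \<eta> * h < (cos b)\<^sup>2 * measure lborel (approx_within (\<delta>2 \<epsilon>) (L / \<delta>2 \<epsilon>) \<inter> {tan a..tan b})"
        by (rule order_tendstoD(1)[OF tendsto_mult_left[OF lim[OF \<delta>(2)]] low_lim])
      ultimately show "\<forall>\<^sub>F \<epsilon> in at_right 0. \<bar>(G \<epsilon> b - G \<epsilon> a) - (H b - H a)\<bar> \<le> \<eta> * (b - a)"
        using ev
      proof eventually_elim
        case (elim \<epsilon>)
        let ?T1 = "approx_within (\<delta>1 \<epsilon>) (U / \<delta>1 \<epsilon>)" and ?T2 = "approx_within (\<delta>2 \<epsilon>) (L / \<delta>2 \<epsilon>)"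
        have vm: "tan -` T \<inter> {a..b} \<in> fmeasurable lborel" if "T \<in> sets borel" for T
          using measurable_sets[OF tan_borel_measurable that] by (intro Int_Icc_fmeasurable) simp
        have "measure lborel (E \<epsilon> \<inter> {a..b}) \<le> measure lborel (tan -` ?T1 \<inter> {a..b})"
          using elim(3) E vm[of ?T1] by (intro measure_mono_fmeasurable) auto
        also have "\<dots> \<le> (cos a)\<^sup>2 * measure lborel (?T1 \<inter> {tan a..tan b})"
          by (rule measure_tan_vimage(2)[OF ab]) simp
        finally have 1: "measure lborel (E \<epsilon> \<inter> {a..b}) \<le> (H b - H a) + \<eta> * h" using elim(1) by linarith
        have "(cos b)\<^sup>2 * measure lborel (?T2 \<inter> {tan a..tan b}) \<le> measure lborel (tan -` ?T2 \<inter> {a..b})"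
          by (rule measure_tan_vimage(1)[OF ab]) simp
        also have "\<dots> \<le> measure lborel (E \<epsilon> \<inter> {a..b})"
          using elim(3) E vm[of ?T2] Int_Icc_fmeasurable[OF E] by (intro measure_mono_fmeasurable) (auto simp: fmeasurableD)
        finally have 2: "(H b - H a) - \<eta> * h \<le> measure lborel (E \<epsilon> \<inter> {a..b})" using elim(2) by linarith
        have "G \<epsilon> b - G \<epsilon> a = measure lborel (E \<epsilon> \<inter> {a..b})"
        proof -
          have f: "E \<epsilon> \<inter> {a<..b} \<in> fmeasurable lborel" "E \<epsilon> \<inter> {\<alpha>..a} \<in> fmeasurable lborel"
            using E[of \<epsilon>] by (auto intro!: fmeasurableI2[OF Icc_fmeasurable[of a b]] Int_Icc_fmeasurable)
          have "E \<epsilon> \<inter> {\<alpha>..b} = (E \<epsilon> \<inter> {\<alpha>..a}) \<union> (E \<epsilon> \<inter> {a<..b})" using y ab by auto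
          then have "G \<epsilon> b = G \<epsilon> a + measure lborel (E \<epsilon> \<inter> {a<..b})"
            unfolding G_def using f by (simp only:) (intro measure_Union, auto simp: fmeasurable_def less_top[symmetric])
          moreover have "E \<epsilon> \<inter> {a..b} = (E \<epsilon> \<inter> {a<..b}) \<union> (E \<epsilon> \<inter> {a})" using ab by auto
          then have "measure lborel (E \<epsilon> \<inter> {a..b}) = measure lborel (E \<epsilon> \<inter> {a<..b})"
            using f null by (simp only:) (intro measure_Un_null_set, auto)
          ultimately show ?thesis by simp
        qed
        then show ?case using 1 2 by (simp add: h_def abs_le_iff)
      qed
    qed
  qed
  moreover have "G \<epsilon> \<alpha> = 0" for \<epsilon>
    using null[of \<epsilon> \<alpha>] by (simp add: G_def null_sets_def measure_def)
  moreover have "H \<alpha> = 0" by (simp add: H_def)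
  ultimately show ?thesis by (simp add: G_def H_def)
qed

lemma scaled_at_right: "c > 0 \<Longrightarrow> filterlim (\<lambda>\<epsilon>. \<epsilon> / c) (at_right 0) (at_right (0::real))"
  by (auto simp: filterlim_at intro!: tendsto_eq_intros eventually_mono[OF eventually_at_right_less])

text \<open>
  Only \<open>x cos \<omega>\<close> varies with the direction. The term \<open>b - a\<close> in the upper constant absorbs the error \<open>2 \<epsilon>\<^sup>2\<close>.
\<close>

theorem cross_directions_tendsto:
  assumes x: "x \<ge> 0" and \<alpha>\<beta>: "0 \<le> \<alpha>" "\<alpha> \<le> \<beta>" "\<beta> \<le> pi/4"
  shows "((\<lambda>\<epsilon>. measure lborel ({\<omega>. \<epsilon> * cross_path \<epsilon> \<omega> \<le> x} \<inter> {\<alpha>..\<beta>}))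
    \<longlongrightarrow> integral {\<alpha>..\<beta>} (\<lambda>\<omega>. limit_cdf (x * cos \<omega>))) (at_right 0)"
proof (rule directions_tendsto[OF _ _ _ _ \<alpha>\<beta>, where C = "x + 1"])
  show "{\<omega>. \<epsilon> * cross_path \<epsilon> \<omega> \<le> x} \<in> sets borel" for \<epsilon> by measurable
  show "continuous_on {0..pi/4} (\<lambda>\<omega>. x * cos \<omega>)" by (intro continuous_intros)
  fix a b :: real assume ab: "0 \<le> a" "a < b" "b \<le> pi/4"
  note cb = cos_block_bounds[OF ab]
  have mono: "cos b \<le> cos \<omega>" "cos \<omega> \<le> cos a" if "\<omega> \<in> {a..b}" for \<omega>
    using that ab pi_gt_zero by (auto intro!: cos_monotone_0_pi_le)
  have id: "filterlim (\<lambda>\<epsilon>. \<epsilon>) (at_right 0) (at_right (0::real))" by (rule filterlim_ident)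
  have "((\<lambda>\<epsilon>::real. 2 * \<epsilon> * \<epsilon>) \<longlongrightarrow> 2 * 0 * 0) (at_right 0)" by (intro tendsto_intros)
  then have small: "\<forall>\<^sub>F \<epsilon>::real in at_right 0. 2 * \<epsilon> * \<epsilon> < b - a" using ab by (intro order_tendstoD(2)) auto
  have pos: "\<forall>\<^sub>F \<epsilon>::real in at_right 0. 0 < \<epsilon>" by (rule eventually_at_right_less)
  have half: "\<forall>\<^sub>F \<epsilon>::real in at_right 0. \<epsilon> < 1/2" by (rule eventually_at_rightI[of 0 "1/2"]) auto
  have "\<forall>\<^sub>F \<epsilon> in at_right 0. \<forall>\<omega>\<in>{a..b}.
     (\<omega> \<in> {\<omega>. \<epsilon> * cross_path \<epsilon> \<omega> \<le> x} \<longrightarrow> tan \<omega> \<in> approx_within \<epsilon> ((x * cos a + (b - a)) / \<epsilon>)) \<and>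
     (tan \<omega> \<in> approx_within \<epsilon> ((x * cos b) / \<epsilon>) \<longrightarrow> \<omega> \<in> {\<omega>. \<epsilon> * cross_path \<epsilon> \<omega> \<le> x})"
    using small pos half
  proof eventually_elim
    case (elim \<epsilon>)
    show ?case
    proof (intro ballI conjI impI)
      fix \<omega> assume \<omega>: "\<omega> \<in> {a..b}"
      then have \<omega>': "0 \<le> \<omega>" "\<omega> \<le> pi/4" using ab by auto
      { assume "\<omega> \<in> {\<omega>. \<epsilon> * cross_path \<epsilon> \<omega> \<le> x}"
        then have "cross_path \<epsilon> \<omega> < x / \<epsilon> + \<epsilon>" using elim by (simp add: field_simps) (smt (verit) mult_pos_pos)
        from cross_path_less[OF \<omega>' elim(2,3) this]
        have "tan \<omega> \<in> approx_within \<epsilon> ((x / \<epsilon> + \<epsilon>) * cos \<omega> + \<epsilon>)" .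
        moreover have "(x / \<epsilon> + \<epsilon>) * cos \<omega> + \<epsilon> \<le> (x * cos a + (b - a)) / \<epsilon>"
        proof -
          have "\<epsilon> * ((x / \<epsilon> + \<epsilon>) * cos \<omega> + \<epsilon>) = x * cos \<omega> + \<epsilon> * \<epsilon> * cos \<omega> + \<epsilon> * \<epsilon>"
            using elim by (simp add: field_simps)
          also have "\<dots> \<le> x * cos a + \<epsilon> * \<epsilon> * 1 + \<epsilon> * \<epsilon>"
            using x mono[OF \<omega>] by (intro add_mono mult_left_mono order_refl) auto
          also have "\<dots> \<le> x * cos a + (b - a)" using elim by simp
          finally show ?thesis using elim by (simp add: pos_le_divide_eq mult.commute)
        qed
        ultimately show "tan \<omega> \<in> approx_within \<epsilon> ((x * cos a + (b - a)) / \<epsilon>)"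
          using approx_within_mono[OF order_refl] by blast }
      { assume t: "tan \<omega> \<in> approx_within \<epsilon> ((x * cos b) / \<epsilon>)"
        have "x * cos b / \<epsilon> \<le> x / \<epsilon> * cos \<omega>"
          using x mono[OF \<omega>] elim by (simp add: divide_right_mono mult_left_mono)
        then have "tan \<omega> \<in> approx_within \<epsilon> (x / \<epsilon> * cos \<omega>)"
          using t approx_within_mono[OF order_refl] by blast
        from cross_path_le[OF \<omega>' elim(2) this]
        show "\<omega> \<in> {\<omega>. \<epsilon> * cross_path \<epsilon> \<omega> \<le> x}" using elim by (simp add: field_simps) }
    qed
  qed
  moreover have "\<bar>(x * cos a + (b - a)) - x * cos \<omega>\<bar> \<le> (x + 1) * (b - a) \<and> \<bar>x * cos b - x * cos \<omega>\<bar> \<le> (x + 1) * (b - a)"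
    if "\<omega> \<in> {a..b}" for \<omega>
  proof -
    have "x * cos a - x * cos \<omega> \<le> x * (b - a)" "x * cos \<omega> - x * cos b \<le> x * (b - a)"
      using mono[OF that] cb x by (auto simp: right_diff_distrib[symmetric] intro!: mult_left_mono)
    moreover have "x * cos b \<le> x * cos \<omega>" "x * cos \<omega> \<le> x * cos a"
      using mono[OF that] x by (auto intro!: mult_left_mono)
    ultimately show ?thesis using ab by (simp add: distrib_right abs_le_iff)
  qed
  ultimately show "\<exists>U L \<delta>1 \<delta>2.
      filterlim \<delta>1 (at_right 0) (at_right 0) \<and> filterlim \<delta>2 (at_right 0) (at_right 0) \<and>
      (\<forall>\<omega>\<in>{a..b}. \<bar>U - x * cos \<omega>\<bar> \<le> (x + 1) * (b - a) \<and> \<bar>L - x * cos \<omega>\<bar> \<le> (x + 1) * (b - a)) \<and>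
      (\<forall>\<^sub>F \<epsilon> in at_right 0. \<forall>\<omega>\<in>{a..b}.
         (\<omega> \<in> {\<omega>. \<epsilon> * cross_path \<epsilon> \<omega> \<le> x} \<longrightarrow> tan \<omega> \<in> approx_within (\<delta>1 \<epsilon>) (U / \<delta>1 \<epsilon>)) \<and>
         (tan \<omega> \<in> approx_within (\<delta>2 \<epsilon>) (L / \<delta>2 \<epsilon>) \<longrightarrow> \<omega> \<in> {\<omega>. \<epsilon> * cross_path \<epsilon> \<omega> \<le> x}))"
    using id by (intro exI[of _ "x * cos a + (b - a)"] exI[of _ "x * cos b"] exI[of _ "\<lambda>\<epsilon>. \<epsilon>"]) blast
qed (use x in auto)

text \<open>
  Both the precision \<open>\<epsilon> / cos \<omega>\<close> and the range \<open>(x / \<epsilon>) cos \<omega>\<close> vary, but their product does not. Replacing \<open>cos \<omega>\<close> by its extreme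
  values on \<open>[a, b]\<close> costs a factor \<open>r = cos a / cos b\<close>, and \<open>r - 1 > 0\<close> absorbs the errors \<open>O(\<epsilon>\<^sup>2)\<close>.
\<close>

theorem circle_directions_tendsto:
  assumes x: "x \<ge> 0" and \<alpha>\<beta>: "0 \<le> \<alpha>" "\<alpha> \<le> \<beta>" "\<beta> \<le> pi/4"
  shows "((\<lambda>\<epsilon>. measure lborel ({\<omega>. \<epsilon> * circle_path \<epsilon> \<omega> \<le> x} \<inter> {\<alpha>..\<beta>}))
    \<longlongrightarrow> integral {\<alpha>..\<beta>} (\<lambda>\<omega>. limit_cdf x)) (at_right 0)"
proof (rule directions_tendsto[OF _ _ _ _ \<alpha>\<beta>, where C = "2 * (x + 1)"])
  show "{\<omega>. \<epsilon> * circle_path \<epsilon> \<omega> \<le> x} \<in> sets borel" for \<epsilon> by measurable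
  show "continuous_on {0..pi/4} (\<lambda>\<omega>. x)" by (intro continuous_intros)
  fix a b :: real assume ab: "0 \<le> a" "a < b" "b \<le> pi/4"
  note cb = cos_block_bounds[OF ab]
  define r where "r = cos a / cos b"
  define U where "U = x * r + (r - 1)"
  define L where "L = x / r - (1 - 1 / r)"
  have r: "r > 1" "r - 1 \<le> 2 * (b - a)"
  proof -
    show "r > 1" using cb by (simp add: r_def less_divide_eq)
    have "r - 1 = (cos a - cos b) / cos b" using cb by (simp add: r_def diff_divide_distrib)
    also have "\<dots> \<le> (b - a) / (1/2)" using cb by (intro frac_le) auto
    finally show "r - 1 \<le> 2 * (b - a)" by simp
  qed
  have mono: "cos b \<le> cos \<omega>" "cos \<omega> \<le> cos a" "cos \<omega> > 0" if "\<omega> \<in> {a..b}" for \<omega>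
  proof -
    show "cos b \<le> cos \<omega>" "cos \<omega> \<le> cos a"
      using that ab pi_gt_zero by (auto intro!: cos_monotone_0_pi_le)
    then show "cos \<omega> > 0" using cb by linarith
  qed
  have "((\<lambda>\<epsilon>::real. 3 * \<epsilon> * \<epsilon> * r) \<longlongrightarrow> 3 * 0 * 0 * r) (at_right 0)" by (intro tendsto_intros)
  then have small: "\<forall>\<^sub>F \<epsilon>::real in at_right 0. 3 * \<epsilon> * \<epsilon> * r < r - 1" using r by (intro order_tendstoD(2)) auto
  have pos: "\<forall>\<^sub>F \<epsilon>::real in at_right 0. 0 < \<epsilon>" by (rule eventually_at_right_less)
  have half: "\<forall>\<^sub>F \<epsilon>::real in at_right 0. \<epsilon> < 1/2" by (rule eventually_at_rightI[of 0 "1/2"]) auto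
  have "\<forall>\<^sub>F \<epsilon> in at_right 0. \<forall>\<omega>\<in>{a..b}.
     (\<omega> \<in> {\<omega>. \<epsilon> * circle_path \<epsilon> \<omega> \<le> x} \<longrightarrow> tan \<omega> \<in> approx_within (\<epsilon> / cos b) (U / (\<epsilon> / cos b))) \<and>
     (tan \<omega> \<in> approx_within (\<epsilon> / cos a) (L / (\<epsilon> / cos a)) \<longrightarrow> \<omega> \<in> {\<omega>. \<epsilon> * circle_path \<epsilon> \<omega> \<le> x})"
    using small pos half
  proof eventually_elim
    case (elim \<epsilon>)
    \<comment> \<open>The three error terms are \<open>\<epsilon>\<close> from the infimum and \<open>2 \<epsilon>\<close> from the shape of the circle; the converse
      inclusion needs only the latter.\<close>
    have e3: "2 * \<epsilon> * \<epsilon> < r - 1"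
    proof -
      have "\<epsilon> * \<epsilon> * 1 \<le> \<epsilon> * \<epsilon> * r" using r by (intro mult_left_mono) auto
      moreover have "0 < \<epsilon> * \<epsilon>" using elim by simp
      ultimately show ?thesis using elim(1) by linarith
    qed
    show ?case
    proof (intro ballI conjI impI)
      fix \<omega> assume \<omega>: "\<omega> \<in> {a..b}"
      then have \<omega>': "0 \<le> \<omega>" "\<omega> \<le> pi/4" using ab by auto
      { assume "\<omega> \<in> {\<omega>. \<epsilon> * circle_path \<epsilon> \<omega> \<le> x}"
        then have "circle_path \<epsilon> \<omega> < x / \<epsilon> + \<epsilon>" using elim by (simp add: field_simps) (smt (verit) mult_pos_pos)
        from circle_path_less[OF \<omega>' elim(2,3) this]
        have "tan \<omega> \<in> approx_within (\<epsilon> / cos \<omega>) ((x / \<epsilon> + \<epsilon> + 2 * \<epsilon>) * cos \<omega>)" .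
        moreover have "\<epsilon> / cos \<omega> \<le> \<epsilon> / cos b" using mono[OF \<omega>] cb elim by (intro divide_left_mono) auto
        moreover have "(x / \<epsilon> + \<epsilon> + 2 * \<epsilon>) * cos \<omega> \<le> U / (\<epsilon> / cos b)"
        proof -
          have "(x / \<epsilon> + \<epsilon> + 2 * \<epsilon>) * cos \<omega> \<le> (x / \<epsilon> + \<epsilon> + 2 * \<epsilon>) * cos a"
            using mono[OF \<omega>] x elim by (intro mult_left_mono add_nonneg_nonneg) auto
          also have "\<dots> = (x * r + 3 * \<epsilon> * \<epsilon> * r) / (\<epsilon> / cos b)"
            using elim cb by (simp add: r_def field_simps)
          also have "\<dots> \<le> U / (\<epsilon> / cos b)"
            using elim cb unfolding U_def by (intro divide_right_mono) auto
          finally show ?thesis .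
        qed
        ultimately show "tan \<omega> \<in> approx_within (\<epsilon> / cos b) (U / (\<epsilon> / cos b))"
          using approx_within_mono by blast }
      { assume t: "tan \<omega> \<in> approx_within (\<epsilon> / cos a) (L / (\<epsilon> / cos a))"
        have ca: "cos a > 0" using cb by linarith
        from t obtain q :: nat where "1 \<le> q" "real q \<le> L / (\<epsilon> / cos a)" by (auto simp: approx_within_def)
        then have "0 < L / (\<epsilon> / cos a)" by linarith
        moreover have "0 < \<epsilon> / cos a" using ca elim by simp
        ultimately have "0 < L" by (metis divide_nonpos_pos not_le)
        then have "0 < L * r" using r by simp
        moreover have Lr: "L * r = x - (r - 1)" using r by (simp add: L_def field_simps)
        ultimately have x2: "x > 2 * \<epsilon> * \<epsilon>" using e3 by linarith
        have "\<epsilon> / cos a \<le> \<epsilon> / cos \<omega>" using mono[OF \<omega>] elim by (intro divide_left_mono) auto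
        moreover have "L / (\<epsilon> / cos a) \<le> (x / \<epsilon> - 2 * \<epsilon>) * cos \<omega>"
        proof -
          have "L / (\<epsilon> / cos a) = (L * r) / \<epsilon> * cos b" using elim cb by (simp add: r_def)
          also have "\<dots> \<le> (x - 2 * \<epsilon> * \<epsilon>) / \<epsilon> * cos b"
            using Lr e3 elim cb by (intro mult_right_mono divide_right_mono) auto
          also have "\<dots> \<le> (x - 2 * \<epsilon> * \<epsilon>) / \<epsilon> * cos \<omega>"
            using x2 elim mono[OF \<omega>] by (intro mult_left_mono divide_nonneg_pos) auto
          also have "(x - 2 * \<epsilon> * \<epsilon>) / \<epsilon> = x / \<epsilon> - 2 * \<epsilon>" using elim by (simp add: diff_divide_distrib)
          finally show ?thesis .
        qed
        ultimately have "tan \<omega> \<in> approx_within (\<epsilon> / cos \<omega>) ((x / \<epsilon> - 2 * \<epsilon>) * cos \<omega>)"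
          using t approx_within_mono by blast
        from circle_path_le[OF \<omega>' elim(2,3) this]
        show "\<omega> \<in> {\<omega>. \<epsilon> * circle_path \<epsilon> \<omega> \<le> x}" using elim by (simp add: field_simps) }
    qed
  qed
  moreover have "\<bar>U - x\<bar> \<le> 2 * (x + 1) * (b - a)" "\<bar>L - x\<bar> \<le> 2 * (x + 1) * (b - a)"
  proof -
    have "U - x = (x + 1) * (r - 1)" by (simp add: U_def algebra_simps)
    moreover have *: "(x + 1) * (r - 1) \<le> (x + 1) * (2 * (b - a))" using r x by (intro mult_left_mono) auto
    moreover have "0 \<le> (x + 1) * (r - 1)" using r x by simp
    moreover have **: "(x + 1) * (2 * (b - a)) = 2 * (x + 1) * (b - a)" by (simp add: algebra_simps)
    ultimately show "\<bar>U - x\<bar> \<le> 2 * (x + 1) * (b - a)" by (simp only: abs_of_nonneg)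
    have "L - x = - ((x + 1) * (r - 1) / r)" using r by (simp add: L_def field_simps)
    moreover have "(x + 1) * (r - 1) / r \<le> (x + 1) * (r - 1) / 1" using r x by (intro divide_left_mono) auto
    moreover have "0 \<le> (x + 1) * (r - 1) / r" using r x by simp
    ultimately show "\<bar>L - x\<bar> \<le> 2 * (x + 1) * (b - a)"
      using * unfolding ** by simp
  qed
  moreover have "filterlim (\<lambda>\<epsilon>. \<epsilon> / cos b) (at_right 0) (at_right 0)" "filterlim (\<lambda>\<epsilon>. \<epsilon> / cos a) (at_right 0) (at_right 0)"
    using cb by (auto intro!: scaled_at_right)
  ultimately show "\<exists>U L \<delta>1 \<delta>2.
      filterlim \<delta>1 (at_right 0) (at_right 0) \<and> filterlim \<delta>2 (at_right 0) (at_right 0) \<and>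
      (\<forall>\<omega>\<in>{a..b}. \<bar>U - x\<bar> \<le> 2 * (x + 1) * (b - a) \<and> \<bar>L - x\<bar> \<le> 2 * (x + 1) * (b - a)) \<and>
      (\<forall>\<^sub>F \<epsilon> in at_right 0. \<forall>\<omega>\<in>{a..b}.
         (\<omega> \<in> {\<omega>. \<epsilon> * circle_path \<epsilon> \<omega> \<le> x} \<longrightarrow> tan \<omega> \<in> approx_within (\<delta>1 \<epsilon>) (U / \<delta>1 \<epsilon>)) \<and>
         (tan \<omega> \<in> approx_within (\<delta>2 \<epsilon>) (L / \<delta>2 \<epsilon>) \<longrightarrow> \<omega> \<in> {\<omega>. \<epsilon> * circle_path \<epsilon> \<omega> \<le> x}))"
    by (intro exI[of _ U] exI[of _ L] exI[of _ "\<lambda>\<epsilon>. \<epsilon> / cos b"] exI[of _ "\<lambda>\<epsilon>. \<epsilon> / cos a"]) blast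
qed (use x in auto)

section \<open>The limit measure and its moments\<close>

definition free_path_law :: "real measure" where
  "free_path_law = density lborel (\<lambda>u. ennreal (indicator {0..1} u * (12 / pi\<^sup>2 * gap_profile u)))"

lemma sets_free_path_law [simp, measurable_cong]: "sets free_path_law = sets borel"
  by (simp add: free_path_law_def)

lemma space_free_path_law [simp]: "space free_path_law = UNIV"
  by (simp add: free_path_law_def)

lemma gap_density_measurable: "(\<lambda>u. indicator {0..1} u * (12 / pi\<^sup>2 * gap_profile u)) \<in> borel_measurable borel"
proof -
  have "(\<lambda>u. indicator {0..1} u *\<^sub>R gap_profile u) \<in> borel_measurable borel"
    by (intro borel_measurable_continuous_on_indicator continuous_on_gap_profile) auto
  then have "(\<lambda>u. 12 / pi\<^sup>2 * (indicator {0..1} u *\<^sub>R gap_profile u)) \<in> borel_measurable borel" by simp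
  then show ?thesis by (simp add: mult.left_commute)
qed

lemma gap_density_nonneg: "0 \<le> indicator {0..1} u * (12 / pi\<^sup>2 * gap_profile u)"
  using gap_profile_nonneg_le_1(1)[of u] by (auto split: split_indicator)

lemma nn_integral_continuous_Icc:
  fixes f :: "real \<Rightarrow> real"
  assumes "continuous_on {a..b} f" "\<And>x. x \<in> {a..b} \<Longrightarrow> 0 \<le> f x"
  shows "(\<integral>\<^sup>+x. ennreal (indicator {a..b} x * f x) \<partial>lborel) = ennreal (integral {a..b} f)"
proof -
  have si: "set_integrable lborel {a..b} f" by (rule borel_integrable_atLeastAtMost'[OF assms(1)])
  have "(\<integral>\<^sup>+x. ennreal (indicator {a..b} x * f x) \<partial>lborel) = ennreal (LINT x:{a..b}|lborel. f x)"
    unfolding set_lebesgue_integral_def real_scaleR_def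
    using si assms(2) by (intro nn_integral_eq_integral) (auto simp: set_integrable_def split: split_indicator)
  then show ?thesis using set_borel_integral_eq_integral(2)[OF si] by simp
qed

lemma emeasure_free_path_law_atMost: "emeasure free_path_law {..x} = ennreal (limit_cdf x)"
proof -
  let ?m = "min (max x 0) 1"
  have "emeasure free_path_law {..x} = (\<integral>\<^sup>+u. ennreal (indicator {0..1} u * (12 / pi\<^sup>2 * gap_profile u)) * indicator {..x} u \<partial>lborel)"
    unfolding free_path_law_def using gap_density_measurable by (intro emeasure_density) auto
  also have "\<dots> = (\<integral>\<^sup>+u. ennreal (indicator {0..?m} u * (12 / pi\<^sup>2 * gap_profile u)) \<partial>lborel)"
  proof (rule nn_integral_cong_AE)
    have "AE u in lborel. u \<noteq> (0::real)" by (rule AE_lborel_singleton)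
    then show "AE u in lborel. ennreal (indicator {0..1} u * (12 / pi\<^sup>2 * gap_profile u)) * indicator {..x} u
        = ennreal (indicator {0..?m} u * (12 / pi\<^sup>2 * gap_profile u))"
      by eventually_elim (auto split: split_indicator simp: min_def max_def)
  qed
  also have "\<dots> = ennreal (integral {0..?m} (\<lambda>u. 12 / pi\<^sup>2 * gap_profile u))"
    using gap_profile_nonneg_le_1(1)
    by (intro nn_integral_continuous_Icc continuous_intros continuous_on_subset[OF continuous_on_gap_profile]) auto
  finally show ?thesis by (simp add: limit_cdf_def)
qed

lemma real_distribution_free_path_law: "real_distribution free_path_law"
proof -
  have "emeasure free_path_law UNIV = (\<integral>\<^sup>+u. ennreal (indicator {0..1} u * (12 / pi\<^sup>2 * gap_profile u)) * indicator UNIV u \<partial>lborel)"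
    unfolding free_path_law_def using gap_density_measurable by (intro emeasure_density) auto
  also have "\<dots> = ennreal (integral {0..1} (\<lambda>u. 12 / pi\<^sup>2 * gap_profile u))"
    unfolding indicator_UNIV mult_1_right using gap_profile_nonneg_le_1(1)
    by (intro nn_integral_continuous_Icc continuous_intros continuous_on_gap_profile) auto
  also have "integral {0..1} (\<lambda>u. 12 / pi\<^sup>2 * gap_profile u) = limit_cdf 1"
    by (simp add: limit_cdf_def)
  finally have "prob_space free_path_law"
    by (intro prob_spaceI) (simp add: limit_cdf_1)
  then interpret prob_space free_path_law .
  show ?thesis by standard simp
qed

lemma cdf_free_path_law: "cdf free_path_law x = limit_cdf x"
  by (simp add: cdf_def measure_def emeasure_free_path_law_atMost limit_cdf_bounds)

lemma AE_free_path_law: "AE u in free_path_law. u \<in> {0..1}"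
  unfolding free_path_law_def using gap_density_measurable
  by (subst AE_density) (auto split: split_indicator intro!: AE_I2)

lemma integral_free_path_law:
  assumes "continuous_on {0..1} f" and fm': "(\<lambda>u. indicator {0..} u *\<^sub>R f u) \<in> borel_measurable borel"
  shows "(LINT u|free_path_law. indicator {0..} u *\<^sub>R f u) = 12 / pi\<^sup>2 * integral {0..1} (\<lambda>u. gap_profile u * f u)"
    (is "?L = ?R")
proof -
  have fm: "(\<lambda>u. indicator {0..1} u *\<^sub>R f u) \<in> borel_measurable borel"
    by (intro borel_measurable_continuous_on_indicator assms) auto
  have "?L = (LINT u|free_path_law. indicator {0..1} u *\<^sub>R f u)"
  proof (rule integral_cong_AE)
    show "AE u in free_path_law. indicator {0..} u *\<^sub>R f u = indicator {0..1} u *\<^sub>R f u"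
      using AE_free_path_law by eventually_elim (auto split: split_indicator)
  qed (use fm fm' in auto)
  also have "\<dots> = (LINT u|lborel. (indicator {0..1} u * (12 / pi\<^sup>2 * gap_profile u)) *\<^sub>R (indicator {0..1} u *\<^sub>R f u))"
    unfolding free_path_law_def using fm gap_density_measurable gap_density_nonneg
    by (intro integral_density) auto
  also have "\<dots> = (LINT u:{0..1}|lborel. 12 / pi\<^sup>2 * (gap_profile u * f u))"
    unfolding set_lebesgue_integral_def
    by (intro Bochner_Integration.integral_cong) (auto split: split_indicator)
  also have "\<dots> = integral {0..1} (\<lambda>u. 12 / pi\<^sup>2 * (gap_profile u * f u))"
    by (intro set_borel_integral_eq_integral(2) borel_integrable_atLeastAtMost' continuous_intros assms continuous_on_gap_profile)
  finally show ?thesis by simp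
qed


lemma geometric_ratio:
  fixes x :: real
  assumes "x \<noteq> 0"
  shows "(1 - (1 - x) ^ n) / x = (\<Sum>k<n. (1 - x) ^ k)"
  using assms sum_gp_strict[of "1 - x" n] by simp

text \<open>
  Integration by parts: \<open>P' x = x (1 - x)\<^bsup>n - 1\<^esup>\<close>, the logarithm has derivative \<open>- 1 / (x (1 - x))\<close>, and
  \<open>P x / (x (1 - x))\<close> is the difference of the two functions \<open>S\<close>. The boundary terms vanish: at \<open>1/2\<close> the logarithm is
  zero, and at \<open>0\<close> the factor \<open>x\<close> in \<open>P x\<close> beats it.
\<close>

lemma integral_log_weight:
  fixes n :: nat
  assumes n: "n \<ge> 1"
  defines "S \<equiv> \<lambda>m x. (\<Sum>k<m. (1 - x) ^ k) / (real m * (1 - x)) :: real"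
  shows "((\<lambda>x. x * (1 - x) ^ (n - 1) * ln ((1 - x) / x)) has_integral integral {0..1/2} (\<lambda>x. S n x - S (n + 1) x)) {0..1/2}"
proof -
  \<comment> \<open>Dividing by \<open>x\<close> beforehand gives expressions that are continuous at \<open>0\<close>.\<close>
  define R where "R m x = (\<Sum>k<m. (1 - x) ^ k) / real m" for m and x :: real
  define P where "P x = (1 - (1 - x) ^ n) / real n - (1 - (1 - x) ^ (n + 1)) / real (n + 1)" for x :: real
  define Q where "Q x = P x * ln ((1 - x) / x)" for x
  have PR: "P x = x * (R n x - R (n + 1) x)" for x
  proof (cases "x = 0")
    case False
    have "P x = x * ((1 - (1 - x) ^ n) / x) / real n - x * ((1 - (1 - x) ^ (n + 1)) / x) / real (n + 1)"
      using False by (simp add: P_def)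
    then show ?thesis unfolding geometric_ratio[OF False] by (simp add: R_def algebra_simps)
  qed (simp add: P_def)
  have cont_log: "continuous_on {0..1/2} (\<lambda>x::real. x * ln ((1 - x) / x))"
    unfolding continuous_on_eq_continuous_within
  proof
    fix x :: real assume x: "x \<in> {0..1/2}"
    show "continuous (at x within {0..1/2}) (\<lambda>x. x * ln ((1 - x) / x))"
    proof (cases "x = 0")
      case True
      have "((\<lambda>x::real. x * ln ((1 - x) / x)) \<longlongrightarrow> 0) (at_right 0)" by real_asymp
      moreover have "at 0 within {0..1/2} = at_right (0::real)" by (rule at_within_Icc_at_right) simp
      ultimately show ?thesis by (simp add: continuous_within True)
    next
      case False
      have "continuous_on {0<..<1} (\<lambda>x::real. x * ln ((1 - x) / x))" by (intro continuous_intros) auto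
      then have "isCont (\<lambda>x::real. x * ln ((1 - x) / x)) x"
        using x False by (auto simp: continuous_on_eq_continuous_at)
      then show ?thesis by (rule continuous_at_imp_continuous_at_within)
    qed
  qed
  have "continuous_on {0..1/2} (\<lambda>x. (R n x - R (n + 1) x) * (x * ln ((1 - x) / x)))"
    unfolding R_def using n by (intro continuous_on_mult cont_log continuous_intros) auto
  then have contQ: "continuous_on {0..1/2} Q" by (simp add: Q_def[abs_def] PR mult_ac)
  have "((\<lambda>x. x * (1 - x) ^ (n - 1) * ln ((1 - x) / x) - (S n x - S (n + 1) x)) has_integral (Q (1/2) - Q 0)) {0..1/2}"
  proof (rule fundamental_theorem_of_calculus_interior[OF _ contQ])
    fix x :: real assume x: "x \<in> {0<..<1/2}"
    have dP: "(P has_real_derivative x * (1 - x) ^ (n - 1)) (at x)"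
    proof -
      have d: "((\<lambda>x. (1 - (1 - x) ^ Suc k) / real (Suc k)) has_real_derivative (1 - x) ^ k) (at x)" for k
      proof -
        have "((\<lambda>x. 1 - (1 - x) ^ Suc k) has_real_derivative real (Suc k) * (1 - x) ^ k) (at x)"
          by (auto intro!: derivative_eq_intros simp del: power_Suc of_nat_Suc)
        from DERIV_cdivide[OF this, of "real (Suc k)"] show ?thesis by (simp del: of_nat_Suc power_Suc)
      qed
      obtain k where k: "n = Suc k" using n by (cases n) auto
      have "(P has_real_derivative (1 - x) ^ k - (1 - x) ^ Suc k) (at x)"
        unfolding P_def[abs_def] k Suc_eq_plus1[symmetric] by (intro DERIV_diff d)
      then show ?thesis by (simp add: k algebra_simps)
    qed
    have dln: "((\<lambda>x. ln ((1 - x) / x)) has_real_derivative - 1 / (x * (1 - x))) (at x)"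
      using x by (auto intro!: derivative_eq_intros simp: field_simps)
    have "(Q has_real_derivative x * (1 - x) ^ (n - 1) * ln ((1 - x) / x) + (- 1 / (x * (1 - x))) * P x) (at x)"
      unfolding Q_def[abs_def] using DERIV_mult[OF dP dln] by (simp add: mult_ac)
    moreover have "(- 1 / (x * (1 - x))) * P x = - (S n x - S (n + 1) x)"
      using x unfolding PR R_def S_def by (simp add: diff_divide_distrib)
    ultimately have "(Q has_real_derivative x * (1 - x) ^ (n - 1) * ln ((1 - x) / x) + - (S n x - S (n + 1) x)) (at x)"
      by (simp only:)
    then show "(Q has_vector_derivative x * (1 - x) ^ (n - 1) * ln ((1 - x) / x) - (S n x - S (n + 1) x)) (at x)"
      by (simp only: has_real_derivative_iff_has_vector_derivative diff_conv_add_uminus)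
  qed simp
  moreover have "Q (1/2) = 0" "Q 0 = 0" by (simp_all add: Q_def)
  moreover have "continuous_on {0..1/2} (\<lambda>x. S n x - S (n + 1) x)"
    unfolding S_def using n by (intro continuous_intros) auto
  then have "((\<lambda>x. S n x - S (n + 1) x) has_integral integral {0..1/2} (\<lambda>x. S n x - S (n + 1) x)) {0..1/2}"
    by (intro integrable_integral integrable_continuous_interval)
  ultimately have "((\<lambda>x. (x * (1 - x) ^ (n - 1) * ln ((1 - x) / x) - (S n x - S (n + 1) x)) + (S n x - S (n + 1) x))
     has_integral (0 - 0) + integral {0..1/2} (\<lambda>x. S n x - S (n + 1) x)) {0..1/2}"
    by (intro has_integral_add) simp_all
  then show ?thesis by simp
qed

lemma integral_reflect_half:
  fixes f :: "real \<Rightarrow> real"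
  assumes "continuous_on {1/2..1} f"
  shows "integral {1/2..1} f = integral {0..1/2} (\<lambda>x. f (1 - x))"
proof -
  have cont: "continuous_on {0..1/2} (\<lambda>x. f (1 - x))"
    by (rule continuous_on_compose2[OF assms]) (auto intro!: continuous_intros)
  have "integral {1/2..1} f = (LINT x|lborel. indicator {1/2..1} x *\<^sub>R f x)"
    using set_borel_integral_eq_integral(2)[OF borel_integrable_atLeastAtMost'[OF assms]]
    by (simp add: set_lebesgue_integral_def)
  also have "\<dots> = (LINT x|lborel. indicator {1/2..1} (1 - x) *\<^sub>R f (1 - x))"
    by (subst lborel_integral_real_affine[of "-1" _ 1]) auto
  also have "\<dots> = (LINT x|lborel. indicator {0..1/2} x *\<^sub>R f (1 - x))"
    by (intro Bochner_Integration.integral_cong) (auto split: split_indicator)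
  also have "\<dots> = integral {0..1/2} (\<lambda>x. f (1 - x))"
    using set_borel_integral_eq_integral(2)[OF borel_integrable_atLeastAtMost'[OF cont]]
    by (simp add: set_lebesgue_integral_def)
  finally show ?thesis .
qed

text \<open>
  The part of the integral over \<open>[1/2, 1]\<close> is reflected to \<open>[0, 1/2]\<close>, where \<open>u = 1 - x\<close> gives
  \<open>u\<^sup>n gap_profile u = x (1 - x)\<^bsup>n - 1\<^esup> (1 + ln ((1 - x) / x))\<close>.
\<close>

theorem moment_const_eq:
  assumes n: "n \<ge> 1"
  shows "12 / pi\<^sup>2 * integral {0..1} (\<lambda>u. gap_profile u * u ^ n) = moment_const n"
proof -
  define S where "S m x = (\<Sum>k<m. (1 - x) ^ k) / (real m * (1 - x))" for m and x :: real
  let ?\<psi> = "\<lambda>x::real. x * (x ^ (n - 1) + (1 - x) ^ (n - 1))"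
  let ?L = "\<lambda>x::real. x * (1 - x) ^ (n - 1) * ln ((1 - x) / x)"
  let ?g = "\<lambda>u. gap_profile u * u ^ n"
  have cont: "continuous_on {0..1} ?g" by (intro continuous_intros continuous_on_gap_profile)
  have contS: "continuous_on {0..1/2} (\<lambda>x. S n x - S (n + 1) x)"
    unfolding S_def using n by (intro continuous_intros) auto
  have cont\<psi>: "continuous_on {0..1/2} ?\<psi>" by (intro continuous_intros)
  have "integral {0..1} ?g = integral {0..1/2} ?g + integral {1/2..1} ?g"
    using cont by (intro Henstock_Kurzweil_Integration.integral_combine[symmetric] integrable_continuous_interval) auto
  also have "integral {1/2..1} ?g = integral {0..1/2} (\<lambda>x. ?g (1 - x))"
    by (intro integral_reflect_half continuous_on_subset[OF cont]) auto
  also have "integral {0..1/2} ?g + integral {0..1/2} (\<lambda>x. ?g (1 - x)) = integral {0..1/2} (\<lambda>x. ?g x + ?g (1 - x))"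
    by (intro Henstock_Kurzweil_Integration.integral_add[symmetric] integrable_continuous_interval
        continuous_on_subset[OF cont] continuous_on_compose2[OF cont]) (auto intro!: continuous_intros)
  also have "\<dots> = integral {0..1/2} (\<lambda>x. ?\<psi> x + ?L x)"
  proof (rule integral_cong)
    fix x :: real assume x: "x \<in> {0..1/2}"
    have pow: "y ^ n = y * y ^ (n - 1)" for y :: real using n by (simp add: power_eq_if)
    have "?g x = x * x ^ (n - 1)" using x by (simp add: gap_profile_def pow)
    moreover have "?g (1 - x) = x * (1 - x) ^ (n - 1) + ?L x"
    proof -
      consider "x = 0" | "x = 1/2" | "0 < x" "x < 1/2" using x by fastforce
      then show ?thesis
      proof cases
        case 2
        show ?thesis unfolding 2 by (simp add: gap_profile_def pow)
      next
        case 3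
        have cancel: "u / c * (1 + l) * (c * y) = u * y + u * y * l" if "c \<noteq> 0" for u c l y :: real
          using that by (simp add: field_simps)
        have "gap_profile (1 - x) = x / (1 - x) * (1 + ln ((1 - x) / x))" using 3 by (simp add: gap_profile_def)
        then show ?thesis using 3 by (simp only: pow[of "1 - x"]) (rule cancel, simp)
      qed (simp add: gap_profile_def)
    qed
    ultimately show "?g x + ?g (1 - x) = ?\<psi> x + ?L x" by (simp add: algebra_simps)
  qed
  also have "\<dots> = integral {0..1/2} ?\<psi> + integral {0..1/2} (\<lambda>x. S n x - S (n + 1) x)"
    using integral_log_weight[OF n] unfolding S_def
    by (intro integral_unique has_integral_add integrable_integral integrable_continuous_interval cont\<psi>) auto
  also have "\<dots> = integral {0..1/2} (\<lambda>x. ?\<psi> x + (S n x - S (n + 1) x))"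
    by (intro Henstock_Kurzweil_Integration.integral_add[symmetric] integrable_continuous_interval cont\<psi> contS)
  also have "\<dots> = (LINT x:{0..1/2}|lborel. ?\<psi> x + (S n x - S (n + 1) x))"
    by (intro set_borel_integral_eq_integral(2)[symmetric] borel_integrable_atLeastAtMost' continuous_on_add cont\<psi> contS)
  also have "\<dots> = (LINT x:{0..1/2}|lborel. ?\<psi> x + (1 - (1 - x) ^ n) / (real n * x * (1 - x))
        - (1 - (1 - x) ^ (n + 1)) / (real (n + 1) * x * (1 - x)))"
    unfolding set_lebesgue_integral_def
  proof (rule integral_cong_AE)
    have "AE x in lborel. x \<noteq> (0::real)" by (rule AE_lborel_singleton)
    then show "AE x in lborel. indicator {0..1/2} x *\<^sub>R (?\<psi> x + (S n x - S (n + 1) x))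
       = indicator {0..1/2} x *\<^sub>R (?\<psi> x + (1 - (1 - x) ^ n) / (real n * x * (1 - x))
        - (1 - (1 - x) ^ (n + 1)) / (real (n + 1) * x * (1 - x)))"
    proof eventually_elim
      case (elim x)
      have "S m x = (1 - (1 - x) ^ m) / (real m * x * (1 - x))" for m
        unfolding S_def geometric_ratio[OF elim, symmetric] by (simp add: mult_ac)
      then show ?case by simp
    qed
  qed (unfold S_def, measurable)
  finally show ?thesis by (simp add: moment_const_def)
qed

section \<open>Convergence of the free path laws\<close>

text \<open>
  A limit at \<open>0\<close> from the right can be tested along sequences, where weak convergence is convergence of distribution functions.
\<close>

lemma weakly_tendsto_at_right_if_cdf:
  fixes \<mu> :: "real \<Rightarrow> real measure"
  assumes \<mu>: "\<And>\<epsilon>. real_distribution (\<mu> \<epsilon>)" and M: "real_distribution M"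
    and cdf: "\<And>x. ((\<lambda>\<epsilon>. cdf (\<mu> \<epsilon>) x) \<longlongrightarrow> cdf M x) (at_right 0)"
  shows "weakly_tendsto \<mu> M (at_right 0)"
  unfolding weakly_tendsto_def
proof (intro allI impI)
  fix f :: "real \<Rightarrow> real" assume f: "continuous_on UNIV f \<and> bounded (range f)"
  show "((\<lambda>\<epsilon>. LINT t|\<mu> \<epsilon>. f t) \<longlongrightarrow> (LINT t|M. f t)) (at_right 0)"
    unfolding tendsto_at_iff_sequentially
  proof (intro allI impI)
    fix X :: "nat \<Rightarrow> real" assume X: "\<forall>i. X i \<in> {0<..} - {0}" "X \<longlonglongrightarrow> 0"
    have "0 < X i" for i using X(1) by simp
    then have "filterlim X (at_right 0) sequentially"
      using X(2) by (auto simp: filterlim_at less_imp_neq[symmetric])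
    then have "weak_conv_m (\<lambda>n. \<mu> (X n)) M"
      unfolding weak_conv_m_def weak_conv_def by (auto intro: filterlim_compose[OF cdf])
    then have "weakly_tendsto (\<lambda>n. \<mu> (X n)) M sequentially"
      using weakly_tendsto_sequentially_iff[of "\<lambda>n. \<mu> (X n)" M] \<mu> M by blast
    then show "((\<lambda>\<epsilon>. LINT t|\<mu> \<epsilon>. f t) \<circ> X) \<longlonglongrightarrow> (LINT t|M. f t)"
      using f by (auto simp: weakly_tendsto_def o_def)
  qed
qed

lemma interval_endpoints:
  fixes I :: "real set"
  assumes I: "is_interval I" "I \<subseteq> {0..pi/4}" "0 < measure lborel I"
  obtains \<alpha> \<beta> where "0 \<le> \<alpha>" "\<alpha> < \<beta>" "\<beta> \<le> pi/4" "{\<alpha><..<\<beta>} \<subseteq> I" "I \<subseteq> {\<alpha>..\<beta>}"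
proof -
  have ne: "I \<noteq> {}" using I(3) by auto
  have bdd: "bdd_below I" "bdd_above I" using I(2) by (auto intro: bdd_below_mono bdd_above_mono)
  have sub: "I \<subseteq> {Inf I..Sup I}" using bdd by (auto intro: cInf_lower cSup_upper)
  have open_sub: "{Inf I<..<Sup I} \<subseteq> I"
  proof
    fix x assume "x \<in> {Inf I<..<Sup I}"
    then obtain u v where "u \<in> I" "u < x" "v \<in> I" "x < v"
      using cInf_less_iff[OF ne bdd(1)] less_cSup_iff[OF ne bdd(2)] by auto
    then show "x \<in> I" using mem_is_interval_1_I[OF I(1), of u v x] by simp
  qed
  have "0 \<le> Inf I" using ne I(2) by (intro cInf_greatest) auto
  moreover have "Sup I \<le> pi/4" using ne I(2) by (intro cSup_least) auto
  moreover have "Inf I < Sup I"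
  proof (rule ccontr)
    assume "\<not> Inf I < Sup I"
    then have "measure lborel {Inf I..Sup I} = 0" by (cases "Inf I = Sup I") auto
    moreover have "measure lborel I \<le> measure lborel {Inf I..Sup I}"
      using sub real_interval_borel_measurable[OF I(1)] by (intro measure_mono_fmeasurable) auto
    ultimately show False using I(3) by simp
  qed
  ultimately show thesis using that open_sub sub by blast
qed

lemma AE_interval_endpoints:
  assumes "{\<alpha><..<\<beta>} \<subseteq> I" "I \<subseteq> {\<alpha>..\<beta>::real}"
  shows "AE x in lborel. x \<in> I \<longleftrightarrow> x \<in> {\<alpha>..\<beta>}"
proof -
  have "AE x in lborel. x \<noteq> \<alpha>" "AE x in lborel. x \<noteq> \<beta>" by (rule AE_lborel_singleton)+
  then show ?thesis by eventually_elim (use assms in force)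
qed

lemma measure_interval_Int:
  assumes "{\<alpha><..<\<beta>} \<subseteq> I" "I \<subseteq> {\<alpha>..\<beta>::real}" "I \<in> sets borel" "E \<in> sets borel"
  shows "measure lborel (I \<inter> E) = measure lborel (E \<inter> {\<alpha>..\<beta>})"
  using AE_interval_endpoints[OF assms(1,2)] assms(3,4) by (intro measure_eq_AE) (auto elim!: eventually_mono)

lemma set_lebesgue_integral_interval:
  fixes f :: "real \<Rightarrow> real"
  assumes "{\<alpha><..<\<beta>} \<subseteq> I" "I \<subseteq> {\<alpha>..\<beta>}" "I \<in> sets borel" and f: "continuous_on {\<alpha>..\<beta>} f"
  shows "(LINT x:I|lborel. f x) = integral {\<alpha>..\<beta>} f"
proof -
  have si: "set_integrable lborel {\<alpha>..\<beta>} f" by (rule borel_integrable_atLeastAtMost'[OF f])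
  have "(LINT x:I|lborel. f x) = (LINT x:{\<alpha>..\<beta>}|lborel. f x)"
    unfolding set_lebesgue_integral_def
  proof (rule integral_cong_AE)
    have m: "(\<lambda>x. indicator {\<alpha>..\<beta>} x *\<^sub>R f x) \<in> borel_measurable lborel" using si by (auto simp: set_integrable_def)
    show "(\<lambda>x. indicator {\<alpha>..\<beta>} x *\<^sub>R f x) \<in> borel_measurable lborel" by (rule m)
    have "(\<lambda>x. indicator I x *\<^sub>R (indicator {\<alpha>..\<beta>} x *\<^sub>R f x)) \<in> borel_measurable lborel"
      using assms(3) by (intro borel_measurable_scaleR[OF borel_measurable_indicator m]) auto
    moreover have "indicator I x *\<^sub>R (indicator {\<alpha>..\<beta>} x *\<^sub>R f x) = indicator I x *\<^sub>R f x" for x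
      using assms(2) by (auto split: split_indicator)
    ultimately show "(\<lambda>x. indicator I x *\<^sub>R f x) \<in> borel_measurable lborel" by (simp only:)
    show "AE x in lborel. indicator I x *\<^sub>R f x = indicator {\<alpha>..\<beta>} x *\<^sub>R f x"
      using AE_interval_endpoints[OF assms(1,2)] by eventually_elim (auto split: split_indicator)
  qed
  then show ?thesis using set_borel_integral_eq_integral(2)[OF si] by simp
qed

lemma integral_uniform_measure:
  fixes f :: "real \<Rightarrow> real"
  assumes I: "I \<in> sets borel" "emeasure lborel I \<noteq> \<infinity>" "0 < measure lborel I" and f: "f \<in> borel_measurable borel"
  shows "(LINT x|uniform_measure lborel I. f x) = (LINT x:I|lborel. f x) / measure lborel I"
proof -
  have e: "emeasure lborel I = ennreal (measure lborel I)"
    using I by (simp add: emeasure_eq_ennreal_measure)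
  have "uniform_measure lborel I = density lborel (\<lambda>x. ennreal (indicator I x / measure lborel I))"
    unfolding uniform_measure_def e
    by (intro arg_cong[where f="density lborel"] ext)
       (use I(3) in \<open>auto simp: divide_ennreal[symmetric] ennreal_indicator split: split_indicator\<close>)
  then have "(LINT x|uniform_measure lborel I. f x) = (LINT x|lborel. (indicator I x / measure lborel I) *\<^sub>R f x)"
    using I f by (simp only:) (intro integral_density, auto)
  then show ?thesis by (simp add: set_lebesgue_integral_def)
qed

lemma free_path_law_moment:
  assumes "n \<ge> 1"
  shows "(LINT u|free_path_law. indicator {0..} u *\<^sub>R u ^ n) = moment_const n"
proof -
  have "continuous_on {0..1} (\<lambda>u::real. u ^ n)" by (intro continuous_intros)
  from integral_free_path_law[OF this] show ?thesis by (simp add: moment_const_eq[OF assms, simplified])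
qed

context
  fixes I :: "real set"
  assumes I: "is_interval I" "I \<subseteq> {0..pi/4}" "0 < measure lborel I"
begin

lemma I_borel [measurable]: "I \<in> sets borel"
  using I(1) by (rule real_interval_borel_measurable)

lemma I_finite: "emeasure lborel I \<noteq> \<infinity>" "emeasure lborel I \<noteq> 0"
proof -
  have "emeasure lborel I \<le> emeasure lborel {0..pi/4}" using I(2) by (intro emeasure_mono) auto
  then show "emeasure lborel I \<noteq> \<infinity>" by (auto simp: top_unique)
  show "emeasure lborel I \<noteq> 0" using I(3) by (auto simp: measure_def)
qed

lemma prob_space_uniform_I: "prob_space (uniform_measure lborel I)"
  using I_finite by (intro prob_space_uniform_measure) auto

lemma real_distribution_law:
  assumes X [measurable]: "X \<in> borel_measurable borel"
  shows "real_distribution (distr (uniform_measure lborel I) borel X)"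
proof -
  interpret U: prob_space "uniform_measure lborel I" by (rule prob_space_uniform_I)
  interpret D: prob_space "distr (uniform_measure lborel I) borel X"
    by (intro U.prob_space_distr) simp
  show ?thesis by standard simp
qed

lemma cdf_law:
  assumes X: "X \<in> borel_measurable borel"
  shows "cdf (distr (uniform_measure lborel I) borel X) x = measure lborel (I \<inter> {\<omega>. X \<omega> \<le> x}) / measure lborel I"
proof -
  have "cdf (distr (uniform_measure lborel I) borel X) x = measure (uniform_measure lborel I) {\<omega>. X \<omega> \<le> x}"
    unfolding cdf_def using X by (subst measure_distr) (auto intro!: arg_cong[where f="measure _"])
  also have "\<dots> = measure lborel (I \<inter> {\<omega>. X \<omega> \<le> x}) / measure lborel I"
    using I_finite X by (subst measure_uniform_measure) auto
  finally show ?thesis .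
qed

text \<open>
  Both families of laws have this shape. Negative arguments \<open>x\<close> are treated separately, since the convergence of the
  measures of direction sets is available for \<open>x \<ge> 0\<close> only.
\<close>

lemma cdf_law_tendsto:
  fixes X F :: "real \<Rightarrow> real \<Rightarrow> real"
  assumes X: "\<And>\<epsilon>. X \<epsilon> \<in> borel_measurable borel"
    and nonneg: "\<And>\<epsilon> \<omega>. 0 < \<epsilon> \<Longrightarrow> \<epsilon> < 1/2 \<Longrightarrow> \<omega> \<in> I \<Longrightarrow> 0 \<le> X \<epsilon> \<omega>"
    and lim: "\<And>\<alpha> \<beta>. 0 \<le> x \<Longrightarrow> 0 \<le> \<alpha> \<Longrightarrow> \<alpha> \<le> \<beta> \<Longrightarrow> \<beta> \<le> pi/4 \<Longrightarrow>
      ((\<lambda>\<epsilon>. measure lborel ({\<omega>. X \<epsilon> \<omega> \<le> x} \<inter> {\<alpha>..\<beta>})) \<longlongrightarrow> integral {\<alpha>..\<beta>} (\<lambda>\<omega>. F x \<omega>)) (at_right 0)"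
    and F: "continuous_on {0..pi/4} (F x)" "\<And>\<omega>. \<omega> \<in> I \<Longrightarrow> x < 0 \<Longrightarrow> F x \<omega> = 0"
  shows "((\<lambda>\<epsilon>. cdf (distr (uniform_measure lborel I) borel (X \<epsilon>)) x) \<longlongrightarrow> (LINT \<omega>:I|lborel. F x \<omega>) / measure lborel I) (at_right 0)"
proof (cases "0 \<le> x")
  case True
  obtain \<alpha> \<beta> where ab: "0 \<le> \<alpha>" "\<alpha> < \<beta>" "\<beta> \<le> pi/4" "{\<alpha><..<\<beta>} \<subseteq> I" "I \<subseteq> {\<alpha>..\<beta>}"
    using interval_endpoints[OF I] .
  have E: "{\<omega>. X \<epsilon> \<omega> \<le> x} \<in> sets borel" for \<epsilon> using X[of \<epsilon>] by measurable
  have "(LINT \<omega>:I|lborel. F x \<omega>) = integral {\<alpha>..\<beta>} (F x)"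
    using ab by (intro set_lebesgue_integral_interval continuous_on_subset[OF F(1)]) auto
  then show ?thesis
    unfolding cdf_law[OF X] measure_interval_Int[OF ab(4,5) I_borel E]
    using lim[OF True, of \<alpha> \<beta>] ab I(3) by (intro tendsto_divide tendsto_const) auto
next
  case False
  have "\<forall>\<^sub>F \<epsilon>::real in at_right 0. 0 < \<epsilon>" by (rule eventually_at_right_less)
  moreover have "\<forall>\<^sub>F \<epsilon>::real in at_right 0. \<epsilon> < 1/2" by (rule eventually_at_rightI[of 0 "1/2"]) auto
  ultimately have "\<forall>\<^sub>F \<epsilon> in at_right 0. cdf (distr (uniform_measure lborel I) borel (X \<epsilon>)) x = 0"
  proof eventually_elim
    case (elim \<epsilon>)
    have "I \<inter> {\<omega>. X \<epsilon> \<omega> \<le> x} = {}" using nonneg[OF elim] False by force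
    then show ?case by (simp add: cdf_law[OF X])
  qed
  then have "((\<lambda>\<epsilon>. cdf (distr (uniform_measure lborel I) borel (X \<epsilon>)) x) \<longlongrightarrow> 0) (at_right 0)"
    by (rule tendsto_eventually)
  moreover have "(LINT \<omega>:I|lborel. F x \<omega>) = (LINT \<omega>:I|lborel. 0)"
    using F(2) False by (intro set_lebesgue_integral_cong) auto
  then have "(LINT \<omega>:I|lborel. F x \<omega>) = 0" by (simp add: set_lebesgue_integral_def)
  ultimately show ?thesis by simp
qed

lemma circle_law_tendsto: "weakly_tendsto (circle_law I) free_path_law (at_right 0)"
proof (rule weakly_tendsto_at_right_if_cdf)
  show "real_distribution (circle_law I \<epsilon>)" for \<epsilon>
    unfolding circle_law_def by (rule real_distribution_law) measurable
  show "real_distribution free_path_law" by (rule real_distribution_free_path_law)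
  fix x
  have "((\<lambda>\<epsilon>. cdf (circle_law I \<epsilon>) x) \<longlongrightarrow> (LINT \<omega>:I|lborel. limit_cdf x) / measure lborel I) (at_right 0)"
    unfolding circle_law_def
  proof (rule cdf_law_tendsto)
    show "(\<lambda>\<omega>. \<epsilon> * circle_path \<epsilon> \<omega>) \<in> borel_measurable borel" for \<epsilon> by measurable
    show "0 \<le> \<epsilon> * circle_path \<epsilon> \<omega>" if "0 < \<epsilon>" "\<epsilon> < 1/2" "\<omega> \<in> I" for \<epsilon> \<omega>
      by (rule circle_path_nonneg[OF I that])
    show "((\<lambda>\<epsilon>. measure lborel ({\<omega>. \<epsilon> * circle_path \<epsilon> \<omega> \<le> x} \<inter> {\<alpha>..\<beta>}))
        \<longlongrightarrow> integral {\<alpha>..\<beta>} (\<lambda>\<omega>. limit_cdf x)) (at_right 0)"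
      if "0 \<le> x" "0 \<le> \<alpha>" "\<alpha> \<le> \<beta>" "\<beta> \<le> pi/4" for \<alpha> \<beta>
      by (rule circle_directions_tendsto[OF that])
  qed (auto simp: limit_cdf_outside)
  also have "(LINT \<omega>:I|lborel. limit_cdf x) = measure lborel I * limit_cdf x"
    using I_finite by (simp add: set_lebesgue_integral_def)
  finally show "((\<lambda>\<epsilon>. cdf (circle_law I \<epsilon>) x) \<longlongrightarrow> cdf free_path_law x) (at_right 0)"
    using I(3) by (simp add: cdf_free_path_law)
qed

definition cross_limit_law :: "real measure" where
  "cross_limit_law = distr (uniform_measure lborel I \<Otimes>\<^sub>M free_path_law) borel (\<lambda>(\<omega>, y). y / cos \<omega>)"

lemma path_quotient_measurable: "(\<lambda>p. snd p / cos (fst p)) \<in> borel_measurable (uniform_measure lborel I \<Otimes>\<^sub>M free_path_law)"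
proof -
  have "cos \<in> borel_measurable (borel :: real measure)"
    by (intro borel_measurable_continuous_onI continuous_intros)
  then have "(\<lambda>p. cos (fst p)) \<in> borel_measurable (uniform_measure lborel I \<Otimes>\<^sub>M free_path_law)"
    by (rule measurable_compose[rotated]) measurable
  then show ?thesis by (intro borel_measurable_divide) measurable
qed

lemma cos_lower_bound: "\<omega> \<in> I \<Longrightarrow> 1 / sqrt 2 \<le> cos \<omega>" "\<omega> \<in> I \<Longrightarrow> 0 < cos \<omega>"
proof -
  assume "\<omega> \<in> I"
  then have \<omega>: "0 \<le> \<omega>" "\<omega> \<le> pi/4" using I(2) by auto
  show "0 < cos \<omega>" by (rule cos_pos_angle[OF \<omega>])
  have "cos (pi/4) \<le> cos \<omega>" using \<omega> by (intro cos_monotone_0_pi_le) auto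
  moreover have "sqrt 2 * sqrt 2 = (2::real)" by simp
  then have "1 / sqrt 2 = sqrt 2 / (2::real)" by (simp add: field_simps del: real_sqrt_mult_self)
  ultimately show "1 / sqrt 2 \<le> cos \<omega>" by (simp add: cos_45)
qed

lemma AE_uniform_I: "AE \<omega> in uniform_measure lborel I. \<omega> \<in> I"
  by (intro AE_uniform_measureI) auto

lemma pair_prob_space_direction_denominator: "pair_prob_space (uniform_measure lborel I) free_path_law"
proof -
  interpret U: prob_space "uniform_measure lborel I" by (rule prob_space_uniform_I)
  interpret F: real_distribution free_path_law by (rule real_distribution_free_path_law)
  show ?thesis ..
qed

lemma real_distribution_cross_limit_law: "real_distribution cross_limit_law"
proof -
  interpret P: pair_prob_space "uniform_measure lborel I" free_path_law by (rule pair_prob_space_direction_denominator)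
  interpret D: prob_space cross_limit_law
    unfolding cross_limit_law_def using path_quotient_measurable by (intro P.prob_space_distr) (simp add: case_prod_beta')
  show ?thesis by standard (simp add: cross_limit_law_def)
qed

lemma AE_direction_denominator: "AE p in uniform_measure lborel I \<Otimes>\<^sub>M free_path_law. fst p \<in> I \<and> snd p \<in> {0..1}"
proof -
  interpret P: pair_prob_space "uniform_measure lborel I" free_path_law by (rule pair_prob_space_direction_denominator)
  have "AE \<omega> in uniform_measure lborel I. AE y in free_path_law. \<omega> \<in> I \<and> y \<in> {0..1}"
    using AE_uniform_I by eventually_elim (use AE_free_path_law in auto)
  moreover have "{p \<in> space (uniform_measure lborel I \<Otimes>\<^sub>M free_path_law). fst p \<in> I \<and> snd p \<in> {0..1}}
      \<in> sets (uniform_measure lborel I \<Otimes>\<^sub>M free_path_law)"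
    by measurable
  ultimately show ?thesis
    by (intro P.AE_pair_measure) simp_all
qed

lemma path_quotient_bounds:
  assumes "\<omega> \<in> I" "y \<in> {0..1}"
  shows "y / cos \<omega> \<in> {0..sqrt 2}"
proof -
  have "y / cos \<omega> \<le> 1 / (1 / sqrt 2)"
    using assms cos_lower_bound[OF assms(1)] by (intro frac_le) auto
  then show ?thesis using assms cos_lower_bound[OF assms(1)] by simp
qed

lemma AE_cross_limit_law: "AE t in cross_limit_law. t \<in> {0..sqrt 2}"
  unfolding cross_limit_law_def
proof (subst AE_distr_iff)
  show "AE p in uniform_measure lborel I \<Otimes>\<^sub>M free_path_law. (case p of (\<omega>, y) \<Rightarrow> y / cos \<omega>) \<in> {0..sqrt 2}"
    using AE_direction_denominator by eventually_elim (use path_quotient_bounds in auto)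
qed (use path_quotient_measurable in \<open>auto simp: case_prod_beta'\<close>)

lemma cdf_cross_limit_law:
  "cdf cross_limit_law x = (LINT \<omega>:I|lborel. limit_cdf (x * cos \<omega>)) / measure lborel I"
proof -
  interpret U: prob_space "uniform_measure lborel I" by (rule prob_space_uniform_I)
  interpret F: real_distribution free_path_law by (rule real_distribution_free_path_law)
  let ?A = "(\<lambda>p. snd p / cos (fst p)) -` {..x} \<inter> space (uniform_measure lborel I \<Otimes>\<^sub>M free_path_law)"
  have fm: "(\<lambda>\<omega>. limit_cdf (x * cos \<omega>)) \<in> borel_measurable borel"
    by (intro borel_measurable_continuous_onI continuous_on_compose2[OF continuous_on_limit_cdf] continuous_intros) auto
  have A: "?A \<in> sets (uniform_measure lborel I \<Otimes>\<^sub>M free_path_law)"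
    using path_quotient_measurable by (rule measurable_sets) simp
  have "emeasure cross_limit_law {..x} = emeasure (uniform_measure lborel I \<Otimes>\<^sub>M free_path_law) ?A"
    unfolding cross_limit_law_def case_prod_beta' using path_quotient_measurable by (subst emeasure_distr) auto
  also have "\<dots> = (\<integral>\<^sup>+\<omega>. emeasure free_path_law (Pair \<omega> -` ?A) \<partial>uniform_measure lborel I)"
    by (rule F.emeasure_pair_measure_alt[OF A])
  also have "\<dots> = (\<integral>\<^sup>+\<omega>. ennreal (limit_cdf (x * cos \<omega>)) \<partial>uniform_measure lborel I)"
  proof (rule nn_integral_cong_AE)
    show "AE \<omega> in uniform_measure lborel I. emeasure free_path_law (Pair \<omega> -` ?A) = ennreal (limit_cdf (x * cos \<omega>))"
      using AE_uniform_I
    proof eventually_elim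
      case (elim \<omega>)
      have "Pair \<omega> -` ?A = {..x * cos \<omega>}"
        using cos_lower_bound(2)[OF elim] by (auto simp: space_pair_measure divide_le_eq)
      then show ?case by (simp add: emeasure_free_path_law_atMost)
    qed
  qed
  also have "\<dots> = ennreal (LINT \<omega>|uniform_measure lborel I. limit_cdf (x * cos \<omega>))"
  proof (rule nn_integral_eq_integral)
    show "integrable (uniform_measure lborel I) (\<lambda>\<omega>. limit_cdf (x * cos \<omega>))"
      using fm limit_cdf_bounds by (intro U.integrable_const_bound[of _ 1]) auto
  qed (auto simp: limit_cdf_bounds)
  also have "(LINT \<omega>|uniform_measure lborel I. limit_cdf (x * cos \<omega>)) = (LINT \<omega>:I|lborel. limit_cdf (x * cos \<omega>)) / measure lborel I"
    using I_finite I(3) fm by (intro integral_uniform_measure) auto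
  finally have "emeasure cross_limit_law {..x} = ennreal ((LINT \<omega>:I|lborel. limit_cdf (x * cos \<omega>)) / measure lborel I)" .
  moreover have "0 \<le> (LINT \<omega>:I|lborel. limit_cdf (x * cos \<omega>)) / measure lborel I"
    unfolding set_lebesgue_integral_def
    by (intro divide_nonneg_nonneg Bochner_Integration.integral_nonneg) (auto simp: limit_cdf_bounds)
  ultimately show ?thesis by (simp add: cdf_def measure_def)
qed

lemma cross_law_tendsto: "weakly_tendsto (cross_law I) cross_limit_law (at_right 0)"
proof (rule weakly_tendsto_at_right_if_cdf)
  show "real_distribution (cross_law I \<epsilon>)" for \<epsilon>
    unfolding cross_law_def by (rule real_distribution_law) measurable
  show "real_distribution cross_limit_law" by (rule real_distribution_cross_limit_law)
  fix x
  show "((\<lambda>\<epsilon>. cdf (cross_law I \<epsilon>) x) \<longlongrightarrow> cdf cross_limit_law x) (at_right 0)"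
    unfolding cross_law_def cdf_cross_limit_law
  proof (rule cdf_law_tendsto)
    show "(\<lambda>\<omega>. \<epsilon> * cross_path \<epsilon> \<omega>) \<in> borel_measurable borel" for \<epsilon> by measurable
    show "0 \<le> \<epsilon> * cross_path \<epsilon> \<omega>" if "0 < \<epsilon>" "\<epsilon> < 1/2" "\<omega> \<in> I" for \<epsilon> \<omega>
      by (rule cross_path_nonneg[OF I that])
    show "continuous_on {0..pi/4} (\<lambda>\<omega>. limit_cdf (x * cos \<omega>))"
      by (intro continuous_on_compose2[OF continuous_on_limit_cdf] continuous_intros) auto
    show "limit_cdf (x * cos \<omega>) = 0" if "\<omega> \<in> I" "x < 0" for \<omega>
      using that cos_lower_bound(2)[OF that(1)] by (intro limit_cdf_outside(1)) (simp add: mult_nonpos_nonneg)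
  qed (rule cross_directions_tendsto)
qed

lemma cross_limit_law_moment:
  assumes n: "n \<ge> 1"
  shows "(LINT t:{0..}|cross_limit_law. t ^ n) = moment_const n / measure lborel I * (LINT x:I|lborel. 1 / cos x ^ n)"
proof -
  interpret P: pair_prob_space "uniform_measure lborel I" free_path_law by (rule pair_prob_space_direction_denominator)
  let ?U = "uniform_measure lborel I"
  let ?h = "\<lambda>p :: real \<times> real. indicator {0..} (snd p / cos (fst p)) *\<^sub>R (snd p / cos (fst p)) ^ n :: real"
  have hm: "?h \<in> borel_measurable (?U \<Otimes>\<^sub>M free_path_law)"
    using path_quotient_measurable by measurable
  have "(LINT t:{0..}|cross_limit_law. t ^ n) = (LINT p|(?U \<Otimes>\<^sub>M free_path_law). ?h p)"
    unfolding cross_limit_law_def set_lebesgue_integral_def case_prod_beta'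
    using path_quotient_measurable by (intro integral_distr) auto
  also have "\<dots> = (LINT \<omega>|?U. LINT y|free_path_law. ?h (\<omega>, y))"
  proof (rule P.integral_fst'[symmetric])
    show "integrable (?U \<Otimes>\<^sub>M free_path_law) ?h"
    proof (rule P.integrable_const_bound[OF _ hm])
      show "AE p in ?U \<Otimes>\<^sub>M free_path_law. norm (?h p) \<le> sqrt 2 ^ n"
        using AE_direction_denominator
      proof eventually_elim
        case (elim p)
        then have "snd p / cos (fst p) \<in> {0..sqrt 2}" by (intro path_quotient_bounds) auto
        then show ?case by (auto intro!: power_mono)
      qed
    qed
  qed
  also have "\<dots> = (LINT \<omega>|?U. moment_const n * (1 / cos \<omega> ^ n))"
  proof (rule integral_cong_AE)
    show "(\<lambda>\<omega>. LINT y|free_path_law. ?h (\<omega>, y)) \<in> borel_measurable ?U"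
      using hm by (intro P.M2.borel_measurable_lebesgue_integral) (simp add: case_prod_beta')
    show "(\<lambda>\<omega>. moment_const n * (1 / cos \<omega> ^ n)) \<in> borel_measurable ?U"
      by (intro borel_measurable_times borel_measurable_divide borel_measurable_power)
         (auto intro!: borel_measurable_continuous_onI continuous_intros)
    show "AE \<omega> in ?U. (LINT y|free_path_law. ?h (\<omega>, y)) = moment_const n * (1 / cos \<omega> ^ n)"
      using AE_uniform_I
    proof eventually_elim
      case (elim \<omega>)
      have "?h (\<omega>, y) = (indicator {0..} y *\<^sub>R y ^ n) * (1 / cos \<omega> ^ n)" for y
        using cos_lower_bound(2)[OF elim] by (auto split: split_indicator simp: power_divide zero_le_divide_iff)
      then show ?case by (simp only: integral_mult_left_zero free_path_law_moment[OF n])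
    qed
  qed
  also have "\<dots> = (LINT \<omega>:I|lborel. moment_const n * (1 / cos \<omega> ^ n)) / measure lborel I"
    using I_finite I(3)
    by (intro integral_uniform_measure borel_measurable_times borel_measurable_divide borel_measurable_power)
         (auto intro!: borel_measurable_continuous_onI continuous_intros)
  finally show ?thesis by (simp only: set_integral_mult_right times_divide_eq_left)
qed

end

theorem corollary1p3:
  shows "\<exists>\<mu>circ. probability_on {0..sqrt 2} \<mu>circ \<and>
    (\<forall>n\<ge>1. (LINT t:{0..}|\<mu>circ. t ^ n) = moment_const n) \<and>
    (\<forall>I. is_interval I \<and> I \<subseteq> {0..pi/4} \<and> 0 < measure lborel I \<longrightarrow>
      weakly_tendsto (circle_law I) \<mu>circ (at_right 0) \<and>
      (\<exists>\<mu>cross. probability_on {0..sqrt 2} \<mu>cross \<and>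
        weakly_tendsto (cross_law I) \<mu>cross (at_right 0) \<and>
        (\<forall>n\<ge>1. (LINT t:{0..}|\<mu>cross. t ^ n)
           = moment_const n / measure lborel I * (LINT x:I|lborel. 1 / (cos x) ^ n))))"
proof (rule exI[of _ free_path_law], intro conjI allI impI)
  have "1 \<le> sqrt (2::real)" by simp
  then have "{0..1::real} \<subseteq> {0..sqrt 2}" by (intro atLeastatMost_subset_iff[THEN iffD2]) blast
  then have "AE u in free_path_law. u \<in> {0..sqrt 2}"
    by (intro eventually_mono[OF AE_free_path_law]) blast
  then show "probability_on {0..sqrt 2} free_path_law"
    by (simp add: probability_on_def real_distribution_free_path_law)
  show "(LINT t:{0..}|free_path_law. t ^ n) = moment_const n" if "1 \<le> n" for n
    unfolding set_lebesgue_integral_def by (rule free_path_law_moment[OF that])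
  fix I :: "real set" assume "is_interval I \<and> I \<subseteq> {0..pi/4} \<and> 0 < measure lborel I"
  then have I: "is_interval I" "I \<subseteq> {0..pi/4}" "0 < measure lborel I" by auto
  show "weakly_tendsto (circle_law I) free_path_law (at_right 0)" by (rule circle_law_tendsto[OF I])
  show "\<exists>\<mu>cross. probability_on {0..sqrt 2} \<mu>cross \<and>
        weakly_tendsto (cross_law I) \<mu>cross (at_right 0) \<and>
        (\<forall>n\<ge>1. (LINT t:{0..}|\<mu>cross. t ^ n)
           = moment_const n / measure lborel I * (LINT x:I|lborel. 1 / (cos x) ^ n))"
    using real_distribution_cross_limit_law[OF I] AE_cross_limit_law[OF I] cross_law_tendsto[OF I] cross_limit_law_moment[OF I]
    by (intro exI[of _ "cross_limit_law I"]) (simp add: probability_on_def)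
qed

end
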